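(* Fix $\epsilon\in(0,1)$. Then there exist constants $c_1=c_1(\epsilon)>0$ and $c_2=c_2(\epsilon)>0$ such that the following holds. Let $\mathrm{w}=(w_k)_{k\ge0}$ be a sequence of non-negative real weights with $w_0>0$, with $w_k>0$ for some $k\ge2$, and with $\frac{w_1\tau}{\Phi(\tau)}<1-\epsilon$. Then for any $t>1$ and any $n$ large enough (depending on $\mathrm{w}$) with $Z_n(\mathrm{w})>0$, $$\mathbf{P}\left(\mathrm{ht}(\mathrm{T}_{\mathrm{w},n})\ge t n^{1/2}\right)<c_1\exp(-c_2t^2).$$
   Context: A plane tree is a rooted, unlabeled finite tree in which the set of children of each node carries a (left-to-right) total order; $v(\mathrm{t})$ is its vertex set and $d_{\mathrm{t}}(v)$ is the number of children of $v$. The weight of $\mathrm{t}$ is $\mathrm{w}(\mathrm{t})=\prod_{v\in v(\mathrm{t})}w_{d_{\mathrm{t}}(v)}$, and $Z_n=Z_n(\mathrm{w})=\sum_{\mathrm{t}:|v(\mathrm{t})|=n}\mathrm{w}(\mathrm{t})$ (sum over plane trees with $n$ vertices). If $Z_n>0$, the simply generated tree $\mathrm{T}_{\mathrm{w},n}$ is the random plane tree with $n$ vertices with $\mathbf{P}(\mathrm{T}_{\mathrm{w},n}=\mathrm{t})=\mathrm{w}(\mathrm{t})/Z_n$. The height $\mathrm{ht}$ is the maximum graph distance from the root to a vertex. Let $\Phi(z)=\sum_{k\ge0}w_kz^k$ and let $\rho=\sup\{s\ge0:\Phi(s)<\infty\}\in[0,\infty]$. For $s\geq 0$ with $\Phi(s)<\infty$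 let $\Psi(s)=\frac{s\Phi'(s)}{\Phi(s)}=\frac{\sum_k kw_ks^k}{\sum_k w_ks^k}\in[0,\infty]$; if $\Phi(\rho)=\infty$ (including $\rho=\infty$) let $\Psi(\rho)=\lim_{s\uparrow\rho}\Psi(s)$ ($\Psi$ is strictly increasing on $[0,\rho)$). Let $\nu=\Psi(\rho)$. Let $\tau=\rho$ if $\nu\le1$ and $\tau=\Psi^{-1}(1)\in[0,\rho)$ if $\nu>1$. *)

theory Defs
  imports "HOL-Probability.Probability"
begin

datatype ptree = Node (children: "ptree list")

text \<open>
  Vertices are Ulam--Harris words: the root is the empty word, and \<open>i # v\<close> is the vertex \<open>v\<close> of the
  subtree at the \<open>i\<close>-th child of the root (counted from 0). The children of \<open>v\<close> are thus the vertices
  \<open>v @ [i]\<close>.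
\<close>

inductive is_vertex :: "ptree \<Rightarrow> nat list \<Rightarrow> bool" where
  "is_vertex t []"
| "i < length (children t) \<Longrightarrow> is_vertex (children t ! i) v \<Longrightarrow> is_vertex t (i # v)"

definition vertices :: "ptree \<Rightarrow> nat list set" where
  "vertices t = {v. is_vertex t v}"

definition num_children :: "ptree \<Rightarrow> nat list \<Rightarrow> nat" where
  "num_children t v = card {i. v @ [i] \<in> vertices t}"

definition weight :: "(nat \<Rightarrow> real) \<Rightarrow> ptree \<Rightarrow> real" where
  "weight w t = (\<Prod>v\<in>vertices t. w (num_children t v))"

definition edges :: "ptree \<Rightarrow> (nat list \<times> nat list) set" where
  "edges t = {(u, v). u \<in> vertices t \<and> v \<in> vertices t \<and> (\<exists>i. v = u @ [i] \<or> u = v @ [i])}"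

definition graph_dist :: "ptree \<Rightarrow> nat list \<Rightarrow> nat list \<Rightarrow> nat" where
  "graph_dist t u v = (LEAST n. (u, v) \<in> edges t ^^ n)"

definition height :: "ptree \<Rightarrow> nat" where
  "height t = Max (graph_dist t [] ` vertices t)"

definition trees :: "nat \<Rightarrow> ptree set" where
  "trees n = {t. card (vertices t) = n}"

definition partition_function :: "(nat \<Rightarrow> real) \<Rightarrow> nat \<Rightarrow> real" where
  "partition_function w n = (\<Sum>t\<in>trees n. weight w t)"

text \<open>Only meaningful if \<open>w\<close> is non-negative and \<open>partition_function w n > 0\<close>;
  see \<open>pmf_simply_generated_tree\<close> below.\<close>

definition simply_generated_tree :: "(nat \<Rightarrow> real) \<Rightarrow> nat \<Rightarrow> ptree pmf" where
  "simply_generated_tree w n =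
     embed_pmf (\<lambda>t. if t \<in> trees n then weight w t / partition_function w n else 0)"

lemma vertices_Node:
  "vertices (Node ts) = insert [] (\<Union>i<length ts. (#) i ` vertices (ts ! i))"
proof (intro set_eqI)
  fix v show "v \<in> vertices (Node ts) \<longleftrightarrow> v \<in> insert [] (\<Union>i<length ts. (#) i ` vertices (ts ! i))"
    unfolding vertices_def mem_Collect_eq is_vertex.simps[of "Node ts" v] by force
qed

lemma finite_vertices: "finite (vertices t)"
  by (induction t) (auto simp: vertices_Node)

lemma num_children_root: "num_children (Node ts) [] = length ts"
proof -
  have "{i. [i] \<in> vertices (Node ts)} = {..<length ts}"
    by (auto simp: vertices_Node) (auto simp: vertices_def intro: is_vertex.intros)
  then show ?thesis by (simp add: num_children_def)
qed

lemma card_vertices_Node: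
  "card (vertices (Node ts)) = Suc (\<Sum>i<length ts. card (vertices (ts ! i)))"
proof -
  have "card (\<Union>i<length ts. (#) i ` vertices (ts ! i)) = (\<Sum>i<length ts. card ((#) i ` vertices (ts ! i)))"
    by (rule card_UN_disjoint) (auto simp: finite_vertices)
  also have "\<dots> = (\<Sum>i<length ts. card (vertices (ts ! i)))"
    by (intro sum.cong refl card_image) (auto simp: inj_on_def)
  finally show ?thesis
    unfolding vertices_Node by (subst card_insert_disjoint) (auto simp: finite_vertices)
qed

lemma finite_trees: "finite (trees n)"
proof -
  have "finite {t. card (vertices t) \<le> n}"
  proof (induction n)
    case 0
    have "card (vertices t) \<noteq> 0" for t
      by (cases t) (simp add: card_vertices_Node)
    then have "{t. card (vertices t) \<le> 0} = {}" by blast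
    then show ?case by (simp only: finite.emptyI)
  next
    case (Suc n)
    let ?A = "{t. card (vertices t) \<le> n}"
    have "{t. card (vertices t) \<le> Suc n} \<subseteq> Node ` {ts. set ts \<subseteq> ?A \<and> length ts \<le> n}"
    proof
      fix t assume "t \<in> {t. card (vertices t) \<le> Suc n}"
      then obtain ts where t: "t = Node ts" and le: "(\<Sum>i<length ts. card (vertices (ts ! i))) \<le> n"
        by (cases t) (auto simp: card_vertices_Node)
      have pos: "1 \<le> card (vertices s)" for s
        by (cases s) (simp add: card_vertices_Node)
      have "length ts = (\<Sum>i<length ts. 1)" by simp
      also have "\<dots> \<le> (\<Sum>i<length ts. card (vertices (ts ! i)))"
        by (rule sum_mono) (rule pos)
      finally have "length ts \<le> n" using le by simp
      moreover have "card (vertices (ts ! i)) \<le> n" if "i < length ts" for i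
        using member_le_sum[of i "{..<length ts}" "\<lambda>i. card (vertices (ts ! i))"] that le by simp
      ultimately show "t \<in> Node ` {ts. set ts \<subseteq> ?A \<and> length ts \<le> n}"
        unfolding t by (intro imageI) (auto simp: in_set_conv_nth)
    qed
    then show ?case
      using finite_lists_length_le[OF Suc.IH] finite_subset by blast
  qed
  then show ?thesis
    by (rule rev_finite_subset) (auto simp: trees_def)
qed

lemma pmf_simply_generated_tree:
  assumes "\<And>k. w k \<ge> 0" and "partition_function w n > 0"
  shows "pmf (simply_generated_tree w n) t =
           (if t \<in> trees n then weight w t / partition_function w n else 0)"
  unfolding simply_generated_tree_def
proof (rule pmf_embed_pmf)
  let ?f = "\<lambda>t. if t \<in> trees n then weight w t / partition_function w n else 0"
  have nonneg: "weight w t \<ge> 0" for t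
    unfolding weight_def by (intro prod_nonneg) (simp add: assms)
  show "?f t \<ge> 0" for t
    using assms nonneg by simp
  have "(\<integral>\<^sup>+t. ennreal (?f t) \<partial>count_space UNIV)
      = (\<integral>\<^sup>+t. ennreal (weight w t / partition_function w n) \<partial>count_space (trees n))"
    by (subst nn_integral_count_space_indicator)
       (auto intro!: nn_integral_cong simp: indicator_def)
  also have "\<dots> = ennreal (\<Sum>t\<in>trees n. weight w t / partition_function w n)"
    using assms(2) nonneg by (simp add: nn_integral_count_space_finite finite_trees)
  also have "(\<Sum>t\<in>trees n. weight w t / partition_function w n) = 1"
    using assms(2) by (simp add: partition_function_def flip: sum_divide_distrib)
  finally show "(\<integral>\<^sup>+t. ennreal (?f t) \<partial>count_space UNIV) = 1" by simp
qed

text \<open>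
  The generating function and the quantities derived from it take values in \<open>[0, \<infinity>]\<close>, represented
  by \<^typ>\<open>ennreal\<close>. Note that \<open>0 * \<infinity> = 0\<close>, so \<open>Phi w \<infinity> = \<infinity>\<close> as soon as some weight of positive index
  is positive.
\<close>

definition Phi :: "(nat \<Rightarrow> real) \<Rightarrow> ennreal \<Rightarrow> ennreal" where
  "Phi w s = (\<Sum>k. ennreal (w k) * s ^ k)"

definition rho :: "(nat \<Rightarrow> real) \<Rightarrow> ennreal" where
  "rho w = Sup {s. s < \<infinity> \<and> Phi w s < \<infinity>}"

definition Psi_ratio :: "(nat \<Rightarrow> real) \<Rightarrow> ennreal \<Rightarrow> ennreal" where
  "Psi_ratio w s = (\<Sum>k. of_nat k * ennreal (w k) * s ^ k) / Phi w s"

text \<open>The second case is only intended for \<open>s = rho w\<close>; if \<open>w 0 > 0\<close> and some \<open>w k\<close> with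
  \<open>k > 0\<close> is positive, \<open>Psi_ratio w\<close> is increasing below \<open>rho w\<close>, so the limit exists.\<close>

definition Psi :: "(nat \<Rightarrow> real) \<Rightarrow> ennreal \<Rightarrow> ennreal" where
  "Psi w s = (if Phi w s < \<infinity> then Psi_ratio w s else Lim (at_left s) (Psi_ratio w))"

definition nu :: "(nat \<Rightarrow> real) \<Rightarrow> ennreal" where
  "nu w = Psi w (rho w)"

definition tau :: "(nat \<Rightarrow> real) \<Rightarrow> ennreal" where
  "tau w = (if nu w \<le> 1 then rho w else (THE s. s < rho w \<and> Psi w s = 1))"

end

(*
  Trees with a given multiset of degrees are counted by words through the cycle lemma. For a uniform
  tree with k vertices and given degrees, the expected proportion of vertices of depth at least L is
  E[xi_1 ... xi_L], where xi is a uniform ordering of the degrees; by Maclaurin's inequality this is at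
  most exp(-c L^2 / k) if a positive proportion of the degrees is 0.

  To pass from typical vertices to the height without losing a power of n, follow a longest path from
  the root and cut it at the dyadic sizes m = n / 2^i of the subtrees. If the piece between the sizes m
  and m / 2 has length more than L, then the maximal subtree of size at most m that it meets has more
  than m / 2 vertices of relative depth at least L. Such maximal subtrees are disjoint and uniform given
  their degrees, so the piece is this long with probability at most 2^(i + 1) exp(-c L^2 / m), and
  L = const 2^(-i/4) t n^(1/2) makes this summable.

  Finally, a simply generated tree is a mixture of uniform trees with given degrees. It has a positive
  proportion of leaves, up to exponentially small probability, because the tilt tau maximises
  y / Phi(y), so that no tilt makes a single child more likely than 1 - epsilon.
*)

theory Submission
  imports Defs "HOL-Combinatorics.Multiset_Permutations"
    "HOL-Computational_Algebra.Formal_Power_Series" "HOL-Real_Asymp.Real_Asymp"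
begin

text \<open>A union bound over vertices would cost a factor n, which exp(-c t^2) cannot pay for
  bounded t; hence the scales, at which a long piece of path already makes a fixed fraction of a
  subtree deep. The allotted lengths shrink by a ratio \<beta> per halving of the size: their sum
  stays bounded if \<beta> < 1, and length squared over size grows if \<beta> > 2^(-1/2). The value
  2^(-1/4) is the geometric middle.

  The obstacle is a shortage of leaves: a tree with nearly all degrees 1 is nearly a path. Leaves
  are needed twice, in the whole tree and in every subtree that is used, since a subtree has its own
  degrees. The passage to subtrees is an exponential estimate with a polynomial union bound,
  affordable because these subtrees have at least order n^(1/3) vertices.

  Apart from being constant on degree classes, the weights enter only through the leaves of the
  whole tree. The prefactor of that estimate depends on w, but half of its exponential rate absorbs
  the prefactor for large n, so the final constants depend on \<epsilon> alone.\<close>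

section \<open>Sampling without replacement\<close>

text \<open>\<open>ordered_esym y L c\<close> is \<open>L!\<close> times the elementary symmetric polynomial of degree \<open>L\<close> in the
  values \<open>y x\<close>, \<open>x \<in># c\<close>.\<close>

primrec ordered_esym :: "('a \<Rightarrow> real) \<Rightarrow> nat \<Rightarrow> 'a multiset \<Rightarrow> real" where
  "ordered_esym y 0 = (\<lambda>c. 1)"
| "ordered_esym y (Suc L) = (\<lambda>c. \<Sum>x\<in>#c. y x * ordered_esym y L (c - {#x#}))"

lemma sum_mset_nonneg_real:
  fixes f :: "'a \<Rightarrow> real"
  assumes "\<And>x. x \<in># c \<Longrightarrow> f x \<ge> 0"
  shows "(\<Sum>x\<in>#c. f x) \<ge> 0"
  using sum_mset_mono[of c "\<lambda>_. 0" f] assms by simp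

lemma ordered_esym_nonneg:
  assumes "\<And>x. y x \<ge> 0"
  shows "ordered_esym y L c \<ge> 0"
  by (induction L arbitrary: c) (auto intro!: sum_mset_nonneg_real mult_nonneg_nonneg assms)

text \<open>Of the ordered choices of L elements, those that use \<open>a\<close> put it in one of L
  positions. At \<open>L = 0\<close> the truncated \<open>L - 1\<close> is harmless, since the
  factor \<open>L\<close> vanishes.\<close>

lemma ordered_esym_add_mset:
  "ordered_esym y L (add_mset a c) = ordered_esym y L c + L * y a * ordered_esym y (L - 1) c"
proof (induction L arbitrary: c)
  case (Suc L)
  have "(\<Sum>x\<in>#c. y x * ordered_esym y L (add_mset a c - {#x#}))
      = (\<Sum>x\<in>#c. y x * ordered_esym y L (c - {#x#})
          + L * y a * (y x * ordered_esym y (L - 1) (c - {#x#})))"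
  proof (intro arg_cong[of _ _ sum_mset] image_mset_cong)
    fix x assume "x \<in># c"
    then have "add_mset a c - {#x#} = add_mset a (c - {#x#})" by simp
    then show "y x * ordered_esym y L (add_mset a c - {#x#}) = y x * ordered_esym y L (c - {#x#})
          + L * y a * (y x * ordered_esym y (L - 1) (c - {#x#}))"
      by (simp only: Suc.IH) (simp add: algebra_simps)
  qed
  also have "\<dots> = ordered_esym y (Suc L) c
      + L * y a * (\<Sum>x\<in>#c. y x * ordered_esym y (L - 1) (c - {#x#}))"
    by (simp add: sum_mset.distrib flip: sum_mset_distrib_left)
  also have "L * y a * (\<Sum>x\<in>#c. y x * ordered_esym y (L - 1) (c - {#x#})) = L * y a * ordered_esym y L c"
    by (cases L) auto
  finally show ?case by (simp add: algebra_simps)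
qed auto

text \<open>Chebyshev's sum inequality: half of the double sum of
  \<open>(f u - f v) * (g u - g v)\<close> is the difference of the two sides.\<close>

lemma chebyshev_sum_mset:
  fixes f g :: "'a \<Rightarrow> real"
  assumes "\<And>u v. u \<in># c \<Longrightarrow> v \<in># c \<Longrightarrow> (f u - f v) * (g u - g v) \<ge> 0"
  shows "(\<Sum>u\<in>#c. f u) * (\<Sum>u\<in>#c. g u) \<le> size c * (\<Sum>u\<in>#c. f u * g u)"
proof -
  have "0 \<le> (\<Sum>u\<in>#c. \<Sum>v\<in>#c. (f u - f v) * (g u - g v))"
    using assms by (intro sum_mset_nonneg_real) auto
  also have "\<dots> = (\<Sum>u\<in>#c. size c * (f u * g u) - f u * (\<Sum>v\<in>#c. g v) - g u * (\<Sum>v\<in>#c. f v)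
      + (\<Sum>v\<in>#c. f v * g v))"
  proof (intro arg_cong[of _ _ sum_mset] image_mset_cong)
    fix u
    have "(\<Sum>v\<in>#c. (f u - f v) * (g u - g v))
        = (\<Sum>v\<in>#c. f u * g u + (- f u) * g v + (- g u) * f v + f v * g v)"
      by (intro arg_cong[of _ _ sum_mset] image_mset_cong) (simp add: algebra_simps)
    also have "\<dots> = size c * (f u * g u) - f u * (\<Sum>v\<in>#c. g v) - g u * (\<Sum>v\<in>#c. f v)
      + (\<Sum>v\<in>#c. f v * g v)"
      by (simp only: sum_mset.distrib flip: sum_mset_distrib_left) (simp add: sum_mset_constant)
    finally show "(\<Sum>v\<in>#c. (f u - f v) * (g u - g v))
        = size c * (f u * g u) - f u * (\<Sum>v\<in>#c. g v) - g u * (\<Sum>v\<in>#c. f v)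
      + (\<Sum>v\<in>#c. f v * g v)" .
  qed
  also have "\<dots> = (\<Sum>u\<in>#c. size c * (f u * g u) + (- (\<Sum>v\<in>#c. g v)) * f u + (- (\<Sum>v\<in>#c. f v)) * g u
      + (\<Sum>v\<in>#c. f v * g v))"
    by (simp add: algebra_simps)
  also have "\<dots> = 2 * (size c * (\<Sum>u\<in>#c. f u * g u) - (\<Sum>u\<in>#c. f u) * (\<Sum>u\<in>#c. g u))"
    by (simp only: sum_mset.distrib flip: sum_mset_distrib_left) (simp add: algebra_simps)
  finally show ?thesis by simp
qed

text \<open>One step of Maclaurin's inequality. Multiplying by the sum of \<open>y\<close> either
  extends a choice by a new element or repeats one of its L elements. The repeated part is bounded
  below by Chebyshev's inequality, because \<open>?g\<close> is ordered like \<open>y\<close>: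
  \<open>?g u - ?g v\<close> is a nonnegative multiple of \<open>y u - y v\<close>.\<close>

lemma ordered_esym_Suc_le:
  assumes y: "\<And>x. y x \<ge> 0"
  shows "size c * ordered_esym y (Suc L) c \<le> (real (size c) - L) * (\<Sum>x\<in>#c. y x) * ordered_esym y L c"
proof (cases L)
  case 0
  then show ?thesis by simp
next
  case (Suc M)
  let ?g = "\<lambda>u. y u * ordered_esym y M (c - {#u#})"
  have remove: "ordered_esym y L c = ordered_esym y L (c - {#u#}) + L * ?g u" if "u \<in># c" for u
    using ordered_esym_add_mset[of y L u "c - {#u#}"] that Suc by simp
  have "(\<Sum>u\<in>#c. y u) * (\<Sum>u\<in>#c. ?g u) \<le> size c * (\<Sum>u\<in>#c. y u * ?g u)"
  proof (rule chebyshev_sum_mset)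
    fix u v assume u: "u \<in># c" and v: "v \<in># c"
    show "0 \<le> (y u - y v) * (?g u - ?g v)"
    proof (cases "u = v")
      case False
      obtain d where "c = add_mset u (add_mset v d)"
        using False u v by (metis insert_noteq_member multi_member_split)
      then have "c - {#u#} = add_mset v d" "c - {#v#} = add_mset u d" by auto
      then have "?g u - ?g v = (y u - y v) * ordered_esym y M d"
        by (simp add: ordered_esym_add_mset algebra_simps)
      then have "(y u - y v) * (?g u - ?g v) = (y u - y v)\<^sup>2 * ordered_esym y M d"
        by (simp add: power2_eq_square)
      then show ?thesis using ordered_esym_nonneg[of y, OF y] by simp
    qed simp
  qed
  then have cheb: "(\<Sum>u\<in>#c. y u) * ordered_esym y L c \<le> size c * (\<Sum>u\<in>#c. y u * ?g u)"
    using Suc by simp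
  have "(\<Sum>u\<in>#c. y u) * ordered_esym y L c = (\<Sum>u\<in>#c. y u * ordered_esym y L c)"
    by (simp add: sum_mset_distrib_right)
  also have "\<dots> = (\<Sum>u\<in>#c. y u * ordered_esym y L (c - {#u#}) + L * (y u * ?g u))"
    by (intro arg_cong[of _ _ sum_mset] image_mset_cong) (simp only: remove, simp add: algebra_simps)
  also have "\<dots> = ordered_esym y (Suc L) c + L * (\<Sum>u\<in>#c. y u * ?g u)"
    by (simp add: sum_mset.distrib flip: sum_mset_distrib_left)
  finally have "size c * ordered_esym y (Suc L) c
      = size c * (\<Sum>u\<in>#c. y u) * ordered_esym y L c - L * (size c * (\<Sum>u\<in>#c. y u * ?g u))"
    by (simp add: algebra_simps)
  also have "\<dots> \<le> size c * (\<Sum>u\<in>#c. y u) * ordered_esym y L c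
      - L * ((\<Sum>u\<in>#c. y u) * ordered_esym y L c)"
    using mult_left_mono[OF cheb, of "real L"] by simp
  finally show ?thesis by (simp add: algebra_simps)
qed

lemma ordered_esym_eq_0:
  "size c < L \<Longrightarrow> ordered_esym y L c = 0"
proof (induction L arbitrary: c)
  case (Suc L)
  have "(\<Sum>x\<in>#c. y x * ordered_esym y L (c - {#x#})) = (\<Sum>x\<in>#c. 0)"
  proof (intro arg_cong[of _ _ sum_mset] image_mset_cong)
    fix x assume "x \<in># c"
    then have "size (c - {#x#}) < size c" by (rule size_Diff1_less)
    with Suc show "y x * ordered_esym y L (c - {#x#}) = 0" by simp
  qed
  then show ?case by simp
qed simp

lemma maclaurin_inequality:
  assumes y: "\<And>x. y x \<ge> 0" and L: "L \<le> size c" and ne: "c \<noteq> {#}"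
  shows "ordered_esym y L c \<le> (\<Prod>i<L. real (size c) - real i) * ((\<Sum>x\<in>#c. y x) / size c) ^ L"
  using L
proof (induction L)
  case (Suc L)
  let ?N = "real (size c)" and ?S = "\<Sum>x\<in>#c. y x"
  have N: "?N > 0" using ne by (simp add: nonempty_has_size)
  have "ordered_esym y (Suc L) c \<le> ((?N - L) * (?S / ?N)) * ordered_esym y L c"
    using ordered_esym_Suc_le[of y c L, OF y] N by (simp add: field_simps)
  also have "\<dots> \<le> ((?N - L) * (?S / ?N)) * ((\<Prod>i<L. ?N - real i) * (?S / ?N) ^ L)"
  proof (rule mult_left_mono)
    show "ordered_esym y L c \<le> (\<Prod>i<L. ?N - real i) * (?S / ?N) ^ L" using Suc by simp
    have "?S \<ge> 0" using y by (rule sum_mset_nonneg_real)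
    then show "0 \<le> (?N - L) * (?S / ?N)" using Suc.prems by simp
  qed
  finally show ?case by (simp only: prod.lessThan_Suc power_Suc mult_ac)
qed simp

lemma ordered_esym_filter_nonzero:
  "ordered_esym y L (filter_mset (\<lambda>x. y x \<noteq> 0) c) = ordered_esym y L c"
proof (induction c arbitrary: L)
  case (add a c)
  then show ?case by (cases "y a = 0") (simp_all add: ordered_esym_add_mset)
qed simp

text \<open>The expectation of \<open>y \<xi>\<^sub>1 \<cdots> y \<xi>\<^sub>L\<close> for a uniformly random enumeration \<open>\<xi>\<close> of \<open>c\<close>.\<close>

definition sample_mean :: "('a \<Rightarrow> real) \<Rightarrow> nat \<Rightarrow> 'a multiset \<Rightarrow> real" where
  "sample_mean y L c = ordered_esym y L c / (\<Prod>i<L. real (size c) - real i)"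

lemma sample_mean_0 [simp]: "sample_mean y 0 c = 1"
  by (simp add: sample_mean_def)

text \<open>Conditioning on the first draw. This recursion will match the reading of a forest from
  its first letter.\<close>

lemma sample_mean_Suc:
  assumes "c \<noteq> {#}"
  shows "sample_mean y (Suc L) c = (\<Sum>x\<in>#c. y x * sample_mean y L (c - {#x#})) / size c"
proof -
  let ?P = "\<Prod>i<L. real (size c - 1) - real i"
  have pos: "size c > 0" using assms by (simp add: nonempty_has_size)
  have P: "(\<Prod>i<Suc L. real (size c) - real i) = size c * ?P"
    unfolding prod.lessThan_Suc_shift using pos by (simp add: algebra_simps of_nat_diff)
  have "(\<Sum>x\<in>#c. y x * sample_mean y L (c - {#x#})) = (\<Sum>x\<in>#c. y x * ordered_esym y L (c - {#x#}) * (1 / ?P))"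
    by (intro arg_cong[of _ _ sum_mset] image_mset_cong)
       (simp add: sample_mean_def size_Diff_submset)
  also have "\<dots> = ordered_esym y (Suc L) c / ?P"
    by (simp only: ordered_esym.simps sum_mset_distrib_right[symmetric]) simp
  finally show ?thesis by (simp only: sample_mean_def P) (simp add: field_simps)
qed

lemma sample_mean_le_power:
  assumes "\<And>x. y x \<ge> 0" and "L \<le> size c"
  shows "sample_mean y L c \<le> ((\<Sum>x\<in>#c. y x) / size c) ^ L"
proof (cases "c = {#}")
  case False
  have "(\<Prod>i<L. real (size c) - real i) > 0" using assms(2) by (intro prod_pos) auto
  then show ?thesis unfolding sample_mean_def
    using maclaurin_inequality[OF assms False] by (simp add: field_simps)
qed (use assms in auto)

lemma sum_mset_eq_sum_count:
  fixes f :: "'a \<Rightarrow> real"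
  shows "(\<Sum>x\<in>#c. f x) = (\<Sum>x\<in>set_mset c. count c x * f x)"
proof (induction c)
  case (add a c)
  have "(\<Sum>x\<in>set_mset (add_mset a c). count (add_mset a c) x * f x)
     = (\<Sum>x\<in>set_mset (add_mset a c). (if x = a then f a else 0) + count c x * f x)"
    by (intro sum.cong) (auto simp: algebra_simps)
  also have "\<dots> = f a + (\<Sum>x\<in>set_mset (add_mset a c). count c x * f x)"
    by (simp add: sum.distrib)
  also have "(\<Sum>x\<in>set_mset (add_mset a c). count c x * f x) = (\<Sum>x\<in>set_mset c. count c x * f x)"
    by (intro sum.mono_neutral_right) (auto simp: not_in_iff)
  finally show ?case using add by simp
qed simp

lemma sum_permutations_of_multiset:
  assumes "c \<noteq> {#}"
  shows "(\<Sum>xs\<in>permutations_of_multiset c. f xs)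
    = (\<Sum>x\<in>set_mset c. \<Sum>xs\<in>permutations_of_multiset (c - {#x#}). f (x # xs))"
proof -
  have "(\<Sum>xs\<in>permutations_of_multiset c. f xs)
      = (\<Sum>x\<in>set_mset c. sum f ((#) x ` permutations_of_multiset (c - {#x#})))"
    by (subst permutations_of_multiset_nonempty[OF assms], rule sum.UNION_disjoint) auto
  then show ?thesis by (simp add: sum.reindex)
qed

abbreviation num_words :: "'a multiset \<Rightarrow> real" where
  "num_words c \<equiv> real (card (permutations_of_multiset c))"

text \<open>The first letter of a uniformly random word is \<open>x\<close> with probability
  \<open>count c x / size c\<close>; sums over distinct letters thereby become sums with
  multiplicity.\<close>

lemma sum_num_words_remove:
  fixes f :: "'a \<Rightarrow> real"
  shows "(\<Sum>x\<in>set_mset c. f x * num_words (c - {#x#})) = num_words c * (\<Sum>x\<in>#c. f x) / size c"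
proof -
  have "(\<Sum>x\<in>set_mset c. f x * num_words (c - {#x#}))
      = (\<Sum>x\<in>set_mset c. num_words c / size c * (count c x * f x))"
    by (intro sum.cong refl) (simp add: real_card_permutations_of_multiset_remove)
  also have "\<dots> = num_words c / size c * (\<Sum>x\<in>#c. f x)"
    by (simp only: sum_mset_eq_sum_count sum_distrib_left)
  finally show ?thesis by simp
qed

lemma sum_prod_list_take:
  "L \<le> size c \<Longrightarrow>
    (\<Sum>xs\<in>permutations_of_multiset c. prod_list (map y (take L xs))) = num_words c * sample_mean y L c"
proof (induction L arbitrary: c)
  case (Suc L)
  then have ne: "c \<noteq> {#}" by auto
  have "(\<Sum>xs\<in>permutations_of_multiset c. prod_list (map y (take (Suc L) xs)))
      = (\<Sum>x\<in>set_mset c. y x * sample_mean y L (c - {#x#}) * num_words (c - {#x#}))"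
    unfolding sum_permutations_of_multiset[OF ne]
  proof (intro sum.cong refl)
    fix x assume x: "x \<in># c"
    have "L \<le> size (c - {#x#})" using Suc.prems x by (simp add: size_Diff_submset)
    then show "(\<Sum>xs\<in>permutations_of_multiset (c - {#x#}). prod_list (map y (take (Suc L) (x # xs))))
        = y x * sample_mean y L (c - {#x#}) * num_words (c - {#x#})"
      using Suc.IH[of "c - {#x#}"] by (simp flip: sum_distrib_left)
  qed
  also have "\<dots> = num_words c * sample_mean y (Suc L) c"
    unfolding sum_num_words_remove sample_mean_Suc[OF ne] by simp
  finally show ?case .
qed simp

text \<open>Only the proportion of zeros matters: replacing the positive entries by their average
  increases the expectation.\<close>

lemma sample_mean_le_exp:
  fixes c :: "nat multiset" and \<delta> :: real
  assumes c: "sum_mset c \<le> size c" and \<delta>: "0 \<le> \<delta>" and zeros: "\<delta> * size c \<le> count c 0"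
  shows "sample_mean real L c \<le> exp (- \<delta> * (real L * (real L - 1)) / (2 * real (size c)))"
proof -
  define b where "b = filter_mset (\<lambda>x. real x \<noteq> 0) c"
  let ?N = "real (size c)" and ?K = "real (size b)"
  have b_size: "size c = count c 0 + size b"
    unfolding b_def by (induction c) auto
  have K: "?K \<le> (1 - \<delta>) * ?N" using zeros b_size by (simp add: algebra_simps)
  \<comment> \<open>Zeros contribute nothing to the products, so Maclaurin's inequality is applied
    to the positive entries alone, while the normalisation still runs over all of \<open>c\<close>.
    The gain comes from this mismatch.\<close>
  have esym: "ordered_esym real L c = ordered_esym real L b"
    unfolding b_def by (simp only: ordered_esym_filter_nonzero)
  consider "size b < L" | "L = 0" | "L \<le> size b" "0 < L" by linarith
  then show ?thesis
  proof cases
    case 1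
    then show ?thesis by (simp add: sample_mean_def esym ordered_esym_eq_0)
  next
    case 2
    then show ?thesis by simp
  next
    case 3
    then have K0: "?K > 0" and N0: "?N > 0" using b_size by auto
    have bne: "b \<noteq> {#}" using 3 by auto
    have "sum_mset b = sum_mset c" unfolding b_def by (induction c) auto
    then have S: "(\<Sum>x\<in>#b. real x) \<le> ?N" using c by (simp flip: of_nat_sum_mset)
    have "ordered_esym real L b \<le> (\<Prod>i<L. ?K - real i) * ((\<Sum>x\<in>#b. real x) / ?K) ^ L"
      by (rule maclaurin_inequality) (use 3 bne in auto)
    also have "\<dots> \<le> (\<Prod>i<L. ?K - real i) * (?N / ?K) ^ L"
    proof (intro mult_left_mono power_mono divide_right_mono S prod_nonneg)
      show "0 \<le> (\<Sum>x\<in>#b. real x) / ?K"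
        by (metis of_nat_sum_mset of_nat_0_le_iff divide_nonneg_nonneg)
    qed (use 3 in auto)
    finally have "sample_mean real L c \<le> (\<Prod>i<L. ?K - real i) * (?N / ?K) ^ L / (\<Prod>i<L. ?N - real i)"
      unfolding sample_mean_def esym using 3 b_size
      by (intro divide_right_mono prod_nonneg) auto
    also have "\<dots> = (\<Prod>i<L. (?K - real i) * (?N / ?K) / (?N - real i))"
      by (simp add: prod_dividef prod.distrib power_divide)
    also have "\<dots> \<le> (\<Prod>i<L. exp (- \<delta> * (real i / ?N)))"
    proof (rule prod_mono, safe)
      fix i assume "i < L"
      then have iK: "real i < ?K" and iN: "real i < ?N" using 3 b_size by auto
      show "0 \<le> (?K - real i) * (?N / ?K) / (?N - real i)" using iK iN by simp
      \<comment> \<open>As (1 - \<delta>)(1 + \<delta>) \<le> 1, the bound on \<open>?K\<close>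
        gives 1 / K \<ge> (1 + \<delta>) / N, which lowers the i-th factor to at most 1 - \<delta> i
        / N.\<close>
      have "?K * (1 + \<delta>) \<le> (1 - \<delta>) * ?N * (1 + \<delta>)"
        using K \<delta> by (intro mult_right_mono) auto
      also have "\<dots> = ?N - \<delta>\<^sup>2 * ?N" by (simp add: algebra_simps power2_eq_square)
      also have "\<dots> \<le> ?N" by simp
      finally have "(1 + \<delta>) / ?N \<le> 1 / ?K" using K0 N0 by (simp add: field_simps)
      then have "(1 + \<delta>) * (real i / ?N) \<le> real i / ?K"
        using mult_left_mono[of "(1 + \<delta>) / ?N" "1 / ?K" "real i"] by (simp add: mult_ac)
      moreover define a where "a = i / ?N"
      ultimately have aK: "(1 + \<delta>) * a \<le> real i / ?K" by simp
      have a: "0 \<le> a" "a < 1" using iN N0 by (auto simp: a_def)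
      have "(?K - real i) * (?N / ?K) / (?N - real i) = (1 - real i / ?K) / (1 - a)"
      proof -
        have "1 - real i / ?K = (?K - real i) / ?K" "1 - a = (?N - real i) / ?N"
          using K0 N0 by (auto simp: a_def diff_divide_distrib)
        then show ?thesis by simp
      qed
      also have "\<dots> \<le> (1 - (1 + \<delta>) * a) / (1 - a)"
        using aK a by (intro divide_right_mono) auto
      also have "\<dots> \<le> 1 - \<delta> * a"
      proof -
        have "0 \<le> \<delta> * a * a" using a \<delta> by simp
        then have "1 - (1 + \<delta>) * a \<le> (1 - \<delta> * a) * (1 - a)" by (simp add: algebra_simps)
        then show ?thesis using a by (simp add: divide_le_eq)
      qed
      also have "\<dots> \<le> exp (- \<delta> * a)" using exp_ge_add_one_self[of "- \<delta> * a"] by simp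
      finally show "(?K - real i) * (?N / ?K) / (?N - real i) \<le> exp (- \<delta> * (real i / ?N))" by (simp add: a_def)
    qed
    also have "\<dots> = exp (\<Sum>i<L. - \<delta> * (real i / ?N))" by (simp add: exp_sum)
    also have "(\<Sum>i<L. - \<delta> * (real i / ?N)) = - \<delta> * (real L * (real L - 1)) / (2 * ?N)"
    proof -
      have "(\<Sum>i<L. real i) = real L * (real L - 1) / 2"
        by (induction L) (auto simp: field_simps)
      moreover have "(\<Sum>i<L. - \<delta> * (real i / ?N)) = - \<delta> / ?N * (\<Sum>i<L. real i)"
        by (simp add: sum_distrib_left)
      ultimately show ?thesis by (simp only: times_divide_times_eq mult.commute)
    qed
    finally show ?thesis .
  qed
qed

section \<open>Plane forests with prescribed degrees\<close>

text \<open>The Lukasiewicz word: the numbers of children in depth-first order.\<close>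

primrec degree_word :: "ptree \<Rightarrow> nat list" where
  "degree_word (Node ts) = length ts # concat (map degree_word ts)"

definition forests :: "nat \<Rightarrow> nat multiset \<Rightarrow> ptree list set" where
  "forests R c = {ts. length ts = R \<and> mset (concat (map degree_word ts)) = c}"

definition tree_class :: "nat multiset \<Rightarrow> ptree set" where
  "tree_class c = {t. mset (degree_word t) = c}"

text \<open>Deleting the first letter replaces the first tree by the children of its root, so the
  claim is again about forests of equal length. The trailing words allow the parsing to stop
  anywhere; with both empty, the word determines the forest.\<close>

lemma degree_word_forest_inj_append:
  assumes "concat (map degree_word ts) @ as = concat (map degree_word us) @ bs" and "length ts = length us"
  shows "ts = us \<and> as = bs"
  using assms
proof (induction "length (concat (map degree_word ts))" arbitrary: ts us rule: less_induct)
  case less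
  show ?case
  proof (cases ts)
    case Nil
    then show ?thesis using less.prems by simp
  next
    case (Cons t ts')
    then obtain u us' where us: "us = u # us'" using less.prems(2) by (cases us) auto
    obtain a b where t: "t = Node a" and u: "u = Node b" by (cases t, cases u) auto
    have "a @ ts' = b @ us' \<and> as = bs"
    proof (rule less.hyps)
      show "length (concat (map degree_word (a @ ts'))) < length (concat (map degree_word ts))"
        using Cons t by simp
    qed (use less.prems Cons us t u in auto)
    moreover have "length a = length b" using less.prems Cons us t u by simp
    ultimately show ?thesis using Cons us t u by simp
  qed
qed

lemma inj_degree_word: "inj degree_word"
proof (rule injI)
  fix t u assume "degree_word t = degree_word u"
  then show "t = u" using degree_word_forest_inj_append[of "[t]" "[]" "[u]" "[]"] by simp
qed

lemma finite_forests [simp]: "finite (forests R c)"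
proof (rule inj_on_finite)
  show "inj_on (\<lambda>ts. concat (map degree_word ts)) (forests R c)"
    using degree_word_forest_inj_append[of _ "[]" _ "[]"] by (auto simp: inj_on_def forests_def)
  show "(\<lambda>ts. concat (map degree_word ts)) ` forests R c \<subseteq> permutations_of_multiset c"
    by (auto simp: forests_def permutations_of_multiset_def)
qed simp

lemma finite_tree_class [simp]: "finite (tree_class c)"
proof (rule inj_on_finite)
  show "inj_on degree_word (tree_class c)" using inj_degree_word by (simp add: inj_on_def)
  show "degree_word ` tree_class c \<subseteq> permutations_of_multiset c"
    by (auto simp: tree_class_def permutations_of_multiset_def)
qed simp

lemma forests_0: "forests 0 c = (if c = {#} then {[]} else {})"
  by (auto simp: forests_def)

text \<open>Reading the first letter x removes the root of the first tree and leaves R + x trees.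
  The recursions for counting and for depth both follow this decomposition.\<close>

lemma forests_Suc:
  "forests (Suc R) c
    = (\<Union>x\<in>set_mset c. (\<lambda>us. Node (take x us) # drop x us) ` forests (R + x) (c - {#x#}))"
    (is "_ = ?rhs")
proof (intro subset_antisym subsetI)
  fix ts assume "ts \<in> forests (Suc R) c"
  then obtain a ts' where ts: "ts = Node a # ts'" and R: "length ts' = R"
      and c: "c = add_mset (length a) (mset (concat (map degree_word (a @ ts'))))"
    by (auto simp: forests_def length_Suc_conv) (metis ptree.exhaust)
  have "a @ ts' \<in> forests (R + length a) (c - {#length a#})"
    using R c by (simp add: forests_def)
  moreover have "ts = Node (take (length a) (a @ ts')) # drop (length a) (a @ ts')"
    using ts by simp
  moreover have "length a \<in># c" using c by simp
  ultimately show "ts \<in> ?rhs" by blast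
next
  fix ts assume "ts \<in> ?rhs"
  then obtain x us where x: "x \<in># c" and us: "us \<in> forests (R + x) (c - {#x#})"
      and ts: "ts = Node (take x us) # drop x us" by auto
  have "mset (concat (map degree_word (take x us @ drop x us))) = c - {#x#}"
    using us unfolding append_take_drop_id by (simp add: forests_def)
  then have "mset (concat (map degree_word (take x us))) + mset (concat (map degree_word (drop x us))) = c - {#x#}"
    unfolding map_append concat_append mset_append .
  moreover have "length (take x us) = x" using us by (simp add: forests_def)
  ultimately have "mset (concat (map degree_word ts)) = c"
    using x by (simp add: ts)
  moreover have "length ts = Suc R" using us by (simp add: ts forests_def)
  ultimately show "ts \<in> forests (Suc R) c" by (simp add: forests_def)
qed

lemma sum_forests_Suc:
  "(\<Sum>ts\<in>forests (Suc R) c. g ts)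
    = (\<Sum>x\<in>set_mset c. \<Sum>us\<in>forests (R + x) (c - {#x#}). g (Node (take x us) # drop x us))"
proof -
  let ?F = "\<lambda>x us. Node (take x us) # drop x us"
  have disj: "?F x ` forests (R + x) (c - {#x#}) \<inter> ?F y ` forests (R + y) (c - {#y#}) = {}"
    if "x \<noteq> y" for x y
  proof -
    have "length (take z us) = z" if "us \<in> forests (R + z) (c - {#z#})" for z us
      using that by (simp add: forests_def)
    then show ?thesis using that by (auto simp del: length_take) metis
  qed
  have "(\<Sum>ts\<in>forests (Suc R) c. g ts)
      = (\<Sum>x\<in>set_mset c. sum g (?F x ` forests (R + x) (c - {#x#})))"
    unfolding forests_Suc by (intro sum.UNION_disjoint) (use disj in auto)
  also have "\<dots> = (\<Sum>x\<in>set_mset c. \<Sum>us\<in>forests (R + x) (c - {#x#}). g (?F x us))"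
  proof (rule sum.cong[OF refl])
    fix x
    have "inj_on (?F x) (forests (R + x) (c - {#x#}))"
      by (rule inj_onI) (metis append_take_drop_id list.inject ptree.inject)
    then show "sum g (?F x ` forests (R + x) (c - {#x#})) = (\<Sum>us\<in>forests (R + x) (c - {#x#}). g (?F x us))"
      by (simp add: sum.reindex)
  qed
  finally show ?thesis .
qed

lemma sum_tree_class_eq_forests:
  "(\<Sum>t\<in>tree_class c. f t) = (\<Sum>ts\<in>forests 1 c. f (ts ! 0))"
proof -
  have "forests 1 c = (\<lambda>t. [t]) ` tree_class c"
    by (auto simp: forests_def tree_class_def length_Suc_conv)
  then show ?thesis by (simp add: sum.reindex inj_on_def)
qed

lemma sum_tree_class:
  "(\<Sum>t\<in>tree_class c. f t) = (\<Sum>x\<in>set_mset c. \<Sum>ts\<in>forests x (c - {#x#}). f (Node ts))"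
proof -
  have "(\<Sum>t\<in>tree_class c. f t) = (\<Sum>ts\<in>forests (Suc 0) c. f (ts ! 0))"
    by (simp add: sum_tree_class_eq_forests)
  also have "\<dots> = (\<Sum>x\<in>set_mset c. \<Sum>us\<in>forests (0 + x) (c - {#x#}). f (Node (take x us)))"
    by (simp add: sum_forests_Suc)
  also have "\<dots> = (\<Sum>x\<in>set_mset c. \<Sum>ts\<in>forests x (c - {#x#}). f (Node ts))"
    by (intro sum.cong) (auto simp: forests_def)
  finally show ?thesis .
qed

text \<open>Exchangeability: swapping the trees at positions 0 and i is an involution of
  \<open>forests R c\<close>.\<close>

lemma sum_forests_nth:
  assumes "i < R"
  shows "(\<Sum>ts\<in>forests R c. f (ts ! i)) = (\<Sum>ts\<in>forests R c. f (ts ! 0))"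
proof -
  define sw where "sw = (\<lambda>ts :: ptree list. ts[0 := ts ! i, i := ts ! 0])"
  have sw_nth: "sw ts ! 0 = ts ! i" "sw (sw ts) = ts" if "ts \<in> forests R c" for ts
  proof -
    have "length ts = R" using that by (simp add: forests_def)
    then show "sw ts ! 0 = ts ! i" "sw (sw ts) = ts"
      using assms by (cases "i = 0"; simp add: sw_def list_update_swap[of 0 i])+
  qed
  have sw_in: "sw ts \<in> forests R c" if "ts \<in> forests R c" for ts
  proof -
    have "mset (sw ts) = mset ts" unfolding sw_def
      using that assms by (intro mset_swap) (auto simp: forests_def)
    then have "mset (concat (map degree_word (sw ts))) = mset (concat (map degree_word ts))"
      by (simp add: mset_concat) (metis mset_map sum_mset_sum_list)
    then show ?thesis using that by (simp add: forests_def sw_def)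
  qed
  show ?thesis
    by (rule sum.reindex_bij_witness[of _ sw sw]) (auto simp: sw_nth sw_in)
qed

lemma sum_mset_remove:
  fixes c :: "nat multiset"
  assumes "x \<in># c"
  shows "sum_mset c = x + sum_mset (c - {#x#})"
  using multi_member_split[OF assms] by auto

text \<open>Induction on the first letter instead of rotations: after the letter x there remain R -
  1 + x trees, and averaging this number over the letters of \<open>c\<close> gives n R / (n + 1),
  where n + 1 is the size of \<open>c\<close>. The case \<open>n = 0\<close> is separate because the
  factor n has to be cancelled.\<close>

lemma cycle_lemma_forests:
  assumes "sum_mset c + R = size c"
  shows "real (size c) * card (forests R c) = R * num_words c"
  using assms
proof (induction "size c" arbitrary: c R)
  case (Suc n)
  show ?case
  proof (cases R)
    case 0
    with Suc show ?thesis by (auto simp: forests_0)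
  next
    case R: (Suc R')
    have card: "real (card (forests R c)) = (\<Sum>x\<in>set_mset c. real (card (forests (R' + x) (c - {#x#}))))"
      using sum_forests_Suc[of "\<lambda>_. 1::real" R' c] R by simp
    show ?thesis
    proof (cases "n = 0")
      case True
      then obtain x where "c = {#x#}" using Suc(2) by (metis One_nat_def size_1_singleton_mset)
      then show ?thesis using Suc.prems R card by (simp add: forests_0)
    next
      case False
      have c_ne: "c \<noteq> {#}" using Suc(2) by auto
      have "real n * card (forests R c) = (\<Sum>x\<in>set_mset c. real (R' + x) * num_words (c - {#x#}))"
        unfolding card sum_distrib_left
      proof (intro sum.cong refl)
        fix x assume x: "x \<in># c"
        then have n: "n = size (c - {#x#})" using Suc(2) by (simp add: size_Diff_submset)
        have "sum_mset c = x + sum_mset (c - {#x#})"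
          using x by (rule sum_mset_remove)
        then have "sum_mset (c - {#x#}) + (R' + x) = size (c - {#x#})"
          using Suc.prems R n Suc(2) by simp
        then show "real n * card (forests (R' + x) (c - {#x#})) = real (R' + x) * num_words (c - {#x#})"
          using Suc(1)[of "c - {#x#}" "R' + x"] n by simp
      qed
      also have "\<dots> = num_words c * (\<Sum>x\<in>#c. real (R' + x)) / size c"
        by (rule sum_num_words_remove)
      also have "(\<Sum>x\<in>#c. real (R' + x)) = real (size c * R' + sum_mset c)"
        by (induction c) auto
      also have "size c * R' + sum_mset c = n * R"
      proof -
        have "sum_mset c + R' = n" "size c = Suc n" using Suc.prems Suc(2) R by auto
        then show ?thesis using R by (simp add: algebra_simps)
      qed
      finally have "real n * (size c * card (forests R c)) = real n * (R * num_words c)"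
        using c_ne by (simp add: eq_divide_eq mult_ac)
      then show ?thesis using False by simp
    qed
  qed
qed simp

lemma cycle_lemma_trees:
  assumes "sum_mset c + 1 = size c"
  shows "real (size c) * card (tree_class c) = num_words c"
  using cycle_lemma_forests[OF assms] sum_tree_class_eq_forests[of "\<lambda>_. 1::nat" c] by simp

text \<open>Every vertex of a forest is either a root or the child of exactly one vertex.\<close>

lemma sum_degree_word_concat:
  assumes "concat (map degree_word ts) = xs"
  shows "sum_list xs + length ts = length xs"
  using assms
proof (induction "length xs" arbitrary: ts xs rule: less_induct)
  case less
  show ?case
  proof (cases ts)
    case (Cons t ts')
    obtain a where t: "t = Node a" by (cases t)
    have "sum_list (concat (map degree_word (a @ ts'))) + length (a @ ts')
        = length (concat (map degree_word (a @ ts')))"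
      by (rule less.hyps) (use less.prems Cons t in auto)
    then show ?thesis using less.prems Cons t by auto
  qed (use less.prems in simp)
qed

lemma tree_class_nonempty_imp:
  assumes "tree_class c \<noteq> {}"
  shows "sum_mset c + 1 = size c"
proof -
  obtain t where t: "mset (degree_word t) = c" using assms by (auto simp: tree_class_def)
  show ?thesis using sum_degree_word_concat[of "[t]" "degree_word t"]
    by (simp flip: t add: sum_mset_sum_list)
qed

section \<open>Depth of a uniform vertex\<close>

text \<open>Depth at least L, rather than exactly L: a large subtree rooted at depth L then counts
  with all its vertices.\<close>

primrec deep_count :: "nat \<Rightarrow> ptree \<Rightarrow> nat" where
  "deep_count 0 = (\<lambda>t. length (degree_word t))"
| "deep_count (Suc L) = (\<lambda>t. sum_list (map (deep_count L) (children t)))"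

text \<open>Reading the degrees along the path to a marked vertex first, and the rest of the forest
  afterwards, turns the count of deep vertices into the sampling expectation.\<close>

lemma sum_forests_deep_count:
  assumes "sum_mset c + Suc R = size c"
  shows "(\<Sum>ts\<in>forests (Suc R) c. real (deep_count L (ts ! 0))) = num_words c * sample_mean real L c"
  using assms
proof (induction L arbitrary: R c)
  case 0
  \<comment> \<open>On average the vertices of the forest are shared equally among its R + 1
    trees.\<close>
  have "real (Suc R) * (\<Sum>ts\<in>forests (Suc R) c. real (length (degree_word (ts ! 0))))
      = (\<Sum>i<Suc R. \<Sum>ts\<in>forests (Suc R) c. real (length (degree_word (ts ! i))))"
    by (subst sum.cong[OF refl sum_forests_nth]) auto
  also have "\<dots> = (\<Sum>ts\<in>forests (Suc R) c. \<Sum>i<Suc R. real (length (degree_word (ts ! i))))"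
    by (rule sum.swap)
  also have "\<dots> = (\<Sum>ts\<in>forests (Suc R) c. real (size c))"
  proof (intro sum.cong refl)
    fix ts assume "ts \<in> forests (Suc R) c"
    then have len: "length ts = Suc R" and c: "size c = length (concat (map degree_word ts))"
      by (auto simp: forests_def simp flip: size_mset)
    show "(\<Sum>i<Suc R. real (length (degree_word (ts ! i)))) = real (size c)"
      unfolding c length_concat map_map sum_list_sum_nth
      using len by (simp add: atLeast0LessThan del: sum.lessThan_Suc)
  qed
  also have "\<dots> = real (Suc R) * num_words c" using cycle_lemma_forests[OF 0] by (simp add: mult.commute)
  finally show ?case by (simp del: of_nat_Suc)
next
  case (Suc L)
  have "(\<Sum>ts\<in>forests (Suc R) c. real (deep_count (Suc L) (ts ! 0)))
      = (\<Sum>x\<in>set_mset c. \<Sum>us\<in>forests (R + x) (c - {#x#}). \<Sum>i<x. real (deep_count L (us ! i)))"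
    unfolding sum_forests_Suc
  proof (intro sum.cong refl)
    fix x us assume "us \<in> forests (R + x) (c - {#x#})"
    then have "length us = R + x" by (simp add: forests_def)
    then show "real (deep_count (Suc L) ((Node (take x us) # drop x us) ! 0)) = (\<Sum>i<x. real (deep_count L (us ! i)))"
      by (simp add: sum_list_sum_nth atLeast0LessThan)
  qed
  also have "\<dots> = (\<Sum>x\<in>set_mset c. real x * sample_mean real L (c - {#x#}) * num_words (c - {#x#}))"
  proof (intro sum.cong refl)
    fix x assume x: "x \<in># c"
    have "(\<Sum>us\<in>forests (R + x) (c - {#x#}). \<Sum>i<x. real (deep_count L (us ! i)))
        = (\<Sum>i<x. \<Sum>us\<in>forests (R + x) (c - {#x#}). real (deep_count L (us ! i)))"
      by (rule sum.swap)
    \<comment> \<open>Each of the x children of the root contributes equally. This factor x is the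
      value of the letter in the product of sampled degrees.\<close>
    also have "\<dots> = (\<Sum>i<x. \<Sum>us\<in>forests (R + x) (c - {#x#}). real (deep_count L (us ! 0)))"
      by (intro sum.cong refl sum_forests_nth) auto
    also have "\<dots> = real x * sample_mean real L (c - {#x#}) * num_words (c - {#x#})"
    proof (cases x)
      case (Suc x')
      have "sum_mset c = x + sum_mset (c - {#x#})" "size c = Suc (size (c - {#x#}))"
        using x by (rule sum_mset_remove, simp add: size_Suc_Diff1)
      then have "sum_mset (c - {#x#}) + Suc (R + x') = size (c - {#x#})"
        using Suc.prems Suc by simp
      from Suc.IH[OF this] show ?thesis using Suc by simp
    qed simp
    finally show "(\<Sum>us\<in>forests (R + x) (c - {#x#}). \<Sum>i<x. real (deep_count L (us ! i)))
        = real x * sample_mean real L (c - {#x#}) * num_words (c - {#x#})" .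
  qed
  also have "\<dots> = num_words c * sample_mean real (Suc L) c"
  proof -
    have "c \<noteq> {#}" using Suc.prems by auto
    then show ?thesis unfolding sum_num_words_remove by (simp add: sample_mean_Suc)
  qed
  finally show ?case .
qed

lemma sum_tree_class_deep_count:
  "(\<Sum>t\<in>tree_class c. real (deep_count L t)) = card (tree_class c) * (size c * sample_mean real L c)"
proof (cases "tree_class c = {}")
  case False
  then have c: "sum_mset c + 1 = size c" by (rule tree_class_nonempty_imp)
  have "(\<Sum>t\<in>tree_class c. real (deep_count L t)) = num_words c * sample_mean real L c"
    unfolding sum_tree_class_eq_forests using sum_forests_deep_count[of c 0 L] c by simp
  then show ?thesis by (simp flip: cycle_lemma_trees[OF c])
qed simp

section \<open>Resampling the maximal subtrees of bounded size\<close>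

text \<open>The threshold is real because it is halved repeatedly. Below 1 the list is empty, since
  even a single vertex is too large.\<close>

primrec maximal_subtrees :: "real \<Rightarrow> ptree \<Rightarrow> ptree list" where
  "maximal_subtrees s (Node ts) =
     (if real (length (degree_word (Node ts))) \<le> s then [Node ts] else concat (map (maximal_subtrees s) ts))"

text \<open>With all trees but the first fixed, the first one ranges over a full degree class;
  exchangeability extends the comparison to the other trees.\<close>

lemma sum_forests_mono:
  fixes F G :: "ptree \<Rightarrow> real"
  assumes "\<And>d. size d \<le> size c \<Longrightarrow> (\<Sum>t\<in>tree_class d. F t) \<le> (\<Sum>t\<in>tree_class d. G t)"
  shows "(\<Sum>ts\<in>forests R c. \<Sum>t\<leftarrow>ts. F t) \<le> (\<Sum>ts\<in>forests R c. \<Sum>t\<leftarrow>ts. G t)"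
proof (cases R)
  case 0
  then show ?thesis by (simp add: forests_0)
next
  case (Suc R')
  have expand: "(\<Sum>ts\<in>forests R c. \<Sum>t\<leftarrow>ts. H t) = R * (\<Sum>ts\<in>forests R c. H (ts ! 0))"
    for H :: "ptree \<Rightarrow> real"
  proof -
    have "(\<Sum>ts\<in>forests R c. \<Sum>t\<leftarrow>ts. H t) = (\<Sum>ts\<in>forests R c. \<Sum>i<R. H (ts ! i))"
      by (intro sum.cong refl) (auto simp: forests_def sum_list_sum_nth atLeast0LessThan)
    also have "\<dots> = (\<Sum>i<R. \<Sum>ts\<in>forests R c. H (ts ! i))" by (rule sum.swap)
    also have "\<dots> = (\<Sum>i<R. \<Sum>ts\<in>forests R c. H (ts ! 0))"
      by (intro sum.cong refl sum_forests_nth) auto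
    finally show ?thesis by simp
  qed
  define rest where "rest = tl ` forests R c"
  define M where "M = (\<lambda>us. mset (concat (map degree_word us)))"
  have M: "M us \<subseteq># c" "length us = R'" if "us \<in> rest" for us
    using that Suc by (auto simp: rest_def M_def forests_def length_Suc_conv)
  have "forests R c = (\<lambda>(us, t). t # us) ` (SIGMA us:rest. tree_class (c - M us))" (is "_ = _ ` ?S")
  proof (intro subset_antisym subsetI)
    fix ts assume ts: "ts \<in> forests R c"
    then obtain t us where tu: "ts = t # us" using Suc by (auto simp: forests_def length_Suc_conv)
    have "us \<in> rest" using ts tu unfolding rest_def by force
    moreover have "t \<in> tree_class (c - M us)" using ts tu by (auto simp: forests_def tree_class_def M_def)
    ultimately show "ts \<in> (\<lambda>(us, t). t # us) ` ?S" using tu by force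
  next
    fix ts assume "ts \<in> (\<lambda>(us, t). t # us) ` ?S"
    then obtain us t where "us \<in> rest" "t \<in> tree_class (c - M us)" "ts = t # us" by auto
    then show "ts \<in> forests R c" using M[of us] Suc
      by (simp add: forests_def tree_class_def) (simp add: M_def)
  qed
  note split = this
  have head: "(\<Sum>ts\<in>forests R c. H (ts ! 0)) = (\<Sum>us\<in>rest. \<Sum>t\<in>tree_class (c - M us). H t)"
    for H :: "ptree \<Rightarrow> real"
  proof -
    have "(\<Sum>ts\<in>forests R c. H (ts ! 0)) = (\<Sum>p\<in>?S. H (snd p))"
      by (subst split) (auto simp: sum.reindex inj_on_def case_prod_unfold)
    also have "\<dots> = (\<Sum>us\<in>rest. \<Sum>t\<in>tree_class (c - M us). H t)"
      by (subst sum.Sigma) (auto simp: rest_def case_prod_unfold)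
    finally show ?thesis .
  qed
  have "(\<Sum>ts\<in>forests R c. F (ts ! 0)) \<le> (\<Sum>ts\<in>forests R c. G (ts ! 0))"
    unfolding head by (intro sum_mono assms diff_subset_eq_self size_mset_mono)
  then show ?thesis unfolding expand by (intro mult_left_mono) auto
qed

text \<open>Whether the root is removed depends on \<open>size c\<close> alone, so the whole class
  takes the same branch and its roots can be stripped off together. In the end each maximal subtree
  ranges over its full degree class, given everything outside it.\<close>

lemma sum_maximal_subtrees_mono:
  fixes f g :: "ptree \<Rightarrow> real"
  assumes "\<And>d. real (size d) \<le> s \<Longrightarrow> (\<Sum>t\<in>tree_class d. f t) \<le> (\<Sum>t\<in>tree_class d. g t)"
  shows "(\<Sum>t\<in>tree_class c. \<Sum>u\<leftarrow>maximal_subtrees s t. f u) \<le> (\<Sum>t\<in>tree_class c. \<Sum>u\<leftarrow>maximal_subtrees s t. g u)"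
proof (induction "size c" arbitrary: c rule: less_induct)
  case less
  show ?case
  proof (cases "real (size c) \<le> s")
    case True
    have "maximal_subtrees s t = [t]" if "t \<in> tree_class c" for t
    proof -
      have "length (degree_word t) = size c" using that by (auto simp: tree_class_def simp flip: size_mset)
      then show ?thesis using True by (cases t) simp
    qed
    then show ?thesis using assms[OF True] by simp
  next
    case False
    have expand: "(\<Sum>t\<in>tree_class c. \<Sum>u\<leftarrow>maximal_subtrees s t. h u)
        = (\<Sum>x\<in>set_mset c. \<Sum>ts\<in>forests x (c - {#x#}). \<Sum>t\<leftarrow>ts. \<Sum>u\<leftarrow>maximal_subtrees s t. h u)"
      for h :: "ptree \<Rightarrow> real"
      unfolding sum_tree_class
    proof (intro sum.cong refl)
      fix x ts assume x: "x \<in> set_mset c" and ts: "ts \<in> forests x (c - {#x#})"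
      have "mset (degree_word (Node ts)) = c" using ts x by (auto simp: forests_def)
      then have "length (degree_word (Node ts)) = size c" by (simp flip: size_mset del: degree_word.simps)
      then have "maximal_subtrees s (Node ts) = concat (map (maximal_subtrees s) ts)"
        using False by (simp del: degree_word.simps)
      moreover have "(\<Sum>u\<leftarrow>concat (map (maximal_subtrees s) us). h u) = (\<Sum>t\<leftarrow>us. \<Sum>u\<leftarrow>maximal_subtrees s t. h u)" for us
        by (induction us) auto
      ultimately show "(\<Sum>u\<leftarrow>maximal_subtrees s (Node ts). h u) = (\<Sum>t\<leftarrow>ts. \<Sum>u\<leftarrow>maximal_subtrees s t. h u)" by simp
    qed
    show ?thesis unfolding expand
    proof (rule sum_mono, rule sum_forests_mono)
      fix x and d :: "nat multiset" assume "x \<in># c" "size d \<le> size (c - {#x#})"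
      then have "size d < size c" by (meson le_less_trans size_Diff1_less)
      then show "(\<Sum>t\<in>tree_class d. \<Sum>u\<leftarrow>maximal_subtrees s t. f u) \<le> (\<Sum>t\<in>tree_class d. \<Sum>u\<leftarrow>maximal_subtrees s t. g u)"
        by (rule less.hyps)
    qed
  qed
qed

lemma maximal_subtrees_size_le: "u \<in> set (maximal_subtrees s t) \<Longrightarrow> real (length (degree_word u)) \<le> s"
  by (induction t) (auto split: if_splits)

lemma sum_maximal_subtrees_length_le: "(\<Sum>u\<leftarrow>maximal_subtrees s t. length (degree_word u)) \<le> length (degree_word t)"
proof (induction t)
  case (Node ts)
  have "(\<Sum>u\<leftarrow>concat (map (maximal_subtrees s) us). length (degree_word u)) \<le> length (concat (map degree_word us))"
    if "set us \<subseteq> set ts" for us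
    using that
  proof (induction us)
    case (Cons u us)
    then show ?case using Node.IH[of u] by simp
  qed simp
  from this[of ts] show ?case by simp
qed

lemma maximal_subtrees_trans:
  assumes "u \<in> set (maximal_subtrees s' t)" and "v \<in> set (maximal_subtrees s u)" and "s \<le> s'"
  shows "v \<in> set (maximal_subtrees s t)"
  using assms(1)
proof (induction t)
  case (Node ts)
  show ?case
  proof (cases "real (length (degree_word (Node ts))) \<le> s'")
    case True
    then show ?thesis using Node.prems assms(2) by simp
  next
    case False
    then obtain t where t: "t \<in> set ts" "u \<in> set (maximal_subtrees s' t)" using Node.prems by auto
    then have "v \<in> set (maximal_subtrees s t)" by (rule Node.IH)
    moreover have "\<not> real (length (degree_word (Node ts))) \<le> s" using False assms(3) by linarith
    ultimately show ?thesis using t by auto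
  qed
qed

lemma degree_word_maximal_subtrees_infix:
  assumes "u \<in> set (maximal_subtrees s t)"
  shows "\<exists>as bs. degree_word t = as @ degree_word u @ bs"
  using assms
proof (induction t)
  case (Node ts)
  show ?case
  proof (cases "real (length (degree_word (Node ts))) \<le> s")
    case True
    then show ?thesis using Node.prems by (auto intro: exI[of _ "[]"])
  next
    case False
    then obtain t where t: "t \<in> set ts" "u \<in> set (maximal_subtrees s t)" using Node.prems by auto
    then obtain as bs where "degree_word t = as @ degree_word u @ bs" using Node.IH by blast
    moreover obtain us vs where "ts = us @ t # vs" using t(1) by (meson split_list)
    ultimately have "degree_word (Node ts) = (length ts # concat (map degree_word us) @ as) @ degree_word u
        @ (bs @ concat (map degree_word vs))" by simp
    then show ?thesis by blast
  qed
qed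

section \<open>Lengths of paths across the scales\<close>

primrec levels :: "ptree \<Rightarrow> nat" where
  "levels (Node ts) = Suc (Max (insert 0 (set (map levels ts))))"

text \<open>Vertices with more than s descendants, themselves included, are closed under passing to
  the parent; the levels counted are those of the tree that they form. As for \<open>levels\<close>,
  the vertices on a path are counted, not its edges.\<close>

primrec heavy_levels :: "real \<Rightarrow> ptree \<Rightarrow> nat" where
  "heavy_levels s (Node ts) =
     (if real (length (degree_word (Node ts))) \<le> s then 0
      else Suc (Max (insert 0 (set (map (heavy_levels s) ts)))))"

text \<open>Subtree sizes decrease along a path from the root, so the path leaves the vertices with
  large subtrees at most once and then stays inside one maximal subtree.\<close>

lemma levels_le:
  assumes "\<And>u. u \<in> set (maximal_subtrees s t) \<Longrightarrow> levels u \<le> B"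
  shows "levels t \<le> heavy_levels s t + B"
  using assms
proof (induction t)
  case (Node ts)
  show ?case
  proof (cases "real (length (degree_word (Node ts))) \<le> s")
    case True
    then show ?thesis using Node.prems[of "Node ts"] by simp
  next
    case False
    let ?M = "Max (insert 0 (set (map (heavy_levels s) ts)))"
    have "levels t \<le> ?M + B" if t: "t \<in> set ts" for t
    proof -
      have "levels t \<le> heavy_levels s t + B"
        using t False by (intro Node.IH Node.prems) auto
      moreover have "heavy_levels s t \<le> ?M" using t by (intro Max_ge) auto
      ultimately show ?thesis by linarith
    qed
    then have "Max (insert 0 (set (map levels ts))) \<le> ?M + B" by auto
    then show ?thesis using False by simp
  qed
qed

lemma heavy_levels_Node_gr:
  assumes "heavy_levels s (Node ts) > Suc L"
  obtains t where "t \<in> set ts" "heavy_levels s t > L"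
proof -
  have "Max (insert 0 (set (map (heavy_levels s) ts))) > L" using assms by (auto split: if_splits)
  then show ?thesis using that by (auto simp: Max_gr_iff)
qed

text \<open>Some vertex at depth L has more than s descendants, itself included, and all of these
  have depth at least L.\<close>

lemma deep_count_gr:
  assumes "heavy_levels s t > L"
  shows "real (deep_count L t) > s"
  using assms
proof (induction L arbitrary: t)
  case 0
  then show ?case by (cases t) (auto split: if_splits)
next
  case (Suc L)
  obtain ts where t: "t = Node ts" by (cases t)
  obtain u where u: "u \<in> set ts" "heavy_levels s u > L"
    using Suc.prems unfolding t by (rule heavy_levels_Node_gr)
  have "deep_count L u \<le> deep_count (Suc L) t" using u(1) t by (auto intro!: member_le_sum_list)
  with Suc.IH[OF u(2)] show ?case by linarith
qed

lemma heavy_levels_le_size: "heavy_levels s t \<le> length (degree_word t)"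
proof (induction t)
  case (Node ts)
  have "heavy_levels s t \<le> length (concat (map degree_word ts))" if "t \<in> set ts" for t
  proof -
    have "length (degree_word t) \<le> sum_list (map length (map degree_word ts))"
      using that by (intro member_le_sum_list) auto
    then show ?thesis using Node.IH[OF that] by (simp add: length_concat)
  qed
  then have "Max (insert 0 (set (map (heavy_levels s) ts))) \<le> length (concat (map degree_word ts))"
    by auto
  then show ?case by simp
qed

text \<open>Scale 0 sees only \<open>t\<close> itself, and scale \<open>I\<close> sees no subtree at
  all, as none has less than one vertex. In between, passing from a maximal subtree to its maximal
  subtrees at the next scale costs \<open>A i\<close> levels.\<close>

lemma levels_le_sum:
  fixes m :: "nat \<Rightarrow> real"
  assumes dec: "\<And>i. m (Suc i) \<le> m i" and m0: "real (length (degree_word t)) \<le> m 0" and mI: "m I < 1"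
    and A: "\<And>i u. i < I \<Longrightarrow> u \<in> set (maximal_subtrees (m i) t) \<Longrightarrow> heavy_levels (m (Suc i)) u \<le> A i"
  shows "levels t \<le> (\<Sum>i<I. A i)"
proof -
  have claim: "\<forall>u\<in>set (maximal_subtrees (m j) t). levels u \<le> (\<Sum>i=j..<I. A i)" if "j \<le> I" for j
    using that
  proof (induction rule: inc_induct)
    case base
    have "length (degree_word u) \<ge> 1" for u by (cases u) simp
    then show ?case using maximal_subtrees_size_le[of _ "m I" t] mI by (smt (verit, best) of_nat_1 of_nat_mono)
  next
    case (step j)
    show ?case
    proof
      fix u assume u: "u \<in> set (maximal_subtrees (m j) t)"
      have "levels u \<le> heavy_levels (m (Suc j)) u + (\<Sum>i=Suc j..<I. A i)"
        using step.IH maximal_subtrees_trans[OF u _ dec] by (intro levels_le) auto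
      also have "\<dots> \<le> A j + (\<Sum>i=Suc j..<I. A i)" using A[OF step.hyps(2) u] by simp
      also have "\<dots> = (\<Sum>i=j..<I. A i)" using step.hyps(2) by (simp add: sum.atLeast_Suc_lessThan)
      finally show "levels u \<le> (\<Sum>i=j..<I. A i)" .
    qed
  qed
  have "t \<in> set (maximal_subtrees (m 0) t)" using m0 by (cases t) simp
  then show ?thesis using claim[of 0] by (simp add: atLeast0LessThan)
qed

section \<open>The height for prescribed degrees\<close>

text \<open>Markov's inequality: each tree in the set has at least m / 2 deep vertices inside its
  maximal subtrees, whereas the class average of their number is at most \<open>size c\<close> times
  the exponential factor.\<close>

lemma card_tree_class_heavy_le:
  fixes m \<delta> :: real
  assumes m: "m > 0" and \<delta>: "\<delta> \<ge> 0"
  shows "real (card {t \<in> tree_class c. \<exists>u\<in>set (maximal_subtrees m t).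
            L < heavy_levels (m / 2) u \<and> \<delta> * length (degree_word u) \<le> count (mset (degree_word u)) 0})
     \<le> 2 * size c / m * exp (- \<delta> * (real L * (real L - 1)) / (2 * m)) * card (tree_class c)"
    (is "real (card ?S) \<le> _")
proof -
  define B where "B = exp (- \<delta> * (real L * (real L - 1)) / (2 * m))"
  \<comment> \<open>The condition on leaves depends only on the degrees of \<open>u\<close>, so on
    each class \<open>f\<close> is either \<open>deep_count L\<close> throughout or 0
    throughout.\<close>
  define f where "f = (\<lambda>u. if \<delta> * length (degree_word u) \<le> count (mset (degree_word u)) 0
      then real (deep_count L u) else 0)"
  define g where "g = (\<lambda>u. B * length (degree_word u))"
  have f0: "f u \<ge> 0" for u by (simp add: f_def)
  have class_le: "(\<Sum>t\<in>tree_class d. f t) \<le> (\<Sum>t\<in>tree_class d. g t)" if d: "real (size d) \<le> m" for d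
  proof (cases "tree_class d = {}")
    case False
    then have sum: "sum_mset d + 1 = size d" by (rule tree_class_nonempty_imp)
    have len: "length (degree_word t) = size d" if "t \<in> tree_class d" for t
      using that by (auto simp: tree_class_def simp flip: size_mset)
    have g: "(\<Sum>t\<in>tree_class d. g t) = card (tree_class d) * (size d * B)"
      by (simp add: g_def len)
    show ?thesis
    proof (cases "\<delta> * size d \<le> count d 0")
      case True
      have "(\<Sum>t\<in>tree_class d. f t) \<le> (\<Sum>t\<in>tree_class d. real (deep_count L t))"
        by (intro sum_mono) (simp add: f_def)
      also have "\<dots> = card (tree_class d) * (size d * sample_mean real L d)"
        by (rule sum_tree_class_deep_count)
      also have "sample_mean real L d \<le> exp (- \<delta> * (real L * (real L - 1)) / (2 * real (size d)))"
        using sum by (intro sample_mean_le_exp \<delta> True) auto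
      also have "\<dots> \<le> B"
      proof -
        have "0 \<le> real L * (real L - 1)" by (cases L) auto
        then have "0 \<le> \<delta> * (real L * (real L - 1))" using \<delta> by simp
        moreover have "real (size d) > 0" using sum by simp
        ultimately have "\<delta> * (real L * (real L - 1)) / (2 * m) \<le> \<delta> * (real L * (real L - 1)) / (2 * real (size d))"
          using d by (intro divide_left_mono) auto
        then show ?thesis by (simp add: B_def)
      qed
      finally show ?thesis unfolding g by (simp add: mult_left_mono)
    next
      case False
      then have "(\<Sum>t\<in>tree_class d. f t) = 0"
        using len by (intro sum.neutral) (auto simp: f_def tree_class_def)
      also have "0 \<le> (\<Sum>t\<in>tree_class d. g t)" unfolding g by (simp add: B_def)
      finally show ?thesis .
    qed
  qed simp
  have "m / 2 * card ?S = (\<Sum>t\<in>?S. m / 2)" by simp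
  also have "\<dots> \<le> (\<Sum>t\<in>?S. \<Sum>u\<leftarrow>maximal_subtrees m t. f u)"
  proof (intro sum_mono)
    fix t assume "t \<in> ?S"
    then obtain u where u: "u \<in> set (maximal_subtrees m t)" "L < heavy_levels (m / 2) u"
        "\<delta> * length (degree_word u) \<le> count (mset (degree_word u)) 0" by blast
    have "m / 2 \<le> f u" using deep_count_gr[OF u(2)] u(3) by (simp add: f_def)
    also have "\<dots> \<le> (\<Sum>u\<leftarrow>maximal_subtrees m t. f u)"
      using u(1) f0 by (intro member_le_sum_list) auto
    finally show "m / 2 \<le> (\<Sum>u\<leftarrow>maximal_subtrees m t. f u)" .
  qed
  also have "\<dots> \<le> (\<Sum>t\<in>tree_class c. \<Sum>u\<leftarrow>maximal_subtrees m t. f u)"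
    using f0 by (intro sum_mono2) (auto intro!: sum_list_nonneg)
  also have "\<dots> \<le> (\<Sum>t\<in>tree_class c. \<Sum>u\<leftarrow>maximal_subtrees m t. g u)"
    by (rule sum_maximal_subtrees_mono) (rule class_le)
  also have "\<dots> \<le> (\<Sum>t\<in>tree_class c. B * size c)"
  proof (intro sum_mono)
    fix t assume "t \<in> tree_class c"
    then have len: "length (degree_word t) = size c" by (auto simp: tree_class_def simp flip: size_mset)
    have "(\<Sum>u\<leftarrow>us. g u) = B * real (\<Sum>u\<leftarrow>us. length (degree_word u))" for us
      by (induction us) (auto simp: g_def algebra_simps)
    then have "(\<Sum>u\<leftarrow>maximal_subtrees m t. g u) = B * real (\<Sum>u\<leftarrow>maximal_subtrees m t. length (degree_word u))" .
    also have "\<dots> \<le> B * size c"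
      using sum_maximal_subtrees_length_le[of m t] len by (intro mult_left_mono) (auto simp: B_def)
    finally show "(\<Sum>u\<leftarrow>maximal_subtrees m t. g u) \<le> B * size c" .
  qed
  finally have "m / 2 * card ?S \<le> card (tree_class c) * (B * size c)" by simp
  then show ?thesis using m unfolding B_def[symmetric] by (simp add: field_simps)
qed

text \<open>A Chernoff bound without replacement. Weighting zeros by exp(-1) gives mean at most 1 -
  p / 2, because 1 - exp(-1) \<ge> 1 / 2, and Maclaurin's inequality compares with independent
  draws. Half of the resulting rate p / 2 pays for the threshold p / 4.\<close>

lemma card_words_few_zeros_le:
  fixes p :: real and c :: "nat multiset"
  assumes p: "p \<ge> 0" and zeros: "p * size c \<le> count c 0" and k: "k \<le> size c" and ne: "c \<noteq> {#}"
  shows "real (card {xs \<in> permutations_of_multiset c. count (mset (take k xs)) 0 < p / 4 * k})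
    \<le> num_words c * exp (- p / 4 * k)" (is "real (card ?S) \<le> _")
proof -
  define y where "y = (\<lambda>x::nat. if x = 0 then exp (-1) else 1 :: real)"
  have y0: "y x \<ge> 0" for x by (simp add: y_def)
  have prod: "prod_list (map y xs) = exp (- real (count (mset xs) 0))" for xs
    by (induction xs) (auto simp: y_def simp flip: exp_add)
  have sum_y: "(\<Sum>x\<in>#c. y x) = size c - (1 - exp (-1)) * count c 0"
    by (induction c) (auto simp: y_def algebra_simps)
  have "exp (-1) \<le> (1/2 :: real)" using exp_ge_add_one_self[of "1::real"]
    by (simp add: exp_minus field_simps)
  then have "1/2 * (p * size c) \<le> (1 - exp (-1)) * count c 0"
    using zeros p by (intro mult_mono) auto
  then have "(\<Sum>x\<in>#c. y x) \<le> (1 - p / 2) * size c" unfolding sum_y by (simp add: algebra_simps)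
  then have "(\<Sum>x\<in>#c. y x) / size c \<le> 1 - p / 2"
    using ne by (simp add: divide_le_eq nonempty_has_size)
  also have "\<dots> \<le> exp (- p / 2)" using exp_ge_add_one_self[of "- p / 2"] by simp
  finally have avg: "(\<Sum>x\<in>#c. y x) / size c \<le> exp (- p / 2)" .
  have avg0: "0 \<le> (\<Sum>x\<in>#c. y x) / size c"
    using sum_mset_nonneg_real[of c y] y0 by simp
  have "exp (- p / 4 * k) * card ?S = (\<Sum>xs\<in>?S. exp (- p / 4 * k))" by simp
  also have "\<dots> \<le> (\<Sum>xs\<in>?S. prod_list (map y (take k xs)))"
    by (intro sum_mono) (auto simp: prod)
  also have "\<dots> \<le> (\<Sum>xs\<in>permutations_of_multiset c. prod_list (map y (take k xs)))"
    by (intro sum_mono2) (auto simp: prod)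
  also have "\<dots> = num_words c * sample_mean y k c" by (rule sum_prod_list_take[OF k])
  also have "\<dots> \<le> num_words c * exp (- p / 2) ^ k"
    using order_trans[OF sample_mean_le_power[of y, OF y0 k] power_mono[OF avg avg0]]
    by (intro mult_left_mono) auto
  also have "exp (- p / 2) ^ k = exp (- p / 4 * k) * exp (- p / 4 * k)"
    by (simp flip: exp_of_nat_mult exp_add)
  finally show ?thesis by simp
qed

text \<open>Subtrees are infixes of the degree_word word. The crude union bound over positions costs only
  a power of \<open>size c\<close>, which is harmless because all subtrees in question have size at least a power
  of \<open>size c\<close>.\<close>

lemma card_tree_class_infix_few_zeros_le:
  fixes p :: real
  assumes p: "p \<ge> 0" and zeros: "p * size c \<le> count c 0"
  shows "real (card {t \<in> tree_class c. \<exists>as ys bs. degree_word t = as @ ys @ bs \<and> length ys = k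
            \<and> count (mset ys) 0 < p / 4 * k})
    \<le> real (size c) ^ 2 * exp (- p / 4 * k) * card (tree_class c)" (is "real (card ?S) \<le> _")
proof (cases "?S = {}")
  case False
  then obtain t0 as0 ys0 bs0 where t0: "t0 \<in> tree_class c" "degree_word t0 = as0 @ ys0 @ bs0" "length ys0 = k"
    "count (mset ys0) 0 < p / 4 * k" by blast
  have sum: "sum_mset c + 1 = size c" using t0(1) by (intro tree_class_nonempty_imp) auto
  then have ne: "c \<noteq> {#}" by auto
  have "size c = length (degree_word t0)" using t0(1) by (auto simp: tree_class_def simp flip: size_mset)
  then have kn: "k \<le> size c" using t0 by simp
  have k0: "k > 0" using t0(4) by (cases k) auto
  define W where "W = (\<lambda>i. {xs \<in> permutations_of_multiset c. count (mset (take k (drop i xs))) 0 < p / 4 * k})"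
  have cardW: "real (card (W i)) \<le> num_words c * exp (- p / 4 * k)" if i: "i + k \<le> size c" for i
  proof -
    \<comment> \<open>Rotating the word moves the infix at position i to the front and keeps the
      letters.\<close>
    have "card (W i) \<le> card {xs \<in> permutations_of_multiset c. count (mset (take k xs)) 0 < p / 4 * k}"
    proof (rule card_inj_on_le)
      show "inj_on (\<lambda>xs. drop i xs @ take i xs) (W i)"
      proof (rule inj_onI)
        fix xs ys assume "xs \<in> W i" "ys \<in> W i" and eq: "drop i xs @ take i xs = drop i ys @ take i ys"
        then have "length xs = length ys"
          by (simp add: W_def permutations_of_multiset_def) (metis size_mset)
        then have "drop i xs = drop i ys \<and> take i xs = take i ys" using eq by simp
        then show "xs = ys" by (metis append_take_drop_id)
      qed
      show "(\<lambda>xs. drop i xs @ take i xs) ` W i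
          \<subseteq> {xs \<in> permutations_of_multiset c. count (mset (take k xs)) 0 < p / 4 * k}"
      proof (intro subsetI)
        fix zs assume "zs \<in> (\<lambda>xs. drop i xs @ take i xs) ` W i"
        then obtain xs where xs: "xs \<in> W i" "zs = drop i xs @ take i xs" by blast
        have "mset zs = mset (take i xs @ drop i xs)" using xs(2) by (simp only: mset_append union_commute)
        then have "mset zs = c" using xs(1) by (auto simp: W_def permutations_of_multiset_def)
        moreover have "length xs = size c"
          using xs(1) by (auto simp: W_def dest: length_finite_permutations_of_multiset)
        then have "take k zs = take k (drop i xs)" using i xs(2) by simp
        ultimately show "zs \<in> {xs \<in> permutations_of_multiset c. count (mset (take k xs)) 0 < p / 4 * k}"
          using xs(1) by (auto simp: W_def permutations_of_multiset_def)
      qed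
    qed simp
    then show ?thesis using card_words_few_zeros_le[OF p zeros kn ne] by linarith
  qed
  have "degree_word ` ?S \<subseteq> (\<Union>i\<in>{..size c - k}. W i)"
  proof (intro subsetI)
    fix xs assume "xs \<in> degree_word ` ?S"
    then obtain as ys bs where xs: "mset xs = c" "xs = as @ ys @ bs" "length ys = k" "count (mset ys) 0 < p / 4 * k"
      by (auto simp: tree_class_def)
    have "take k (drop (length as) xs) = ys" using xs by simp
    moreover have "length as \<le> size c - k" using xs by auto
    ultimately show "xs \<in> (\<Union>i\<in>{..size c - k}. W i)"
      using xs by (intro UN_I[of "length as"]) (auto simp: W_def permutations_of_multiset_def)
  qed
  then have "card (degree_word ` ?S) \<le> card (\<Union>i\<in>{..size c - k}. W i)"
    by (intro card_mono) (auto simp: W_def)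
  also have "\<dots> \<le> (\<Sum>i\<in>{..size c - k}. card (W i))" by (rule card_UN_le) simp
  finally have "real (card ?S) \<le> (\<Sum>i\<in>{..size c - k}. real (card (W i)))"
    using inj_degree_word by (simp add: card_image inj_on_def flip: of_nat_sum)
  also have "\<dots> \<le> (\<Sum>i\<in>{..size c - k}. num_words c * exp (- p / 4 * k))"
    using kn by (intro sum_mono cardW) auto
  also have "\<dots> = real (size c - k + 1) * (num_words c * exp (- p / 4 * k))" by simp
  \<comment> \<open>One factor \<open>size c\<close> bounds the number of positions; the other comes
    from the cycle lemma, by which there are \<open>size c\<close> words per tree.\<close>
  also have "\<dots> \<le> real (size c) * (num_words c * exp (- p / 4 * k))"
    using k0 kn by (intro mult_right_mono) auto
  also have "\<dots> = real (size c) ^ 2 * exp (- p / 4 * k) * card (tree_class c)"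
    by (simp add: power2_eq_square flip: cycle_lemma_trees[OF sum])
  finally show ?thesis .
next
  case True
  show ?thesis unfolding True by simp
qed

lemma summable_scales:
  fixes \<gamma> :: real
  assumes "\<gamma> > 0"
  shows "summable (\<lambda>i. 2 ^ (i + 1) * exp (- \<gamma> * (sqrt 2 ^ i - 1)))"
proof (rule summable_comparison_test_ev)
  \<comment> \<open>With 4^i in place of 2^i, a factor 2^i is left over to produce the geometric
    majorant.\<close>
  have "(\<lambda>i. 4 ^ i * exp (- \<gamma> * (sqrt 2 ^ i - 1))) \<longlonglongrightarrow> 0"
    using assms by real_asymp
  then have "eventually (\<lambda>i. 4 ^ i * exp (- \<gamma> * (sqrt 2 ^ i - 1)) < 1) sequentially"
    by (rule order_tendstoD) simp
  then show "eventually (\<lambda>i. norm (2 ^ (i + 1) * exp (- \<gamma> * (sqrt 2 ^ i - 1))) \<le> 2 * (1/2) ^ i) sequentially"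
  proof eventually_elim
    case (elim i)
    have "(2::real) ^ i * 2 ^ i = 4 ^ i" by (simp flip: power_mult_distrib)
    with elim have "2 ^ i * (2 ^ i * exp (- \<gamma> * (sqrt 2 ^ i - 1))) < 1" by (simp add: mult.assoc[symmetric])
    then show ?case by (simp add: power_divide field_simps)
  qed
  show "summable (\<lambda>i. 2 * (1/2::real) ^ i)" by (intro summable_mult summable_geometric) simp
qed

text \<open>At scale \<open>m i = n / 2 ^ i\<close> the piece of the path may have length \<open>x i\<close>, a fraction of
  order \<open>\<beta> ^ i\<close> of \<open>h\<close> with \<open>\<beta> = 2 powr (-1/4)\<close>. Then \<open>(x i)\<^sup>2 / m i\<close> grows like \<open>sqrt 2 ^ i\<close>, which beats
  the factor \<open>2 ^ (i + 1)\<close>; and a nonempty scale has \<open>x i \<le> m i\<close>, which bounds the sizes of the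
  relevant subtrees from below.\<close>

lemma card_tree_class_levels_le:
  fixes p :: real
  assumes p: "0 < p"
  shows "\<exists>C>0. \<exists>\<gamma>>0. \<exists>N. \<forall>c t. size c \<ge> N \<and> p * size c \<le> count c 0 \<and> t > 1 \<longrightarrow>
    real (card {T \<in> tree_class c. levels T > t * sqrt (size c)}) \<le> C * exp (- \<gamma> * t\<^sup>2) * card (tree_class c)"
proof -
  define \<kappa> where "\<kappa> = sqrt (2::real)"
  define \<beta> where "\<beta> = 1 / sqrt \<kappa>"
  \<comment> \<open>The sum of a \<beta>^i over all i is 1, so the lengths \<open>x i\<close> add up
    to at most \<open>h\<close>.\<close>
  define a where "a = 1 - \<beta>"
  \<comment> \<open>p / 4 is the proportion of leaves kept inside subtrees. The 8 is the 2 in the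
    exponent of the sampling bound times the 4 lost in comparing \<open>A i * (A i - 1)\<close> with
    the square of \<open>x i\<close>.\<close>
  define \<gamma> where "\<gamma> = p / 4 * a\<^sup>2 / 8"
  define C where "C = exp (p / 8) * (\<Sum>i. 2 ^ (i + 1) * exp (- \<gamma> * (\<kappa> ^ i - 1)))"
  have \<kappa>: "\<kappa> > 1" "\<kappa>\<^sup>2 = 2" by (auto simp: \<kappa>_def)
  have \<beta>: "\<beta> > 0" "\<beta> < 1" "\<beta>\<^sup>2 = 1 / \<kappa>" using \<kappa>(1) by (auto simp: \<beta>_def power_divide)
  have a: "a > 0" "a < 1" using \<beta> by (auto simp: a_def)
  have \<gamma>: "\<gamma> > 0" using p a by (simp add: \<gamma>_def)
  have summable: "summable (\<lambda>i. 2 ^ (i + 1) * exp (- \<gamma> * (\<kappa> ^ i - 1)))"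
    using summable_scales[OF \<gamma>] by (simp add: \<kappa>_def)
  have C: "C > 0" unfolding C_def
    using summable by (intro mult_pos_pos suminf_pos) auto
  \<comment> \<open>The power n^3 consists of n^2 from the union bound over infixes and at most n
    lengths. Half of the rate p / 4 is spent here; the other half yields the decay in t.\<close>
  have "(\<lambda>n. real n ^ 3 * exp (- (p / 8) * root 3 (a ^ 4 * real n / 8))) \<longlonglongrightarrow> 0"
  proof -
    have "(\<lambda>n. real n ^ 3 * exp (- (p / 8) * (a ^ 4 * real n / 8) powr (1/3))) \<longlonglongrightarrow> 0"
      using p a(1) by real_asymp
    moreover have "eventually (\<lambda>n. real n ^ 3 * exp (- (p / 8) * (a ^ 4 * real n / 8) powr (1/3))
        = real n ^ 3 * exp (- (p / 8) * root 3 (a ^ 4 * real n / 8))) sequentially"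
      using eventually_gt_at_top[of 0] by eventually_elim (use a(1) in \<open>simp add: root_powr_inverse\<close>)
    ultimately show ?thesis by (rule Lim_transform_eventually)
  qed
  then have "eventually (\<lambda>n. real n ^ 3 * exp (- (p / 8) * root 3 (a ^ 4 * real n / 8)) < 1) sequentially"
    by (rule order_tendstoD) simp
  then obtain N where N: "\<And>n. n \<ge> N \<Longrightarrow> real n ^ 3 * exp (- (p / 8) * root 3 (a ^ 4 * real n / 8)) < 1"
    by (auto simp: eventually_sequentially)
  show ?thesis
  proof (intro exI conjI allI impI)
    show "C + 1 > 0" "\<gamma> > 0" using C \<gamma> by auto
    fix c :: "nat multiset" and t :: real
    assume asm: "size c \<ge> max 1 N \<and> p * size c \<le> count c 0 \<and> t > 1"
    define n where "n = size c"
    have n: "n \<ge> 1" "n \<ge> N" and zeros: "p * size c \<le> count c 0" and t: "t > 1"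
      using asm by (auto simp: n_def)
    have n0: "real n > 0" using n by simp
    define M where "M = real (card (tree_class c))"
    define h where "h = t * sqrt n"
    define m where "m = (\<lambda>i. real n / 2 ^ i)"
    define x where "x = (\<lambda>i. a * h * \<beta> ^ i)"
    define A where "A = (\<lambda>i. nat \<lfloor>x i\<rfloor>)"
    have h: "h > 0" using t n by (simp add: h_def)
    have m_pos: "m i > 0" for i using n0 by (simp add: m_def)
    have m_Suc: "m (Suc i) = m i / 2" for i by (simp add: m_def)
    have x_pos: "x i > 0" for i using a h \<beta> by (simp add: x_def)
    have A_le: "real (A i) \<le> x i" and A_ge: "x i < real (A i) + 1" for i
      using x_pos[of i] by (auto simp: A_def)
    have x_m: "(x i)\<^sup>2 = a\<^sup>2 * t\<^sup>2 * \<kappa> ^ i * m i" for i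
    proof -
      have "(\<beta> ^ i)\<^sup>2 * (\<kappa> ^ i)\<^sup>2 = \<kappa> ^ i"
      proof -
        have "(\<beta> ^ i)\<^sup>2 * (\<kappa> ^ i)\<^sup>2 = (\<beta>\<^sup>2 * \<kappa>\<^sup>2) ^ i"
          by (simp add: power_mult_distrib flip: power_mult) (simp add: mult.commute power_mult)
        also have "\<beta>\<^sup>2 * \<kappa>\<^sup>2 = \<kappa>" unfolding \<beta>(3) using \<kappa>(1) by (simp add: power2_eq_square)
        finally show ?thesis .
      qed
      moreover have "(\<kappa> ^ i)\<^sup>2 = 2 ^ i" using \<kappa>(2) by (metis power_mult mult.commute)
      ultimately have "(\<beta> ^ i)\<^sup>2 = \<kappa> ^ i / 2 ^ i" by (simp add: eq_divide_eq)
      moreover have "h\<^sup>2 = t\<^sup>2 * n" by (simp add: h_def power_mult_distrib)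
      ultimately show ?thesis by (simp add: x_def m_def power_mult_distrib)
    qed
    define S where "S = (\<lambda>i. {T \<in> tree_class c. \<exists>u\<in>set (maximal_subtrees (m i) T).
        A i < heavy_levels (m i / 2) u \<and> p / 4 * length (degree_word u) \<le> count (mset (degree_word u)) 0})"
    \<comment> \<open>The possible sizes of a subtree with too long a piece. Both lower bounds
      follow from \<open>x i\<close> \<le> k \<le> \<open>m i\<close> < 2 k; the one gives decay in
      t, the other decay in n.\<close>
    define K where "K = {k. k \<le> n \<and> a\<^sup>2 * t\<^sup>2 \<le> real k \<and> a ^ 4 * real n / 8 \<le> real k ^ 3}"
    define Bad where "Bad = (\<lambda>k. {T \<in> tree_class c. \<exists>as ys bs. degree_word T = as @ ys @ bs \<and> length ys = k
            \<and> count (mset ys) 0 < p / 4 * k})"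
    have len: "length (degree_word T) = n" if "T \<in> tree_class c" for T
      using that by (auto simp: tree_class_def n_def simp flip: size_mset)
    \<comment> \<open>n scales suffice since n / 2^n < 1. At a scale with too long a piece, the
      subtree either keeps a proportion p / 4 of leaves or yields an infix with too few of
      them.\<close>
    have cover: "{T \<in> tree_class c. levels T > h} \<subseteq> (\<Union>i<n. S i) \<union> (\<Union>k\<in>K. Bad k)"
    proof (intro subsetI)
      fix T assume "T \<in> {T \<in> tree_class c. levels T > h}"
      then have T: "T \<in> tree_class c" and lev: "levels T > h" by auto
      have "\<exists>i<n. \<exists>u\<in>set (maximal_subtrees (m i) T). A i < heavy_levels (m (Suc i)) u"
      proof (rule ccontr)
        assume neg: "\<not> ?thesis"
        then have light: "heavy_levels (m (Suc i)) u \<le> A i" if "i < n" "u \<in> set (maximal_subtrees (m i) T)" for i u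
          using that by (meson not_less)
        have "levels T \<le> (\<Sum>i<n. A i)"
        proof (rule levels_le_sum)
          show "m (Suc i) \<le> m i" for i using m_pos[of i] by (simp add: m_Suc)
          show "real (length (degree_word T)) \<le> m 0" using len[OF T] by (simp add: m_def)
          have "real n < 2 ^ n" using of_nat_less_two_power[of n] by simp
          then show "m n < 1" by (simp add: m_def)
        qed (rule light)
        then have "real (levels T) \<le> (\<Sum>i<n. real (A i))" by (metis of_nat_le_iff of_nat_sum)
        also have "\<dots> \<le> (\<Sum>i<n. x i)" by (intro sum_mono A_le)
        also have "\<dots> = a * h * (\<Sum>i<n. \<beta> ^ i)" by (simp add: x_def sum_distrib_left)
        also have "(\<Sum>i<n. \<beta> ^ i) = (1 - \<beta> ^ n) / a"
          using \<beta> by (simp add: a_def sum_gp_strict)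
        also have "a * h * \<dots> = h * (1 - \<beta> ^ n)" using a by simp
        also have "\<dots> \<le> h" using h \<beta> by (simp add: algebra_simps)
        finally show False using lev by simp
      qed
      then obtain i u where i: "i < n" and u: "u \<in> set (maximal_subtrees (m i) T)" and Ai: "A i < heavy_levels (m i / 2) u"
        by (auto simp: m_Suc)
      define k where "k = length (degree_word u)"
      show "T \<in> (\<Union>i<n. S i) \<union> (\<Union>k\<in>K. Bad k)"
      proof (cases "p / 4 * k \<le> count (mset (degree_word u)) 0")
        case True
        then have "T \<in> S i" using T u Ai by (auto simp: S_def k_def)
        then show ?thesis using i by blast
      next
        case False
        obtain as bs where split: "degree_word T = as @ degree_word u @ bs"
          using degree_word_maximal_subtrees_infix[OF u] by blast
        have kn: "k \<le> n" using split len[OF T] by (simp add: k_def)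
        have km: "real k \<le> m i" using maximal_subtrees_size_le[OF u] by (simp add: k_def)
        have "heavy_levels (m i / 2) u > 0" using Ai by simp
        then have mk: "m i / 2 < real k" using deep_count_gr[of 0 "m i / 2" u] by (simp add: k_def)
        have "A i + 1 \<le> k" using Ai heavy_levels_le_size[of "m i / 2" u] by (simp add: k_def)
        then have xk: "x i \<le> k" using A_ge[of i] by linarith
        have \<kappa>i: "\<kappa> ^ i \<ge> 1" using \<kappa> by (intro one_le_power) auto
        have "a\<^sup>2 * t\<^sup>2 * m i \<le> a\<^sup>2 * t\<^sup>2 * \<kappa> ^ i * m i"
          using \<kappa>i m_pos[of i] mult_left_mono[OF \<kappa>i, of "a\<^sup>2 * t\<^sup>2 * m i"] by (simp add: mult_ac)
        also have "\<dots> = (x i)\<^sup>2" by (simp add: x_m)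
        also have "\<dots> \<le> real k ^ 2" using xk x_pos[of i] by (intro power_mono) auto
        also have "\<dots> \<le> real k * m i" using km by (simp add: power2_eq_square mult_left_mono)
        finally have 1: "a\<^sup>2 * t\<^sup>2 \<le> real k" using m_pos[of i] by simp
        have x4: "(x i) ^ 4 = a ^ 4 * t ^ 4 * n * m i"
        proof -
          have "(x i) ^ 4 = ((x i)\<^sup>2)\<^sup>2" by (simp flip: power_mult)
          also have "\<dots> = a ^ 4 * t ^ 4 * ((\<kappa> ^ i)\<^sup>2 * (m i * m i))"
            unfolding x_m by (simp add: power2_eq_square power4_eq_xxxx mult_ac)
          also have "(\<kappa> ^ i)\<^sup>2 * (m i * m i) = n * m i"
          proof -
            have "(\<kappa> ^ i)\<^sup>2 = 2 ^ i" using \<kappa>(2) by (metis power_mult mult.commute)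
            then show ?thesis by (simp add: m_def)
          qed
          finally show ?thesis by (simp add: mult_ac)
        qed
        have "(a ^ 4 * n) * m i \<le> (a ^ 4 * n) * m i * t ^ 4"
          using mult_left_mono[of 1 "t ^ 4" "(a ^ 4 * n) * m i"] one_le_power[of t 4] t m_pos[of i] a by simp
        also have "\<dots> = (x i) ^ 4" by (simp add: x4 mult_ac)
        also have "\<dots> \<le> m i ^ 4" using xk km x_pos[of i] by (intro power_mono) auto
        also have "\<dots> = m i ^ 3 * m i" by (simp add: power_eq_if)
        finally have "a ^ 4 * n \<le> m i ^ 3" using m_pos[of i] by simp
        then have "a ^ 4 * n / 8 \<le> (m i / 2) ^ 3" by (simp add: power_divide)
        also have "\<dots> \<le> real k ^ 3" using mk m_pos[of i] by (intro power_mono) auto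
        finally have 2: "a ^ 4 * n / 8 \<le> real k ^ 3" .
        have "k \<in> K" using kn 1 2 by (simp add: K_def)
        moreover have "degree_word T = as @ degree_word u @ bs \<and> length (degree_word u) = k
            \<and> count (mset (degree_word u)) 0 < p / 4 * k"
          using split False by (simp add: k_def)
        then have "T \<in> Bad k" using T unfolding Bad_def by blast
        ultimately show ?thesis by blast
      qed
    qed
    have card_S: "real (card (S i)) \<le> (exp (p / 8) * (2 ^ (i + 1) * exp (- \<gamma> * (\<kappa> ^ i - 1)))) * exp (- \<gamma> * t\<^sup>2) * M" for i
    proof (cases "S i = {}")
      case True
      then show ?thesis by (simp add: M_def)
    next
      case False
      then obtain T u where "u \<in> set (maximal_subtrees (m i) T)" by (auto simp: S_def)
      then have "real (length (degree_word u)) \<le> m i" by (rule maximal_subtrees_size_le)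
      moreover have "length (degree_word u) \<ge> 1" by (cases u) simp
      \<comment> \<open>A nonempty scale is at least 1, so \<open>m i\<close> can absorb the
        additive constant left by rounding.\<close>
      ultimately have m1: "m i \<ge> 1" by linarith
      have "a\<^sup>2 * t\<^sup>2 * \<kappa> ^ i * m i \<le> 4 * (real (A i) * (real (A i) - 1)) + 4"
      proof -
        have "(x i)\<^sup>2 \<le> (real (A i) + 1)\<^sup>2"
          using A_ge[of i] x_pos[of i] by (intro power_mono) auto
        \<comment> \<open>This square is the difference between 4 A (A - 1) + 4 and (A +
          1)^2.\<close>
        moreover have "0 \<le> 3 * (real (A i) - 1)\<^sup>2" by simp
        ultimately show ?thesis unfolding x_m by (simp add: power2_eq_square algebra_simps)
      qed
      then have "8 * \<gamma> * (t\<^sup>2 * \<kappa> ^ i) * m i \<le> p / 4 * (4 * (real (A i) * (real (A i) - 1)) + 4)"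
        using mult_left_mono[of _ _ "p / 4"] p by (simp add: \<gamma>_def mult_ac)
      also have "\<dots> \<le> p * (real (A i) * (real (A i) - 1)) + p * m i"
        using m1 p by (simp add: algebra_simps)
      finally have "\<gamma> * (t\<^sup>2 * \<kappa> ^ i) - p / 8 \<le> p / 4 * (real (A i) * (real (A i) - 1)) / (2 * m i)"
        using m_pos[of i] by (simp add: field_simps)
      \<comment> \<open>Since t and \<kappa> exceed 1, the product of t^2 and \<kappa>^i dominates a
        sum, which separates the decay in t from the summability over scales.\<close>
      moreover have "\<gamma> * t\<^sup>2 + \<gamma> * (\<kappa> ^ i - 1) \<le> \<gamma> * (t\<^sup>2 * \<kappa> ^ i)"
      proof -
        have "\<kappa> ^ i \<ge> 1" using \<kappa> by (intro one_le_power) auto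
        then have "0 \<le> (t\<^sup>2 - 1) * (\<kappa> ^ i - 1)" using t by (intro mult_nonneg_nonneg) auto
        then have "t\<^sup>2 + (\<kappa> ^ i - 1) \<le> t\<^sup>2 * \<kappa> ^ i" by (simp add: algebra_simps)
        then show ?thesis using mult_left_mono[of _ _ \<gamma>] \<gamma> by (simp flip: distrib_left)
      qed
      ultimately have "- (p / 4) * (real (A i) * (real (A i) - 1)) / (2 * m i)
          \<le> p / 8 + (- \<gamma> * (\<kappa> ^ i - 1)) + (- \<gamma> * t\<^sup>2)" by simp
      then have e: "exp (- (p / 4) * (real (A i) * (real (A i) - 1)) / (2 * m i))
          \<le> exp (p / 8) * exp (- \<gamma> * (\<kappa> ^ i - 1)) * exp (- \<gamma> * t\<^sup>2)"
        by (simp only: flip: exp_add) simp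
      have "real (card (S i)) \<le> 2 * size c / m i * exp (- (p / 4) * (real (A i) * (real (A i) - 1)) / (2 * m i)) * M"
        unfolding S_def M_def using p m_pos by (intro card_tree_class_heavy_le) auto
      also have "2 * size c / m i = 2 ^ (i + 1)" using n0 by (simp add: m_def flip: n_def)
      also have "2 ^ (i + 1) * exp (- (p / 4) * (real (A i) * (real (A i) - 1)) / (2 * m i)) * M
          \<le> 2 ^ (i + 1) * (exp (p / 8) * exp (- \<gamma> * (\<kappa> ^ i - 1)) * exp (- \<gamma> * t\<^sup>2)) * M"
        by (intro mult_right_mono mult_left_mono e) (auto simp: M_def)
      finally show ?thesis by (simp add: mult_ac)
    qed
    have card_Bad: "real (card (Bad k)) \<le> real n ^ 2 * exp (- (p / 8) * root 3 (a ^ 4 * real n / 8)) * exp (- \<gamma> * t\<^sup>2) * M"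
      if k: "k \<in> K" for k
    proof -
      have "root 3 (a ^ 4 * real n / 8) \<le> root 3 (real k ^ 3)" using k by (simp add: K_def)
      then have k3: "root 3 (a ^ 4 * real n / 8) \<le> real k" by (simp add: real_root_power_cancel)
      have "\<gamma> * t\<^sup>2 \<le> p / 8 * (a\<^sup>2 * t\<^sup>2)" using p by (simp add: \<gamma>_def)
      also have "\<dots> \<le> p / 8 * k" using k p by (intro mult_left_mono) (auto simp: K_def)
      finally have "- p / 4 * k \<le> - (p / 8) * root 3 (a ^ 4 * real n / 8) + (- \<gamma> * t\<^sup>2)"
        using mult_left_mono[OF k3, of "p / 8"] p by linarith
      then have e: "exp (- p / 4 * k) \<le> exp (- (p / 8) * root 3 (a ^ 4 * real n / 8)) * exp (- \<gamma> * t\<^sup>2)"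
        by (simp only: exp_le_cancel_iff flip: exp_add)
      have "real (card (Bad k)) \<le> real (size c) ^ 2 * exp (- p / 4 * k) * card (tree_class c)"
        unfolding Bad_def using p zeros by (intro card_tree_class_infix_few_zeros_le) auto
      also have "\<dots> \<le> real n ^ 2 * (exp (- (p / 8) * root 3 (a ^ 4 * real n / 8)) * exp (- \<gamma> * t\<^sup>2)) * M"
        unfolding n_def[symmetric] M_def by (intro mult_right_mono mult_left_mono e) auto
      finally show ?thesis by (simp add: mult_ac)
    qed
    have fin_K: "finite K" unfolding K_def by auto
    have "0 < a\<^sup>2 * t\<^sup>2" using a t by simp
    then have "k \<noteq> 0" if "k \<in> K" for k using that by (cases k) (auto simp: K_def)
    then have "K \<subseteq> {1..n}" by (force simp: K_def)
    then have card_K: "real (card K) \<le> n" using card_mono[of "{1..n}" K] by simp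
    have "card {T \<in> tree_class c. levels T > h} \<le> card ((\<Union>i<n. S i) \<union> (\<Union>k\<in>K. Bad k))"
      using cover fin_K by (intro card_mono) (auto simp: S_def Bad_def)
    also have "\<dots> \<le> card (\<Union>i<n. S i) + card (\<Union>k\<in>K. Bad k)" by (rule card_Un_le)
    also have "\<dots> \<le> (\<Sum>i<n. card (S i)) + (\<Sum>k\<in>K. card (Bad k))"
      using fin_K by (intro add_mono card_UN_le) auto
    finally have "real (card {T \<in> tree_class c. levels T > h}) \<le> (\<Sum>i<n. real (card (S i))) + (\<Sum>k\<in>K. real (card (Bad k)))"
      by (simp flip: of_nat_sum of_nat_add)
    also have "(\<Sum>i<n. real (card (S i))) \<le> C * exp (- \<gamma> * t\<^sup>2) * M"
    proof -
      have "(\<Sum>i<n. real (card (S i)))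
          \<le> (\<Sum>i<n. (exp (p / 8) * (2 ^ (i + 1) * exp (- \<gamma> * (\<kappa> ^ i - 1)))) * exp (- \<gamma> * t\<^sup>2) * M)"
        by (intro sum_mono card_S)
      also have "\<dots> = exp (p / 8) * (\<Sum>i<n. 2 ^ (i + 1) * exp (- \<gamma> * (\<kappa> ^ i - 1))) * exp (- \<gamma> * t\<^sup>2) * M"
        by (simp only: sum_distrib_left sum_distrib_right)
      also have "\<dots> \<le> C * exp (- \<gamma> * t\<^sup>2) * M"
        unfolding C_def using summable
        by (intro mult_right_mono mult_left_mono sum_le_suminf) (auto simp: M_def)
      finally show ?thesis .
    qed
    also have "(\<Sum>k\<in>K. real (card (Bad k))) \<le> 1 * exp (- \<gamma> * t\<^sup>2) * M"
    proof -
      define D where "D = exp (- (p / 8) * root 3 (a ^ 4 * real n / 8))"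
      have "(\<Sum>k\<in>K. real (card (Bad k))) \<le> (\<Sum>k\<in>K. real n ^ 2 * D * exp (- \<gamma> * t\<^sup>2) * M)"
        unfolding D_def by (intro sum_mono card_Bad)
      also have "\<dots> = card K * (real n ^ 2 * D) * exp (- \<gamma> * t\<^sup>2) * M" by simp
      also have "\<dots> \<le> n * (real n ^ 2 * D) * exp (- \<gamma> * t\<^sup>2) * M"
        using card_K by (intro mult_right_mono) (auto simp: M_def D_def)
      also have "n * (real n ^ 2 * D) = real n ^ 3 * D" by (simp add: power_eq_if)
      also have "real n ^ 3 * D * exp (- \<gamma> * t\<^sup>2) * M \<le> 1 * exp (- \<gamma> * t\<^sup>2) * M"
        using N[OF n(2)] unfolding D_def by (intro mult_right_mono) (auto simp: M_def)
      finally show ?thesis .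
    qed
    finally show "real (card {T \<in> tree_class c. levels T > t * sqrt (size c)}) \<le> (C + 1) * exp (- \<gamma> * t\<^sup>2) * card (tree_class c)"
      by (simp add: h_def n_def M_def algebra_simps)
  qed
qed

section \<open>Weights and the partition function\<close>

lemma card_vertices: "card (vertices t) = length (degree_word t)"
proof (induction t)
  case (Node ts)
  have "(\<Sum>i<length ts. card (vertices (ts ! i))) = (\<Sum>i<length ts. length (degree_word (ts ! i)))"
    by (intro sum.cong refl Node) auto
  then show ?case
    by (simp add: card_vertices_Node length_concat sum_list_sum_nth atLeast0LessThan)
qed

lemma num_children_Cons:
  assumes "i < length ts"
  shows "num_children (Node ts) (i # v) = num_children (ts ! i) v"
proof -
  have "(i # v) @ [j] \<in> vertices (Node ts) \<longleftrightarrow> v @ [j] \<in> vertices (ts ! i)" for j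
    using assms by (auto simp: vertices_Node)
  then show ?thesis by (simp add: num_children_def)
qed

lemma weight_eq: "weight w t = prod_list (map w (degree_word t))"
proof (induction t)
  case (Node ts)
  let ?f = "\<lambda>v. w (num_children (Node ts) v)"
  have "weight w (Node ts) = ?f [] * (\<Prod>v\<in>(\<Union>i<length ts. (#) i ` vertices (ts ! i)). ?f v)"
    unfolding weight_def vertices_Node by (subst prod.insert) (auto simp: finite_vertices)
  also have "(\<Prod>v\<in>(\<Union>i<length ts. (#) i ` vertices (ts ! i)). ?f v)
      = (\<Prod>i<length ts. \<Prod>v\<in>(#) i ` vertices (ts ! i). ?f v)"
    by (rule prod.UNION_disjoint) (auto simp: finite_vertices)
  also have "\<dots> = (\<Prod>i<length ts. weight w (ts ! i))"
    by (intro prod.cong refl) (simp add: prod.reindex num_children_Cons weight_def)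
  also have "\<dots> = (\<Prod>i<length ts. prod_list (map w (degree_word (ts ! i))))"
    by (intro prod.cong refl Node) auto
  also have "\<dots> = prod_list (map (\<lambda>t. prod_list (map w (degree_word t))) ts)"
    by (simp add: prod.list_conv_set_nth atLeast0LessThan)
  also have "\<dots> = prod_list (map w (concat (map degree_word ts)))"
    by (induction ts) auto
  finally show ?case by (simp add: num_children_root)
qed

lemma trees_eq: "trees n = {t. length (degree_word t) = n}"
  by (simp add: trees_def card_vertices)

lemma sum_degree_word: "sum_list (degree_word t) + 1 = length (degree_word t)"
  using sum_degree_word_concat[of "[t]" "degree_word t"] by simp

definition words :: "nat \<Rightarrow> nat \<Rightarrow> nat list set" where
  "words n s = {xs. length xs = n \<and> sum_list xs = s}"

lemma words_Suc: "words (Suc n) s = (\<Union>i\<in>{0..s}. (#) i ` words n (s - i))"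
proof (intro subset_antisym subsetI)
  fix xs assume "xs \<in> words (Suc n) s"
  then obtain x ys where "xs = x # ys" "length ys = n" "x + sum_list ys = s"
    by (auto simp: words_def length_Suc_conv)
  then show "xs \<in> (\<Union>i\<in>{0..s}. (#) i ` words n (s - i))"
    by (intro UN_I[of x]) (auto simp: words_def)
qed (auto simp: words_def)

lemma finite_words [simp]: "finite (words n s)"
proof (induction n arbitrary: s)
  case 0
  have "words 0 s \<subseteq> {[]}" by (auto simp: words_def)
  then show ?case by (rule finite_subset) simp
qed (simp add: words_Suc)

lemma fps_power_nth_words:
  "fps_nth (Abs_fps w ^ n) s = (\<Sum>xs\<in>words n s. prod_list (map w xs))"
  for w :: "nat \<Rightarrow> real"
proof (induction n arbitrary: s)
  case 0
  have "words 0 s = (if s = 0 then {[]} else {})" by (auto simp: words_def)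
  then show ?case by simp
next
  case (Suc n)
  have "fps_nth (Abs_fps w ^ Suc n) s = (\<Sum>i=0..s. w i * (\<Sum>xs\<in>words n (s - i). prod_list (map w xs)))"
    by (simp add: fps_mult_nth Suc.IH)
  also have "\<dots> = (\<Sum>i=0..s. \<Sum>xs\<in>(#) i ` words n (s - i). prod_list (map w xs))"
    by (simp add: sum.reindex sum_distrib_left)
  also have "\<dots> = (\<Sum>xs\<in>words (Suc n) s. prod_list (map w xs))"
    unfolding words_Suc by (rule sum.UNION_disjoint[symmetric]) auto
  finally show ?case .
qed

lemma sum_trees_group:
  fixes f :: "ptree \<Rightarrow> real"
  shows "(\<Sum>t\<in>trees n. f t) = (\<Sum>c\<in>mset ` degree_word ` trees n. \<Sum>t\<in>tree_class c. f t)"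
proof -
  have "(\<Sum>t\<in>trees n. f t) = (\<Sum>c\<in>mset ` degree_word ` trees n. \<Sum>t\<in>{t \<in> trees n. mset (degree_word t) = c}. f t)"
    by (rule sum.group[symmetric]) (auto simp: finite_trees)
  also have "\<dots> = (\<Sum>c\<in>mset ` degree_word ` trees n. \<Sum>t\<in>tree_class c. f t)"
  proof (intro sum.cong refl)
    fix c t
    assume c: "c \<in> mset ` degree_word ` trees n"
    show "{t \<in> trees n. mset (degree_word t) = c} = tree_class c"
      using c by (auto simp: trees_eq tree_class_def dest: mset_eq_length)
  qed
  finally show ?thesis .
qed

lemma weight_tree_class:
  assumes "t \<in> tree_class c"
  shows "weight w t = prod_mset (image_mset w c)"
proof -
  have "c = mset (degree_word t)" using assms by (simp add: tree_class_def)
  then show ?thesis by (simp add: weight_eq prod_mset_prod_list flip: mset_map)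
qed

text \<open>Lagrange inversion, as an instance of the cycle lemma.\<close>

lemma partition_function_eq_fps:
  assumes "n \<ge> 1"
  shows "real n * partition_function w n = fps_nth (Abs_fps w ^ n) (n - 1)"
proof -
  have word_class: "permutations_of_multiset c = {xs \<in> words n (n - 1). mset xs = c}"
    if c: "c \<in> mset ` words n (n - 1)" for c
  proof -
    obtain ys where ys: "ys \<in> words n (n - 1)" "c = mset ys" using c by auto
    have "xs \<in> words n (n - 1)" if "mset xs = mset ys" for xs
    proof -
      have "length xs = length ys" using that by (rule mset_eq_length)
      moreover have "sum_list xs = sum_list ys" using that by (metis sum_mset_sum_list)
      ultimately show ?thesis using ys by (simp add: words_def)
    qed
    then show ?thesis using ys by (auto simp: permutations_of_multiset_def)
  qed
  have size: "size c = n" "sum_mset c + 1 = size c" if "c \<in> mset ` words n (n - 1)" for c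
    using that assms by (auto simp: words_def sum_mset_sum_list)
  have sub: "mset ` degree_word ` trees n \<subseteq> mset ` words n (n - 1)"
  proof (intro image_mono subsetI)
    fix xs assume "xs \<in> degree_word ` trees n"
    then obtain t where t: "xs = degree_word t" "length (degree_word t) = n" by (auto simp: trees_eq)
    then show "xs \<in> words n (n - 1)" using sum_degree_word[of t] by (simp add: words_def)
  qed
  have "real n * partition_function w n
      = real n * (\<Sum>c\<in>mset ` words n (n - 1). \<Sum>t\<in>tree_class c. weight w t)"
    unfolding partition_function_def sum_trees_group
  proof (intro arg_cong[of _ _ "\<lambda>x. real n * x"] sum.mono_neutral_left sub ballI sum.neutral)
    fix c t assume c: "c \<in> mset ` words n (n - 1) - mset ` degree_word ` trees n" and "t \<in> tree_class c"
    then have t: "c = mset (degree_word t)" by (simp add: tree_class_def)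
    then have "t \<in> trees n" using size(1)[of c] c by (simp add: trees_eq)
    then show "weight w t = 0" using c t by auto
  qed simp
  also have "\<dots> = (\<Sum>c\<in>mset ` words n (n - 1). num_words c * prod_mset (image_mset w c))"
    unfolding sum_distrib_left
  proof (intro sum.cong refl)
    fix c assume c: "c \<in> mset ` words n (n - 1)"
    have "(\<Sum>t\<in>tree_class c. real n * weight w t)
        = (\<Sum>t\<in>tree_class c. real n * prod_mset (image_mset w c))"
      by (intro sum.cong refl) (simp add: weight_tree_class)
    then show "(\<Sum>t\<in>tree_class c. real n * weight w t) = num_words c * prod_mset (image_mset w c)"
      using cycle_lemma_trees[OF size(2)[OF c]] size(1)[OF c] by (simp add: mult_ac)
  qed
  also have "\<dots> = (\<Sum>c\<in>mset ` words n (n - 1). \<Sum>xs\<in>{xs \<in> words n (n - 1). mset xs = c}. prod_list (map w xs))"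
  proof (intro sum.cong refl)
    fix c assume c: "c \<in> mset ` words n (n - 1)"
    have "(\<Sum>xs\<in>permutations_of_multiset c. prod_list (map w xs))
        = (\<Sum>xs\<in>permutations_of_multiset c. prod_mset (image_mset w c))"
      by (intro sum.cong refl) (auto simp: permutations_of_multiset_def prod_mset_prod_list simp flip: mset_map)
    then show "num_words c * prod_mset (image_mset w c)
        = (\<Sum>xs\<in>{xs \<in> words n (n - 1). mset xs = c}. prod_list (map w xs))"
      unfolding word_class[OF c, symmetric] by simp
  qed
  also have "\<dots> = (\<Sum>xs\<in>words n (n - 1). prod_list (map w xs))"
    by (rule sum.group) auto
  finally show ?thesis by (simp add: fps_power_nth_words)
qed

section \<open>Comparison of coefficients and the generating function of trees\<close>

lemma fps_power_nth_nonneg: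
  fixes w :: "nat \<Rightarrow> real"
  assumes "\<And>k. w k \<ge> 0"
  shows "fps_nth (Abs_fps w ^ n) s \<ge> 0"
  unfolding fps_power_nth_words by (intro sum_nonneg prod_list_nonneg) (use assms in auto)

text \<open>One term of the Cauchy product. On the diagonal, it makes the coefficients of index j in
  the j-th power supermultiplicative.\<close>

lemma fps_power_nth_supermult:
  fixes w :: "nat \<Rightarrow> real"
  assumes "\<And>k. w k \<ge> 0"
  shows "fps_nth (Abs_fps w ^ i) s * fps_nth (Abs_fps w ^ j) t \<le> fps_nth (Abs_fps w ^ (i + j)) (s + t)"
proof -
  let ?f = "\<lambda>l. fps_nth (Abs_fps w ^ i) l * fps_nth (Abs_fps w ^ j) (s + t - l)"
  have "?f s \<le> (\<Sum>l=0..s + t. ?f l)"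
    by (rule member_le_sum) (auto intro!: mult_nonneg_nonneg fps_power_nth_nonneg assms)
  then show ?thesis by (simp add: power_add fps_mult_nth)
qed

lemma partition_function_nonneg:
  assumes "\<And>k. w k \<ge> 0"
  shows "partition_function w n \<ge> 0"
  unfolding partition_function_def weight_eq
  by (intro sum_nonneg prod_list_nonneg) (use assms in auto)

lemma sum_lists_prod:
  fixes u :: "'a \<Rightarrow> real"
  assumes "finite A"
  shows "(\<Sum>ts\<in>{ts. set ts \<subseteq> A \<and> length ts = k}. prod_list (map u ts)) = sum u A ^ k"
proof (induction k)
  case 0
  have "{ts. set ts \<subseteq> A \<and> length ts = 0} = {[]}" by auto
  then show ?case by simp
next
  case (Suc k)
  let ?S = "{ts. set ts \<subseteq> A \<and> length ts = k}"
  have "(\<Sum>ts\<in>{ts. set ts \<subseteq> A \<and> length ts = Suc k}. prod_list (map u ts))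
      = (\<Sum>(ts, t)\<in>?S \<times> A. u t * prod_list (map u ts))"
    unfolding lists_length_Suc_eq by (subst sum.reindex) (auto simp: inj_on_def intro!: sum.cong)
  also have "\<dots> = (\<Sum>ts\<in>?S. \<Sum>t\<in>A. u t * prod_list (map u ts))"
    by (subst sum.cartesian_product) simp
  also have "\<dots> = (\<Sum>ts\<in>?S. sum u A * prod_list (map u ts))"
    by (simp add: sum_distrib_right)
  also have "\<dots> = sum u A ^ Suc k" by (simp add: Suc.IH flip: sum_distrib_left)
  finally show ?case .
qed

lemma degree_word_length_le_concat:
  assumes "\<And>t. t \<in> set ts \<Longrightarrow> length (degree_word t) \<le> N"
  shows "length (concat (map degree_word ts)) \<le> length ts * N"
  using assms by (induction ts) force+

text \<open>The generating function \<open>y\<close> of all trees satisfies \<open>y = \<Phi>(y)\<close>; only this inequality is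
  needed.\<close>

lemma Phi_tree_series_le:
  fixes v :: "nat \<Rightarrow> real"
  assumes v: "\<And>k. v k \<ge> 0" and summable: "summable (partition_function v)"
  defines "y \<equiv> suminf (partition_function v)"
  shows "(\<Sum>k<K. v k * y ^ k) \<le> y"
proof -
  define A where "A = (\<lambda>N. {t. length (degree_word t) < N})"
  have A_UN: "A N = (\<Union>n<N. trees n)" for N by (auto simp: A_def trees_eq)
  have fin: "finite (A N)" for N by (simp add: A_UN finite_trees)
  have sumA: "(\<Sum>t\<in>A N. weight v t) = (\<Sum>n<N. partition_function v n)" for N
    unfolding A_UN partition_function_def
    by (rule sum.UNION_disjoint) (auto simp: finite_trees, auto simp: trees_eq)
  have le_y: "(\<Sum>t\<in>A N. weight v t) \<le> y" for N
    unfolding sumA y_def by (intro sum_le_suminf summable partition_function_nonneg v) auto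
  \<comment> \<open>Truncation keeps all sums finite: joining fewer than K trees with fewer than N
    vertices each under a new root gives distinct trees of bounded size. N tends to infinity
    afterwards.\<close>
  have "(\<Sum>k<K. v k * (\<Sum>n<N. partition_function v n) ^ k) \<le> y" for N
  proof -
    let ?L = "\<lambda>k. {ts. set ts \<subseteq> A N \<and> length ts = k}"
    have finL: "finite (?L k)" for k by (rule finite_lists_length_eq[OF fin])
    have "(\<Sum>k<K. v k * (\<Sum>n<N. partition_function v n) ^ k)
        = (\<Sum>k<K. \<Sum>ts\<in>?L k. v k * prod_list (map (weight v) ts))"
      by (simp add: sum_lists_prod[OF fin] sumA flip: sum_distrib_left)
    also have "\<dots> = (\<Sum>k<K. \<Sum>ts\<in>?L k. weight v (Node ts))"
    proof (intro sum.cong refl)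
      fix k ts assume "ts \<in> ?L k"
      moreover have "prod_list (map (weight v) us) = prod_list (map v (concat (map degree_word us)))" for us
        by (induction us) (auto simp: weight_eq)
      ultimately show "v k * prod_list (map (weight v) ts) = weight v (Node ts)"
        by (simp add: weight_eq)
    qed
    also have "\<dots> = (\<Sum>k<K. \<Sum>t\<in>Node ` ?L k. weight v t)"
      by (simp add: sum.reindex inj_on_def)
    also have "\<dots> = (\<Sum>t\<in>(\<Union>k<K. Node ` ?L k). weight v t)"
      by (rule sum.UNION_disjoint[symmetric]) (use finL in auto)
    also have "\<dots> \<le> (\<Sum>t\<in>A (Suc (Suc (K * N))). weight v t)"
    proof (rule sum_mono2)
      show "(\<Union>k<K. Node ` ?L k) \<subseteq> A (Suc (Suc (K * N)))"
      proof safe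
        fix ts assume k: "length ts < K" and ts: "set ts \<subseteq> A N"
        have "length (concat (map degree_word ts)) \<le> length ts * N"
          using ts by (intro degree_word_length_le_concat) (auto simp: A_def)
        also have "\<dots> \<le> K * N" using k by (intro mult_right_mono) auto
        finally show "Node ts \<in> A (Suc (Suc (K * N)))" by (simp add: A_def)
      qed
      show "0 \<le> weight v t" for t unfolding weight_eq
        by (intro prod_list_nonneg) (use v in auto)
    qed (rule fin)
    also have "\<dots> \<le> y" by (rule le_y)
    finally show ?thesis .
  qed
  moreover have "(\<lambda>N. \<Sum>k<K. v k * (\<Sum>n<N. partition_function v n) ^ k) \<longlonglongrightarrow> (\<Sum>k<K. v k * y ^ k)"
    unfolding y_def by (intro tendsto_intros summable_LIMSEQ summable)
  ultimately show ?thesis by (intro LIMSEQ_le_const2) auto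
qed

section \<open>The number of vertices with exactly one child\<close>

lemma partition_function_scale:
  "partition_function (\<lambda>k. w k * z) n = partition_function w n * z ^ n" for z :: real
proof -
  have "weight (\<lambda>k. w k * z) t = weight w t * z ^ n" if "t \<in> trees n" for t
  proof -
    have "prod_list (map (\<lambda>k. w k * z) xs) = prod_list (map w xs) * z ^ length xs" for xs
      by (induction xs) auto
    then show ?thesis using that by (simp add: weight_eq trees_eq)
  qed
  then show ?thesis by (simp add: partition_function_def sum_distrib_right)
qed

text \<open>The hypothesis \<open>opt\<close> says that the tilted law gives mass at most \<open>1 - \<epsilon>\<close> to 1 for every
  admissible tilt. The exponential growth rate of the coefficients on the right is the infimum of
  \<open>\<Phi>(y) / y\<close>: otherwise the tree series would converge at some point \<open>z\<close> with
  \<open>1 / z < inf \<Phi>(y) / y\<close>, whereas its value \<open>y\<close> there satisfies \<open>z \<Phi>(y) \<le> y\<close>.\<close>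

lemma power_weight_1_le:
  fixes w :: "nat \<Rightarrow> real" and \<epsilon> :: real
  assumes w: "\<And>k. w k \<ge> 0" and w0: "w 0 > 0" and k: "k \<ge> 2" "w k > 0" and \<epsilon>: "0 < \<epsilon>" "\<epsilon> < 1"
    and opt: "\<And>y. y > 0 \<Longrightarrow> summable (\<lambda>k. w k * y ^ k) \<Longrightarrow> w 1 * y \<le> (1 - \<epsilon>) * (\<Sum>k. w k * y ^ k)"
  shows "\<exists>C>0. \<forall>j. w 1 ^ j \<le> C * (1 - \<epsilon> / 2) ^ j * fps_nth (Abs_fps w ^ j) j"
proof (cases "w 1 = 0")
  case True
  have "w 1 ^ j \<le> 1 * (1 - \<epsilon> / 2) ^ j * fps_nth (Abs_fps w ^ j) j" for j
    using True \<epsilon> fps_power_nth_nonneg[of w j j] w by (cases j) auto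
  then show ?thesis by (intro exI[of _ 1]) auto
next
  case False
  then have w1: "w 1 > 0" using w[of 1] by simp
  define a where "a = (\<lambda>j. fps_nth (Abs_fps w ^ j) j)"
  define b where "b = w 1 / (1 - \<epsilon> / 2)"
  define b1 where "b1 = w 1 / (1 - \<epsilon>)"
  \<comment> \<open>Strictly between the two: b < b2 makes the tree series converge at 1 / b2, and
    b2 < b1 is what \<open>opt\<close> contradicts there.\<close>
  define b2 where "b2 = (b + b1) / 2"
  have b: "b > 0" using w1 \<epsilon> by (simp add: b_def)
  have "b < b1" using w1 \<epsilon> unfolding b_def b1_def by (intro divide_strict_left_mono) auto
  then have b2: "b < b2" "b2 < b1" by (auto simp: b2_def)
  have a_mult: "a i * a j \<le> a (i + j)" for i j
    unfolding a_def by (rule fps_power_nth_supermult) (rule w)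
  have a0: "a j \<ge> 0" for j unfolding a_def by (rule fps_power_nth_nonneg) (rule w)
  have a_pow: "a i ^ q \<le> a (i * q)" for i q
  proof (induction q)
    case (Suc q)
    have "a i ^ Suc q \<le> a i * a (i * q)" using Suc a0 by (simp add: mult_left_mono)
    also have "\<dots> \<le> a (i * Suc q)" using a_mult[of i "i * q"] by simp
    finally show ?case .
  qed (simp add: a_def)
  have "\<exists>J\<ge>1. b ^ J \<le> a J"
  proof (rule ccontr)
    assume "\<not> ?thesis"
    then have small: "a j < b ^ j" if "j \<ge> 1" for j using that by force
    \<comment> \<open>One factor of index k and k - 2 factors of index 0 form a multiplier that
      lifts the coefficient n - 1 of the n-th power to a diagonal one.\<close>
    define c where "c = w k * w 0 ^ (k - 2)"
    have c: "c > 0" using w0 k by (simp add: c_def)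
    have c_le: "c \<le> fps_nth (Abs_fps w ^ (k - 1)) k"
    proof -
      have "fps_nth (Abs_fps w ^ 1) k * fps_nth (Abs_fps w ^ (k - 2)) 0
          \<le> fps_nth (Abs_fps w ^ (1 + (k - 2))) (k + 0)"
        by (rule fps_power_nth_supermult) (rule w)
      moreover have eq: "1 + (k - 2) = k - 1" using k by simp
      ultimately show ?thesis unfolding eq by (simp add: c_def fps_nth_power_0)
    qed
    have Z_le: "partition_function w n \<le> b ^ (k - 1) / c * b ^ n" for n
    proof (cases "n = 0")
      case True
      have "trees 0 = {}" by (auto simp: trees_eq) (metis length_0_conv degree_word.simps ptree.exhaust list.distinct(1))
      then show ?thesis using True b c by (simp add: partition_function_def)
    next
      case False
      have "partition_function w n * c \<le> (real n * partition_function w n) * c"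
        using False partition_function_nonneg[of w n] w c by (intro mult_right_mono) (auto simp: mult_le_cancel_right1)
      also have "\<dots> \<le> fps_nth (Abs_fps w ^ n) (n - 1) * fps_nth (Abs_fps w ^ (k - 1)) k"
        using False c_le fps_power_nth_nonneg[of w n "n - 1"] w
        by (subst partition_function_eq_fps) (auto intro!: mult_left_mono)
      also have "\<dots> \<le> fps_nth (Abs_fps w ^ (n + (k - 1))) (n - 1 + k)"
        by (rule fps_power_nth_supermult) (rule w)
      also have "n - 1 + k = n + (k - 1)" using False k by simp
      also have "fps_nth (Abs_fps w ^ (n + (k - 1))) (n + (k - 1)) \<le> b ^ (n + (k - 1))"
        using small[of "n + (k - 1)"] False by (simp add: a_def)
      finally show ?thesis using c by (simp add: field_simps power_add)
    qed
    define z where "z = 1 / b2"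
    define v where "v = (\<lambda>k. w k * z)"
    have z: "z > 0" using b b2 by (simp add: z_def)
    have v: "v k \<ge> 0" for k using w z by (simp add: v_def)
    have bz: "b * z < 1" using b b2 by (simp add: z_def)
    have Zv: "partition_function v n = partition_function w n * z ^ n" for n
      unfolding v_def by (rule partition_function_scale)
    have summ: "summable (partition_function v)"
    proof (rule summable_comparison_test')
      show "summable (\<lambda>n. b ^ (k - 1) / c * (b * z) ^ n)"
        using bz b z by (intro summable_mult summable_geometric) auto
      show "norm (partition_function v n) \<le> b ^ (k - 1) / c * (b * z) ^ n" if "n \<ge> 0" for n
        using partition_function_nonneg[of v n] v mult_right_mono[OF Z_le[of n], of "z ^ n"] z
        by (simp add: Zv power_mult_distrib mult_ac)
    qed
    define y where "y = suminf (partition_function v)"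
    have "partition_function v 1 = v 0"
      using partition_function_eq_fps[of 1 v] by simp
    also have "\<dots> > 0" using w0 z by (simp add: v_def)
    finally have y: "y > 0" unfolding y_def
      using v by (intro suminf_pos2[OF summ, of 1] partition_function_nonneg) auto
    \<comment> \<open>Convergence of the weight series at y is not known beforehand; the bounded
      partial sums make y an admissible tilt.\<close>
    have partial: "(\<Sum>k<K. w k * y ^ k) \<le> y / z" for K
    proof -
      have "(\<Sum>k<K. v k * y ^ k) \<le> y" unfolding y_def by (rule Phi_tree_series_le[OF v summ])
      moreover have "(\<Sum>k<K. v k * y ^ k) = (\<Sum>k<K. w k * y ^ k) * z"
        by (simp add: v_def sum_distrib_left sum_distrib_right mult_ac)
      ultimately show ?thesis using z by (simp add: field_simps)
    qed
    have summ_w: "summable (\<lambda>k. w k * y ^ k)"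
      using partial w y by (intro summableI_nonneg_bounded[where x = "y / z"]) auto
    have "(\<Sum>k. w k * y ^ k) \<le> y / z" using partial by (intro suminf_le_const summ_w)
    then have "w 1 * y \<le> (1 - \<epsilon>) * (y / z)"
      using opt[OF y summ_w] \<epsilon> mult_left_mono[of _ "y / z" "1 - \<epsilon>"] by (meson diff_ge_0_iff_ge less_imp_le order_trans)
    then have "w 1 * y \<le> ((1 - \<epsilon>) * b2) * y" by (simp add: z_def mult_ac)
    then have "w 1 \<le> (1 - \<epsilon>) * b2" using y by (subst (asm) mult_le_cancel_right_pos)
    then have "b1 \<le> b2" using \<epsilon> by (simp add: b1_def field_simps)
    then show False using b2 by simp
  qed
  then obtain J where J: "J \<ge> 1" "b ^ J \<le> a J" by blast
  have q: "0 < 1 - \<epsilon> / 2" "1 - \<epsilon> / 2 \<le> 1" using \<epsilon> by auto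
  have w1b: "w 1 = b * (1 - \<epsilon> / 2)" using q by (simp add: b_def)
  have "w 1 ^ j \<le> 1 / (1 - \<epsilon> / 2) ^ J * (1 - \<epsilon> / 2) ^ j * a j" for j
  proof -
    \<comment> \<open>The inequality at J controls multiples of J only. The remainder r < J is
      covered by \<open>w 1 = a 1\<close> and costs a constant that depends on J, hence on
      w.\<close>
    define r where "r = j mod J"
    define d where "d = j div J"
    have j: "j = J * d + r" by (simp add: r_def d_def)
    have "b ^ j * (1 - \<epsilon> / 2) ^ J \<le> b ^ j * (1 - \<epsilon> / 2) ^ r"
      using J(1) b q by (intro mult_left_mono power_decreasing) (auto simp: r_def less_imp_le)
    also have "\<dots> = (b ^ J) ^ d * w 1 ^ r"
    proof -
      have "w 1 ^ r = b ^ r * (1 - \<epsilon> / 2) ^ r" by (simp only: w1b power_mult_distrib)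
      moreover have "b ^ j = (b ^ J) ^ d * b ^ r" by (simp add: j power_add power_mult)
      ultimately show ?thesis by simp
    qed
    also have "\<dots> \<le> a J ^ d * w 1 ^ r"
      using J(2) b w1 by (intro mult_right_mono power_mono) auto
    also have "\<dots> \<le> a (J * d) * a r"
    proof (intro mult_mono a_pow a0)
      show "w 1 ^ r \<le> a r" using a_pow[of 1 r] by (simp add: a_def)
    qed (use w1 in auto)
    also have "\<dots> \<le> a j" using a_mult[of "J * d" r] by (simp add: j)
    finally have "b ^ j * (1 - \<epsilon> / 2) ^ j * (1 - \<epsilon> / 2) ^ J \<le> a j * (1 - \<epsilon> / 2) ^ j"
      using mult_right_mono[of _ _ "(1 - \<epsilon> / 2) ^ j"] q by (simp add: mult_ac)
    then have "w 1 ^ j * (1 - \<epsilon> / 2) ^ J \<le> a j * (1 - \<epsilon> / 2) ^ j"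
      by (simp only: w1b power_mult_distrib)
    moreover have "x \<le> 1 / c * d * e" if "x * c \<le> e * d" "c > 0" for x c d e :: real
      using that by (simp add: field_simps)
    ultimately show ?thesis using q by simp
  qed
  then show ?thesis using q unfolding a_def by (intro exI[of _ "1 / (1 - \<epsilon> / 2) ^ J"]) auto
qed

text \<open>Chernoff bound: tilting \<open>w 1\<close> by \<open>exp \<theta>\<close> and expanding binomially in the surplus leads to
  the moment generating function of a binomial variable with parameter \<open>1 - \<epsilon> / 2\<close>.\<close>

lemma sum_weight_many_ones_le:
  fixes w :: "nat \<Rightarrow> real" and \<epsilon> :: real
  assumes w: "\<And>k. w k \<ge> 0" and \<epsilon>: "0 < \<epsilon>" "\<epsilon> < 1" and n: "n \<ge> 1"
    and C: "\<And>j. w 1 ^ j \<le> C * (1 - \<epsilon> / 2) ^ j * fps_nth (Abs_fps w ^ j) j"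
  shows "(\<Sum>t\<in>{t \<in> trees n. (1 - \<epsilon> / 4) * n \<le> count (mset (degree_word t)) 1}. weight w t)
    \<le> C * exp (- (\<epsilon>\<^sup>2 / 64) * n) * partition_function w n" (is "sum _ ?S \<le> _")
proof -
  \<comment> \<open>Maximises the gain \<theta> \<epsilon> / 4 - \<theta>^2, whose value is then
    \<epsilon>^2 / 64.\<close>
  define \<theta> where "\<theta> = \<epsilon> / 8"
  define s where "s = (exp \<theta> - 1) * w 1"
  define v where "v = (\<lambda>k. if k = 1 then exp \<theta> * w 1 else w k)"
  let ?\<Phi> = "Abs_fps w"
  have \<theta>: "0 < \<theta>" "\<theta> < 1" using \<epsilon> by (auto simp: \<theta>_def)
  have s: "s \<ge> 0" using \<theta> w[of 1] by (simp add: s_def)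
  have C0: "C \<ge> 0" using C[of 0] by simp
  have weight_v: "weight v t = exp (\<theta> * count (mset (degree_word t)) 1) * weight w t" for t
  proof -
    have "prod_list (map v xs) = exp (\<theta> * count (mset xs) 1) * prod_list (map w xs)" for xs
      by (induction xs) (auto simp: v_def algebra_simps exp_add)
    then show ?thesis by (simp add: weight_eq)
  qed
  have weight0: "weight w t \<ge> 0" for t
    unfolding weight_eq by (intro prod_list_nonneg) (use w in auto)
  have "exp (\<theta> * ((1 - \<epsilon> / 4) * n)) * sum (weight w) ?S = (\<Sum>t\<in>?S. exp (\<theta> * ((1 - \<epsilon> / 4) * n)) * weight w t)"
    by (simp add: sum_distrib_left)
  also have "\<dots> \<le> (\<Sum>t\<in>?S. weight v t)"
    unfolding weight_v using \<theta> weight0 by (intro sum_mono mult_right_mono) auto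
  also have "\<dots> \<le> partition_function v n"
    unfolding partition_function_def
    by (intro sum_mono2) (auto simp: finite_trees weight_v weight0)
  finally have markov: "exp (\<theta> * ((1 - \<epsilon> / 4) * n)) * sum (weight w) ?S \<le> partition_function v n" .
  have \<Phi>v: "Abs_fps v = fps_const s * fps_X + ?\<Phi>"
    by (rule fps_ext) (auto simp: v_def s_def algebra_simps fps_mult_fps_X_commute simp flip: fps_mult_fps_X_commute)
  have "fps_nth (Abs_fps v ^ n) (n - 1)
      = (\<Sum>j\<le>n. real (n choose j) * (s ^ j * fps_nth (fps_X ^ j * ?\<Phi> ^ (n - j)) (n - 1)))"
    unfolding \<Phi>v binomial_ring
    by (simp add: fps_sum_nth power_mult_distrib fps_const_power mult.assoc fps_of_nat[symmetric])
  also have "\<dots> \<le> (\<Sum>j\<le>n. real (n choose j) * (C * ((exp \<theta> - 1) * (1 - \<epsilon> / 2)) ^ j * fps_nth (?\<Phi> ^ n) (n - 1)))"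
  proof (intro sum_mono mult_left_mono)
    fix j assume "j \<in> {..n}"
    then have jn: "j \<le> n" by simp
    show "s ^ j * fps_nth (fps_X ^ j * ?\<Phi> ^ (n - j)) (n - 1)
        \<le> C * ((exp \<theta> - 1) * (1 - \<epsilon> / 2)) ^ j * fps_nth (?\<Phi> ^ n) (n - 1)"
    proof (cases "j < n")
      case True
      have "s ^ j * fps_nth (fps_X ^ j * ?\<Phi> ^ (n - j)) (n - 1)
          = (exp \<theta> - 1) ^ j * (w 1 ^ j * fps_nth (?\<Phi> ^ (n - j)) (n - 1 - j))"
        using True by (simp add: fps_X_power_mult_nth s_def power_mult_distrib)
      also have "\<dots> \<le> (exp \<theta> - 1) ^ j * ((C * (1 - \<epsilon> / 2) ^ j * fps_nth (?\<Phi> ^ j) j) * fps_nth (?\<Phi> ^ (n - j)) (n - 1 - j))"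
        using \<theta> w by (intro mult_left_mono mult_right_mono C fps_power_nth_nonneg) auto
      also have "\<dots> = (exp \<theta> - 1) ^ j * (C * (1 - \<epsilon> / 2) ^ j) * (fps_nth (?\<Phi> ^ j) j * fps_nth (?\<Phi> ^ (n - j)) (n - 1 - j))"
        by simp
      \<comment> \<open>Supermultiplicativity joins the powers j and n - j again, so that the
        coefficient no longer depends on j.\<close>
      also have "\<dots> \<le> (exp \<theta> - 1) ^ j * (C * (1 - \<epsilon> / 2) ^ j) * fps_nth (?\<Phi> ^ (j + (n - j))) (j + (n - 1 - j))"
        using \<theta> C0 \<epsilon> w by (intro mult_left_mono fps_power_nth_supermult) auto
      also have "\<dots> = C * ((exp \<theta> - 1) * (1 - \<epsilon> / 2)) ^ j * fps_nth (?\<Phi> ^ n) (n - 1)"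
        using True by (simp add: power_mult_distrib)
      finally show ?thesis .
    next
      case False
      then have "fps_nth (fps_X ^ j * ?\<Phi> ^ (n - j)) (n - 1) = 0"
        using n jn by (simp add: fps_X_power_mult_nth)
      then show ?thesis using C0 \<theta> \<epsilon> fps_power_nth_nonneg[of w n "n - 1"] w by simp
    qed
  qed simp
  also have "\<dots> = (\<Sum>j\<le>n. real (n choose j) * ((exp \<theta> - 1) * (1 - \<epsilon> / 2)) ^ j * 1 ^ (n - j)) * (C * fps_nth (?\<Phi> ^ n) (n - 1))"
    by (simp add: sum_distrib_left sum_distrib_right mult_ac)
  also have "\<dots> = ((exp \<theta> - 1) * (1 - \<epsilon> / 2) + 1) ^ n * (C * fps_nth (?\<Phi> ^ n) (n - 1))"
    by (simp only: binomial_ring)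
  finally have "real n * partition_function v n
      \<le> ((exp \<theta> - 1) * (1 - \<epsilon> / 2) + 1) ^ n * (C * (real n * partition_function w n))"
    using n by (simp add: partition_function_eq_fps)
  then have Zv: "partition_function v n \<le> ((exp \<theta> - 1) * (1 - \<epsilon> / 2) + 1) ^ n * (C * partition_function w n)"
  proof -
    assume "real n * partition_function v n
      \<le> ((exp \<theta> - 1) * (1 - \<epsilon> / 2) + 1) ^ n * (C * (real n * partition_function w n))"
    then have "real n * partition_function v n
      \<le> real n * (((exp \<theta> - 1) * (1 - \<epsilon> / 2) + 1) ^ n * (C * partition_function w n))" by (simp add: mult_ac)
    then show ?thesis using n by (subst (asm) mult_le_cancel_left_pos) auto
  qed
  have "(exp \<theta> - 1) * (1 - \<epsilon> / 2) + 1 \<le> exp (\<theta> * (1 - \<epsilon> / 4) - \<epsilon>\<^sup>2 / 64)"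
  proof -
    have "exp \<theta> \<le> 1 + \<theta> + \<theta>\<^sup>2" using \<theta> by (intro exp_bound) auto
    then have "(exp \<theta> - 1) * (1 - \<epsilon> / 2) \<le> (\<theta> + \<theta>\<^sup>2) * (1 - \<epsilon> / 2)"
      using \<epsilon> by (intro mult_right_mono) auto
    also have "\<dots> \<le> \<theta> * (1 - \<epsilon> / 2) + \<theta>\<^sup>2"
      using \<epsilon> by (simp add: algebra_simps)
    also have "\<dots> = \<theta> * (1 - \<epsilon> / 4) - \<epsilon>\<^sup>2 / 64"
      by (simp add: \<theta>_def power2_eq_square field_simps)
    finally show ?thesis using exp_ge_add_one_self[of "\<theta> * (1 - \<epsilon> / 4) - \<epsilon>\<^sup>2 / 64"] by linarith
  qed
  then have "((exp \<theta> - 1) * (1 - \<epsilon> / 2) + 1) ^ n \<le> exp (\<theta> * (1 - \<epsilon> / 4) - \<epsilon>\<^sup>2 / 64) ^ n"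
    using \<theta> \<epsilon> by (intro power_mono) auto
  also have "\<dots> = exp (\<theta> * ((1 - \<epsilon> / 4) * n)) * exp (- (\<epsilon>\<^sup>2 / 64) * n)"
    by (simp add: algebra_simps flip: exp_of_nat_mult exp_add)
  finally have "partition_function v n
      \<le> (exp (\<theta> * ((1 - \<epsilon> / 4) * n)) * exp (- (\<epsilon>\<^sup>2 / 64) * n)) * (C * partition_function w n)"
    using Zv mult_right_mono[of _ _ "C * partition_function w n"] C0 partition_function_nonneg[of w n] w
    by (smt (verit) mult_nonneg_nonneg)
  then have "partition_function v n
      \<le> exp (\<theta> * ((1 - \<epsilon> / 4) * n)) * (C * exp (- (\<epsilon>\<^sup>2 / 64) * n) * partition_function w n)"
    by (simp only: mult_ac)
  from order_trans[OF markov this] show ?thesis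
    by (simp only: mult_le_cancel_left_pos exp_gt_zero)
qed

section \<open>The optimal tilt\<close>

context
  fixes w :: "nat \<Rightarrow> real"
  assumes w: "\<And>k. w k \<ge> 0" and w0: "w 0 > 0" and w2: "\<exists>k\<ge>2. w k > 0"
begin

section \<open>From extended nonnegative values to real power series\<close>

lemma Phi_ennreal:
  assumes "s \<ge> 0" and "summable (\<lambda>k. w k * s ^ k)"
  shows "Phi w (ennreal s) = ennreal (\<Sum>k. w k * s ^ k)"
proof -
  have "Phi w (ennreal s) = (\<Sum>k. ennreal (w k * s ^ k))"
    using assms(1) w by (simp add: Phi_def ennreal_power ennreal_mult)
  also have "\<dots> = ennreal (\<Sum>k. w k * s ^ k)"
    using assms w by (intro suminf_ennreal2) auto
  finally show ?thesis .
qed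

lemma Phi_finite_iff:
  assumes "s \<ge> 0"
  shows "Phi w (ennreal s) < \<infinity> \<longleftrightarrow> summable (\<lambda>k. w k * s ^ k)"
proof
  assume "Phi w (ennreal s) < \<infinity>"
  moreover have "Phi w (ennreal s) = (\<Sum>k. ennreal (w k * s ^ k))"
    using assms(1) w by (simp add: Phi_def ennreal_power ennreal_mult)
  ultimately show "summable (\<lambda>k. w k * s ^ k)"
    using assms w by (intro summable_suminf_not_top) auto
qed (simp add: Phi_ennreal assms)

lemma Psi_ratio_ennreal:
  assumes "s \<ge> 0" and "summable (\<lambda>k. w k * s ^ k)" and "summable (\<lambda>k. real k * w k * s ^ k)"
  shows "Psi_ratio w (ennreal s) = ennreal (\<Sum>k. real k * w k * s ^ k) / ennreal (\<Sum>k. w k * s ^ k)"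
proof -
  have "(\<Sum>k. of_nat k * ennreal (w k) * ennreal s ^ k) = (\<Sum>k. ennreal (real k * w k * s ^ k))"
    using assms(1) w by (simp add: ennreal_power ennreal_mult ennreal_of_nat_eq_real_of_nat)
  also have "\<dots> = ennreal (\<Sum>k. real k * w k * s ^ k)"
    using assms w by (intro suminf_ennreal2) auto
  finally show ?thesis by (simp add: Psi_ratio_def Phi_ennreal assms)
qed

lemma Phi_pos:
  assumes "s \<ge> 0" and "summable (\<lambda>k. w k * s ^ k)"
  shows "(\<Sum>k. w k * s ^ k) > 0"
  using assms w w0 by (intro suminf_pos2[of _ 0]) auto

text \<open>By Bernoulli's inequality, k is at most a constant times (s' / s)^k.\<close>

lemma summable_weighted:
  assumes "0 \<le> s" "s < s'" and "summable (\<lambda>k. w k * s' ^ k)"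
  shows "summable (\<lambda>k. real k * w k * s ^ k)"
proof (cases "s = 0")
  case True
  have "(\<lambda>k. real k * w k * s ^ k) = (\<lambda>k. 0)"
  proof
    fix k show "real k * w k * s ^ k = 0" using True by (cases k) auto
  qed
  then show ?thesis by simp
next
  case False
  define d where "d = s' / s - 1"
  have d: "d > 0" using False assms by (simp add: d_def)
  show ?thesis
  proof (rule summable_comparison_test')
    show "summable (\<lambda>k. 1 / d * (w k * s' ^ k))" using assms(3) by (rule summable_mult)
    fix k :: nat
    have "1 + real k * d \<le> (1 + d) ^ k" using d by (intro Bernoulli_inequality) auto
    then have "real k * d \<le> (s' / s) ^ k" by (simp add: d_def)
    then have "real k * d * (w k * s ^ k) \<le> (s' / s) ^ k * (w k * s ^ k)"
      using w assms by (intro mult_right_mono) auto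
    also have "\<dots> = w k * s' ^ k" using False by (simp add: power_divide)
    finally show "norm (real k * w k * s ^ k) \<le> 1 / d * (w k * s' ^ k)"
      using d w[of k] assms(1) by (simp add: field_simps)
  qed
qed

lemma summable_smaller:
  assumes "0 \<le> s" "s \<le> s'" and "summable (\<lambda>k. w k * s' ^ k)"
  shows "summable (\<lambda>k. w k * s ^ k)"
  using assms(3) by (rule summable_comparison_test') (use assms w in \<open>auto intro!: mult_left_mono power_mono\<close>)

lemma less_rhoE:
  assumes "s \<ge> 0" "ennreal s < rho w"
  obtains s' where "s < s'" "summable (\<lambda>k. w k * s' ^ k)"
proof -
  obtain u where u: "u < \<infinity>" "Phi w u < \<infinity>" "ennreal s < u"
    using assms(2) unfolding rho_def less_Sup_iff by auto
  then obtain s' where s': "u = ennreal s'" "s' \<ge> 0" by (cases u) auto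
  then show ?thesis using u that[of s'] Phi_finite_iff[of s'] assms(1) by (simp add: ennreal_less_iff)
qed

lemma le_rho:
  assumes "s \<ge> 0" "summable (\<lambda>k. w k * s ^ k)"
  shows "ennreal s \<le> rho w"
  unfolding rho_def by (intro Sup_upper) (use assms Phi_finite_iff[of s] in auto)

text \<open>Convexity of \<open>\<Phi>\<close>: its graph lies above the tangent at \<open>s\<close>, which passes through the origin
  if \<open>s \<Phi>'(s) = \<Phi>(s)\<close>.\<close>

lemma Phi_tangent:
  assumes s: "s > 0" "summable (\<lambda>k. w k * s ^ k)" "summable (\<lambda>k. real k * w k * s ^ k)"
    and y: "y > 0" "summable (\<lambda>k. w k * y ^ k)"
    and crit: "(\<Sum>k. real k * w k * s ^ k) = (\<Sum>k. w k * s ^ k)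
      \<or> y \<le> s \<and> (\<Sum>k. real k * w k * s ^ k) \<le> (\<Sum>k. w k * s ^ k)"
  shows "y * (\<Sum>k. w k * s ^ k) \<le> s * (\<Sum>k. w k * y ^ k)"
proof -
  let ?\<Phi> = "\<Sum>k. w k * s ^ k" and ?A = "\<Sum>k. real k * w k * s ^ k"
  have "?\<Phi> + (y / s - 1) * ?A = (\<Sum>k. w k * s ^ k + (y / s - 1) * (real k * w k * s ^ k))"
    by (simp only: suminf_mult[OF s(3), symmetric] suminf_add[OF s(2) summable_mult[OF s(3)]])
  also have "\<dots> \<le> (\<Sum>k. w k * y ^ k)"
  proof (rule suminf_le)
    fix k
    have "1 + real k * (y / s - 1) \<le> (1 + (y / s - 1)) ^ k"
      using s(1) y(1) by (intro Bernoulli_inequality) auto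
    then have "w k * s ^ k * (1 + real k * (y / s - 1)) \<le> w k * s ^ k * (y / s) ^ k"
      using w s by (intro mult_left_mono) auto
    also have "\<dots> = w k * y ^ k" using s(1) by (simp add: power_divide)
    finally show "w k * s ^ k + (y / s - 1) * (real k * w k * s ^ k) \<le> w k * y ^ k"
      by (simp add: algebra_simps)
  qed (use s y in \<open>auto intro!: summable_add summable_mult\<close>)
  finally have le: "?\<Phi> + (y / s - 1) * ?A \<le> (\<Sum>k. w k * y ^ k)" .
  \<comment> \<open>In the second alternative of \<open>crit\<close> both y / s - 1 and A - \<Phi>
    are nonpositive: to the left of s, too small a slope only helps.\<close>
  have "(y / s - 1) * ?\<Phi> \<le> (y / s - 1) * ?A"
  proof (cases "?A = ?\<Phi>")
    case False
    then have "y / s - 1 \<le> 0" "?A \<le> ?\<Phi>" using crit s(1) by auto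
    then show ?thesis by (rule mult_left_mono_neg[rotated])
  qed simp
  with le have "y / s * ?\<Phi> \<le> (\<Sum>k. w k * y ^ k)" by (simp add: algebra_simps)
  then show ?thesis using s(1) by (simp add: field_simps)
qed

text \<open>The ratio is the mean of the tilted law. With m the mean at s and \<theta> = s' / s, the
  numbers k - m and \<theta>^k - \<theta>^m have the same sign, so the sum of (k - m) w_k s'^k
  exceeds \<theta>^m times the same sum at s, which is 0. The term k = 0 makes it strict.\<close>

lemma Psi_ratio_less:
  assumes s: "0 < s" "s < s'" "summable (\<lambda>k. w k * s' ^ k)" "summable (\<lambda>k. real k * w k * s' ^ k)"
  shows "(\<Sum>k. real k * w k * s ^ k) / (\<Sum>k. w k * s ^ k)
    < (\<Sum>k. real k * w k * s' ^ k) / (\<Sum>k. w k * s' ^ k)"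
proof -
  let ?\<Phi> = "\<lambda>s. \<Sum>k. w k * s ^ k" and ?A = "\<lambda>s. \<Sum>k. real k * w k * s ^ k"
  have sm: "summable (\<lambda>k. w k * s ^ k)" "summable (\<lambda>k. real k * w k * s ^ k)"
    using summable_smaller[of s s'] summable_weighted[of s s'] s by auto
  define m where "m = ?A s / ?\<Phi> s"
  define \<theta> where "\<theta> = s' / s"
  have \<Phi>: "?\<Phi> s > 0" "?\<Phi> s' > 0" using Phi_pos sm s by auto
  have \<theta>: "\<theta> > 1" using s by (simp add: \<theta>_def)
  obtain k2 where k2: "k2 \<ge> 2" "w k2 > 0" using w2 by auto
  have m: "m > 0" unfolding m_def
  proof (intro divide_pos_pos \<Phi>)
    show "?A s > 0" using k2 s w by (intro suminf_pos2[OF sm(2), of k2]) auto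
  qed
  let ?f = "\<lambda>k. (real k - m) * w k * s ^ k"
  have f_eq: "(real k - m) * w k * x ^ k = real k * w k * x ^ k - m * (w k * x ^ k)" for k x
    by (simp add: algebra_simps)
  have sumf: "summable ?f" "suminf ?f = ?A s - m * ?\<Phi> s"
    unfolding f_eq by (intro summable_diff summable_mult sm)
      (simp only: suminf_diff[OF sm(2) summable_mult[OF sm(1)], symmetric] suminf_mult[OF sm(1)])
  have zero: "suminf ?f = 0" unfolding sumf(2) using \<Phi> by (simp add: m_def)
  let ?g = "\<lambda>k. (real k - m) * w k * s' ^ k"
  have sumg: "summable ?g" "suminf ?g = ?A s' - m * ?\<Phi> s'"
    unfolding f_eq by (intro summable_diff summable_mult s)
      (simp only: suminf_diff[OF s(4) summable_mult[OF s(3)], symmetric] suminf_mult[OF s(3)])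
  have ge: "?g k \<ge> ?f k * \<theta> powr m" for k
  proof -
    have cross: "(real k - m) * (\<theta> ^ k - \<theta> powr m) \<ge> 0"
    proof (cases "real k \<ge> m")
      case True
      then have "\<theta> powr m \<le> \<theta> powr real k" using \<theta> by (intro powr_mono) auto
      then show ?thesis using True \<theta> by (simp add: powr_realpow)
    next
      case False
      then have "\<theta> powr real k \<le> \<theta> powr m" using \<theta> by (intro powr_mono) auto
      then show ?thesis using False \<theta> by (simp add: powr_realpow mult_nonpos_nonpos)
    qed
    have "0 \<le> w k * s ^ k * ((real k - m) * (\<theta> ^ k - \<theta> powr m))"
      using w s by (intro mult_nonneg_nonneg[OF mult_nonneg_nonneg cross]) auto
    also have "\<dots> = (real k - m) * w k * (s ^ k * \<theta> ^ k) - ?f k * \<theta> powr m" by (simp add: algebra_simps)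
    also have "s ^ k * \<theta> ^ k = s' ^ k" using s by (simp add: \<theta>_def power_divide)
    finally show ?thesis by simp
  qed
  have "0 < (\<Sum>k. ?g k - ?f k * \<theta> powr m)"
  proof (rule suminf_pos2)
    show "summable (\<lambda>k. ?g k - ?f k * \<theta> powr m)"
      by (intro summable_diff sumg summable_mult2 sumf)
    have "\<theta> powr m > 1" using \<theta> m by (simp add: gr_one_powr)
    then have "m * w 0 < m * w 0 * \<theta> powr m" using m w0 by simp
    then show "0 < ?g 0 - ?f 0 * \<theta> powr m" by simp
  qed (use ge in auto)
  also have "\<dots> = suminf ?g - suminf ?f * \<theta> powr m"
    using sumf(1) sumg(1) by (simp add: suminf_diff[symmetric] suminf_mult2 summable_mult2)
  also have "\<dots> = ?A s' - m * ?\<Phi> s'" by (simp add: zero sumg(2))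
  finally show ?thesis using \<Phi> by (simp add: m_def pos_less_divide_eq)
qed

lemma Psi_ratio_mono:
  assumes "u < v" "v < rho w"
  shows "Psi_ratio w u \<le> Psi_ratio w v"
proof -
  have "v < \<infinity>" using assms(2) by (rule less_le_trans) simp
  moreover have "u < \<infinity>" using assms(1) by (rule less_le_trans) simp
  ultimately obtain s s' where s: "u = ennreal s" "v = ennreal s'" "s \<ge> 0" "s' \<ge> 0" by (cases u; cases v) auto
  have ss: "s < s'" using assms(1) s by (simp add: ennreal_less_iff)
  obtain r where r: "s' < r" "summable (\<lambda>k. w k * r ^ k)"
    using less_rhoE[of s'] assms(2) s by auto
  have 1: "summable (\<lambda>k. w k * s' ^ k)" "summable (\<lambda>k. real k * w k * s' ^ k)"
    using summable_smaller[of s' r] summable_weighted[of s' r] r s by auto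
  have 2: "summable (\<lambda>k. w k * s ^ k)" "summable (\<lambda>k. real k * w k * s ^ k)"
    using summable_smaller[of s r] summable_weighted[of s r] r s ss by auto
  show ?thesis
  proof (cases "s = 0")
    case True
    have "(\<lambda>k. real k * w k * s ^ k) = (\<lambda>k. 0)"
    proof
      fix k show "real k * w k * s ^ k = 0" using True by (cases k) auto
    qed
    then show ?thesis using s 2 by (simp add: Psi_ratio_ennreal)
  next
    case False
    have nonneg: "(\<Sum>k. real k * w k * x ^ k) \<ge> 0" if "summable (\<lambda>k. real k * w k * x ^ k)" "x \<ge> 0" for x
      using that w by (intro suminf_nonneg) auto
    have "(\<Sum>k. real k * w k * s ^ k) / (\<Sum>k. w k * s ^ k)
        \<le> (\<Sum>k. real k * w k * s' ^ k) / (\<Sum>k. w k * s' ^ k)"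
      using Psi_ratio_less[of s s'] 1 False s ss by (intro less_imp_le) auto
    then show ?thesis
      using Phi_pos[of s] Phi_pos[of s'] nonneg[of s] nonneg[of s'] 1 2 s
      by (simp add: Psi_ratio_ennreal divide_ennreal ennreal_leI)
  qed
qed

section \<open>The cases of nu and the position of tau\<close>

lemma rho_pos_if_Phi_infinite:
  assumes "\<not> Phi w (rho w) < \<infinity>"
  shows "0 < rho w"
proof -
  have "Phi w (ennreal 0) < \<infinity>" by (subst Phi_finite_iff) (auto intro!: summable_finite[of "{0}"] simp: power_0_left split: if_splits)
  then have "rho w \<noteq> 0" using assms by auto
  then show ?thesis by (simp add: zero_less_iff_neq_zero)
qed

text \<open>Monotonicity turns the left limit in \<open>Psi\<close> into a supremum, from which both
  upper bounds below rho and witnesses above 1 can be read off.\<close>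

lemma nu_eq_SUP:
  assumes "\<not> Phi w (rho w) < \<infinity>"
  shows "nu w = (SUP u\<in>{..<rho w}. Psi_ratio w u)" (is "_ = ?l")
proof -
  have rho0: "0 < rho w" by (rule rho_pos_if_Phi_infinite) (rule assms)
  have "(Psi_ratio w \<longlongrightarrow> ?l) (at_left (rho w))"
  proof (rule increasing_tendsto)
    show "\<forall>\<^sub>F u in at_left (rho w). Psi_ratio w u \<le> ?l"
      unfolding eventually_at_left[OF rho0] by (intro exI[of _ 0]) (auto intro!: SUP_upper rho0)
    fix x assume "x < ?l"
    then obtain u where u: "u < rho w" "x < Psi_ratio w u" by (auto simp: less_SUP_iff)
    show "\<forall>\<^sub>F v in at_left (rho w). x < Psi_ratio w v"
      unfolding eventually_at_left[OF rho0]
      using u Psi_ratio_mono by (intro exI[of _ u]) (auto intro: order.strict_trans2)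
  qed
  moreover have "at_left (rho w) \<noteq> bot"
    unfolding trivial_limit_def eventually_at_left[OF rho0] using dense by blast
  ultimately have "Lim (at_left (rho w)) (Psi_ratio w) = ?l" by (intro tendsto_Lim)
  then show ?thesis using assms by (simp add: nu_def Psi_def)
qed

text \<open>Ensures that \<open>rho w\<close> is a real number as soon as \<open>Phi w\<close> is
  finite there.\<close>

lemma Phi_top: "Phi w \<infinity> = \<infinity>"
proof -
  obtain k where k: "k \<ge> 2" "w k > 0" using w2 by auto
  have "(\<Sum>j\<in>{k}. ennreal (w j) * \<infinity> ^ j) \<le> Phi w \<infinity>"
    unfolding Phi_def by (intro sum_le_suminf) auto
  moreover have "(\<Sum>j\<in>{k}. ennreal (w j) * \<infinity> ^ j) = \<infinity>"
    using k by (simp add: ennreal_mult_top power_eq_top_ennreal)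
  ultimately show ?thesis by (simp add: top_unique)
qed

lemma Psi_ratio_cmp_1:
  assumes "s \<ge> 0" and "summable (\<lambda>k. w k * s ^ k)" and "summable (\<lambda>k. real k * w k * s ^ k)"
  shows "Psi_ratio w (ennreal s) \<le> 1 \<longleftrightarrow> (\<Sum>k. real k * w k * s ^ k) \<le> (\<Sum>k. w k * s ^ k)"
    and "Psi_ratio w (ennreal s) = 1 \<longleftrightarrow> (\<Sum>k. real k * w k * s ^ k) = (\<Sum>k. w k * s ^ k)"
proof -
  have A: "(\<Sum>k. real k * w k * s ^ k) \<ge> 0" using assms w by (intro suminf_nonneg) auto
  have \<Phi>: "(\<Sum>k. w k * s ^ k) > 0" using Phi_pos assms by auto
  have "Psi_ratio w (ennreal s) = ennreal ((\<Sum>k. real k * w k * s ^ k) / (\<Sum>k. w k * s ^ k))"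
    using A \<Phi> by (simp add: Psi_ratio_ennreal[OF assms] divide_ennreal)
  then show "Psi_ratio w (ennreal s) \<le> 1 \<longleftrightarrow> (\<Sum>k. real k * w k * s ^ k) \<le> (\<Sum>k. w k * s ^ k)"
    and "Psi_ratio w (ennreal s) = 1 \<longleftrightarrow> (\<Sum>k. real k * w k * s ^ k) = (\<Sum>k. w k * s ^ k)"
    using \<Phi> by (auto simp: ennreal_le_1 ennreal_eq_1)
qed

lemma summable_below_rho:
  assumes "s \<ge> 0" "ennreal s < rho w"
  shows "summable (\<lambda>k. w k * s ^ k)" "summable (\<lambda>k. real k * w k * s ^ k)"
proof -
  obtain r where "s < r" "summable (\<lambda>k. w k * r ^ k)" using less_rhoE[OF assms] .
  then show "summable (\<lambda>k. w k * s ^ k)" "summable (\<lambda>k. real k * w k * s ^ k)"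
    using summable_smaller[of s r] summable_weighted[of s r] assms by auto
qed

text \<open>If Phi is finite at rho, the derivative series may still diverge there. One of its
  partial sums already exceeds \<open>Phi w (rho w)\<close> and, by continuity, still does slightly
  below rho, where all series converge.\<close>

lemma nu_gr_1_supercritical:
  assumes "nu w > 1"
  shows "\<exists>s\<ge>0. ennreal s < rho w \<and> (\<Sum>k. w k * s ^ k) < (\<Sum>k. real k * w k * s ^ k)"
proof (cases "Phi w (rho w) < \<infinity>")
  case False
  then obtain u where u: "u < rho w" "1 < Psi_ratio w u"
    using assms by (auto simp: nu_eq_SUP less_SUP_iff)
  have "u < \<infinity>" using u(1) by (rule less_le_trans) simp
  then obtain s where s: "u = ennreal s" "s \<ge> 0" by (cases u) auto
  then have less: "ennreal s < rho w" and "\<not> Psi_ratio w (ennreal s) \<le> 1" using u by (auto simp: not_le)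
  then have "\<not> (\<Sum>k. real k * w k * s ^ k) \<le> (\<Sum>k. w k * s ^ k)"
    using Psi_ratio_cmp_1(1)[OF s(2) summable_below_rho[OF s(2) less]] by simp
  then show ?thesis using s less by (intro exI[of _ s]) (simp add: not_le)
next
  case True
  then have "rho w \<noteq> \<infinity>" using Phi_top by auto
  then obtain r where r: "rho w = ennreal r" "r \<ge> 0" by (cases "rho w") auto
  have sm: "summable (\<lambda>k. w k * r ^ k)" using True r Phi_finite_iff[of r] by simp
  have \<Phi>: "Phi w (rho w) = ennreal (\<Sum>k. w k * r ^ k)" "(\<Sum>k. w k * r ^ k) > 0"
    using Phi_ennreal[of r] Phi_pos[of r] sm r by auto
  let ?num = "\<Sum>k. of_nat k * ennreal (w k) * rho w ^ k"
  have num: "1 < ?num / Phi w (rho w)" using assms True by (simp add: nu_def Psi_def Psi_ratio_def)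
  have "Phi w (rho w) < ?num"
  proof (rule ccontr)
    assume "\<not> ?thesis"
    then have "?num / Phi w (rho w) \<le> Phi w (rho w) / Phi w (rho w)"
      by (intro divide_right_mono_ennreal) simp
    also have "\<dots> = 1" using True \<Phi> by (intro ennreal_divide_self) auto
    finally show False using num by simp
  qed
  also have "?num = (\<Sum>k. ennreal (real k * w k * r ^ k))"
    using r w by (simp add: ennreal_power ennreal_mult ennreal_of_nat_eq_real_of_nat)
  also have "\<dots> = (SUP K. \<Sum>k<K. ennreal (real k * w k * r ^ k))" by (rule suminf_eq_SUP)
  finally obtain K where "Phi w (rho w) < (\<Sum>k<K. ennreal (real k * w k * r ^ k))"
    by (auto simp: less_SUP_iff)
  also have "\<dots> = ennreal (\<Sum>k<K. real k * w k * r ^ k)" using w r by (intro sum_ennreal) auto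
  finally have K: "(\<Sum>k. w k * r ^ k) < (\<Sum>k<K. real k * w k * r ^ k)"
    using \<Phi> by (simp add: ennreal_less_iff)
  have "r \<noteq> 0"
  proof
    assume "r = 0"
    have "(\<Sum>k<K. real k * w k * r ^ k) = 0"
      by (rule sum.neutral) (auto simp: \<open>r = 0\<close> power_0_left)
    with K \<Phi>(2) show False by simp
  qed
  then have r0: "r > 0" using r by simp
  have "((\<lambda>s. \<Sum>k<K. real k * w k * s ^ k) \<longlongrightarrow> (\<Sum>k<K. real k * w k * r ^ k)) (at_left r)"
    by (intro tendsto_intros)
  then have "\<forall>\<^sub>F s in at_left r. (\<Sum>k. w k * r ^ k) < (\<Sum>k<K. real k * w k * s ^ k)"
    using K by (rule order_tendstoD)
  moreover have "\<forall>\<^sub>F s in at_left r. s \<in> {0<..<r}" using r0 by (rule eventually_at_left_real)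
  ultimately have "\<forall>\<^sub>F s in at_left r. (\<Sum>k. w k * r ^ k) < (\<Sum>k<K. real k * w k * s ^ k) \<and> s \<in> {0<..<r}"
    by (rule eventually_conj)
  then obtain s where s: "(\<Sum>k. w k * r ^ k) < (\<Sum>k<K. real k * w k * s ^ k)" "0 < s" "s < r"
    using eventually_happens[of _ "at_left r"] by fastforce
  have less: "ennreal s < rho w" using s r by (simp add: ennreal_less_iff)
  note sms = summable_below_rho[OF less_imp_le[OF s(2)] less]
  have "(\<Sum>k. w k * s ^ k) \<le> (\<Sum>k. w k * r ^ k)"
    using w s by (intro suminf_le sms sm mult_left_mono power_mono) auto
  also note s(1)
  also have "(\<Sum>k<K. real k * w k * s ^ k) \<le> (\<Sum>k. real k * w k * s ^ k)"
    using w s by (intro sum_le_suminf sms) auto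
  finally show ?thesis using s less by (intro exI[of _ s]) auto
qed

lemma critical_point_exists:
  assumes "nu w > 1"
  shows "\<exists>s>0. ennreal s < rho w \<and> (\<Sum>k. real k * w k * s ^ k) = (\<Sum>k. w k * s ^ k)"
proof -
  obtain b where b: "b \<ge> 0" "ennreal b < rho w" "(\<Sum>k. w k * b ^ k) < (\<Sum>k. real k * w k * b ^ k)"
    using nu_gr_1_supercritical[OF assms] by auto
  obtain r where r: "b < r" "summable (\<lambda>k. w k * r ^ k)" using less_rhoE[OF b(1,2)] .
  \<comment> \<open>Continuity of the power series up to b requires convergence of both series at a
    point beyond b.\<close>
  define q where "q = (b + r) / 2"
  have q: "b < q" "q < r" using r by (auto simp: q_def)
  have sumq: "summable (\<lambda>k. w k * q ^ k)" "summable (\<lambda>k. real k * w k * q ^ k)"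
    using summable_smaller[of q r] summable_weighted[of q r] q r b by auto
  let ?f = "\<lambda>s. (\<Sum>k. real k * w k * s ^ k) - (\<Sum>k. w k * s ^ k)"
  have cont: "continuous_on {0..b} ?f"
  proof (intro continuous_at_imp_continuous_on ballI continuous_intros)
    fix s assume "s \<in> {0..b}"
    then have "norm s < norm q" using q by auto
    then show "isCont (\<lambda>s. \<Sum>k. real k * w k * s ^ k) s" "isCont (\<lambda>s. \<Sum>k. w k * s ^ k) s"
      using sumq by (auto intro: Transcendental.isCont_powser)
  qed
  have f0: "?f 0 < 0"
  proof -
    have "(\<lambda>k. real k * w k * 0 ^ k) = (\<lambda>k. 0)" by (rule ext) (simp add: power_0_left)
    moreover have "(\<Sum>k. w k * 0 ^ k) > 0"
      using summable_smaller[of 0 r] r b by (intro Phi_pos) auto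
    ultimately show ?thesis by simp
  qed
  obtain s where s: "0 \<le> s" "s \<le> b" "?f s = 0"
    using IVT'[of ?f 0 0 b] f0 b cont by (auto simp: less_imp_le)
  have "s \<noteq> 0" using s f0 by auto
  moreover have "ennreal s < rho w" using s b by (meson ennreal_leI le_less_trans)
  ultimately show ?thesis using s by (intro exI[of _ s]) auto
qed

text \<open>Strict monotonicity of the ratio makes the solution in the definition of
  \<open>tau\<close> unique; 0 is no solution because the numerator vanishes there.\<close>

lemma tau_eq:
  assumes nu: "nu w > 1" and s: "s > 0" "ennreal s < rho w"
    and crit: "(\<Sum>k. real k * w k * s ^ k) = (\<Sum>k. w k * s ^ k)"
  shows "tau w = ennreal s"
proof -
  have Psi: "Psi w (ennreal x) = Psi_ratio w (ennreal x)" if "x \<ge> 0" "ennreal x < rho w" for x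
    using summable_below_rho[OF that] Phi_finite_iff[OF that(1)] by (simp add: Psi_def)
  have "(THE u. u < rho w \<and> Psi w u = 1) = ennreal s"
  proof (rule the_equality)
    show "ennreal s < rho w \<and> Psi w (ennreal s) = 1"
      using s crit Psi[of s] Psi_ratio_cmp_1(2)[of s] summable_below_rho[of s] by simp
    fix u assume u: "u < rho w \<and> Psi w u = 1"
    then have "u < \<infinity>" by (auto intro: less_le_trans)
    then obtain x where x: "u = ennreal x" "x \<ge> 0" by (cases u) auto
    have sx: "summable (\<lambda>k. w k * x ^ k)" "summable (\<lambda>k. real k * w k * x ^ k)"
      using summable_below_rho[of x] u x by auto
    have ss: "summable (\<lambda>k. w k * s ^ k)" "summable (\<lambda>k. real k * w k * s ^ k)"
      using summable_below_rho[of s] s by auto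
    have cx: "(\<Sum>k. real k * w k * x ^ k) = (\<Sum>k. w k * x ^ k)"
      using u x Psi[of x] Psi_ratio_cmp_1(2)[OF x(2) sx] by simp
    have px: "(\<Sum>k. w k * x ^ k) > 0" and ps: "(\<Sum>k. w k * s ^ k) > 0"
      using Phi_pos[OF x(2) sx(1)] Phi_pos[of s] ss s by auto
    have "x \<noteq> 0"
    proof
      assume "x = 0"
      then have "(\<lambda>k. real k * w k * x ^ k) = (\<lambda>k. 0)" by (intro ext) (simp add: power_0_left)
      with cx px show False by simp
    qed
    then have x0: "x > 0" using x by simp
    have "x = s"
    proof (rule ccontr)
      assume "x \<noteq> s"
      then consider "x < s" | "s < x" by linarith
      then show False
      proof cases
        case 1
        from Psi_ratio_less[OF x0 1 ss] show False using cx crit px ps by simp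
      next
        case 2
        from Psi_ratio_less[OF s(1) 2 sx] show False using cx crit px ps by simp
      qed
    qed
    then show "u = ennreal s" by (simp add: x)
  qed
  moreover have "\<not> nu w \<le> 1" using nu by simp
  ultimately show ?thesis by (simp add: tau_def)
qed

text \<open>Since Psi is at most 1 below rho, Phi(s) / s stays below its value at y for s > y. For
  finite rho this linear bound survives the limit; for infinite rho it contradicts a positive weight
  of index at least 2.\<close>

lemma nu_le_1_Phi_rho_finite:
  assumes nu: "nu w \<le> 1" and y: "y > 0" "summable (\<lambda>k. w k * y ^ k)"
  shows "Phi w (rho w) < \<infinity>"
proof (rule ccontr)
  assume inf: "\<not> Phi w (rho w) < \<infinity>"
  define B where "B = (\<Sum>k. w k * y ^ k) / y"
  have "Phi w (ennreal y) < \<infinity>" using y by (simp add: Phi_ennreal)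
  then have y_rho: "ennreal y < rho w" using le_rho[of y] y inf by (metis less_imp_le order_le_less)
  have bound: "(\<Sum>k. w k * s ^ k) \<le> s * B" if s: "y < s" "ennreal s < rho w" for s
  proof -
    have s0: "s \<ge> 0" using s y by simp
    have "Psi_ratio w (ennreal s) \<le> nu w" unfolding nu_eq_SUP[OF inf] using s by (intro SUP_upper) auto
    then have "Psi_ratio w (ennreal s) \<le> 1" using nu by simp
    then have "(\<Sum>k. real k * w k * s ^ k) \<le> (\<Sum>k. w k * s ^ k)"
      using Psi_ratio_cmp_1(1)[OF s0 summable_below_rho[OF s0 s(2)]] by simp
    then have "y * (\<Sum>k. w k * s ^ k) \<le> s * (\<Sum>k. w k * y ^ k)"
      using s y by (intro Phi_tangent summable_below_rho[OF s0 s(2)]) auto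
    then show ?thesis using y by (simp add: B_def field_simps)
  qed
  show False
  proof (cases "rho w")
    case (real r)
    then have yr: "y < r" using y_rho y by (simp add: ennreal_less_iff)
    have B0: "B \<ge> 0" using Phi_pos[of y] y by (simp add: B_def)
    have "(\<Sum>k<K. w k * r ^ k) \<le> r * B" for K
    proof (rule tendsto_upperbound)
      show "((\<lambda>s. \<Sum>k<K. w k * s ^ k) \<longlongrightarrow> (\<Sum>k<K. w k * r ^ k)) (at_left r)"
        by (intro tendsto_intros)
      show "\<forall>\<^sub>F s in at_left r. (\<Sum>k<K. w k * s ^ k) \<le> r * B"
        using eventually_at_left_real[OF yr]
      proof eventually_elim
        case (elim s)
        then have s: "y < s" "s < r" by auto
        then have less: "ennreal s < rho w" using real y by (simp add: ennreal_less_iff)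
        have "(\<Sum>k<K. w k * s ^ k) \<le> (\<Sum>k. w k * s ^ k)"
          using w s y summable_below_rho(1)[OF _ less] by (intro sum_le_suminf) auto
        also have "\<dots> \<le> s * B" by (rule bound) (use s less in auto)
        also have "\<dots> \<le> r * B" using s B0 by (intro mult_right_mono) auto
        finally show ?case .
      qed
    qed simp
    then have "summable (\<lambda>k. w k * r ^ k)"
      using w real by (intro summableI_nonneg_bounded[where x = "r * B"]) auto
    then show False using inf real Phi_finite_iff[of r] by simp
  next
    case top
    obtain k where k: "k \<ge> 2" "w k > 0" using w2 by auto
    define s where "s = max (y + 1) (max 1 (B / w k + 1))"
    have s: "y < s" "s \<ge> 1" "s > B / w k" by (auto simp: s_def)
    have less: "ennreal s < rho w" using top by simp
    have "w k * s\<^sup>2 \<le> w k * s ^ k"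
      using k s by (intro mult_left_mono power_increasing) auto
    also have "\<dots> = (\<Sum>j\<in>{k}. w j * s ^ j)" by simp
    also have "\<dots> \<le> (\<Sum>j. w j * s ^ j)"
      using w s summable_below_rho(1)[OF _ less] by (intro sum_le_suminf) auto
    also have "\<dots> \<le> s * B" by (rule bound) (use s less in auto)
    finally have "s * (w k * s) \<le> s * B" by (simp add: power2_eq_square mult_ac)
    then have "w k * s \<le> B" using s by simp
    moreover have "B < w k * s" using s(3) k by (simp add: field_simps)
    ultimately show False by simp
  qed
qed

text \<open>If \<open>\<rho> = 0\<close> there is no admissible \<open>y\<close>, and the hypothesis holds for trivial reasons.\<close>

lemma weight_1_tilt_le:
  assumes \<epsilon>: "\<epsilon> < 1" and hyp: "ennreal (w 1) * tau w / Phi w (tau w) < ennreal (1 - \<epsilon>)"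
    and y: "y > 0" "summable (\<lambda>k. w k * y ^ k)"
  shows "w 1 * y \<le> (1 - \<epsilon>) * (\<Sum>k. w k * y ^ k)"
proof -
  have "\<exists>s>0. tau w = ennreal s \<and> summable (\<lambda>k. w k * s ^ k)
      \<and> y * (\<Sum>k. w k * s ^ k) \<le> s * (\<Sum>k. w k * y ^ k)"
  proof (cases "nu w \<le> 1")
    case True
    then have tau: "tau w = rho w" by (simp add: tau_def)
    have fin: "Phi w (rho w) < \<infinity>" using True y by (rule nu_le_1_Phi_rho_finite)
    then have "rho w \<noteq> \<infinity>" using Phi_top by auto
    then obtain r where r: "rho w = ennreal r" "r \<ge> 0" by (cases "rho w") auto
    have yr: "y \<le> r" using le_rho[of y] y r by simp
    have sm: "summable (\<lambda>k. w k * r ^ k)" using fin r Phi_finite_iff[of r] by simp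
    have \<Phi>: "Phi w (rho w) = ennreal (\<Sum>k. w k * r ^ k)" "(\<Sum>k. w k * r ^ k) > 0"
      using Phi_ennreal[of r] Phi_pos[of r] sm r by auto
    have "Psi_ratio w (rho w) \<le> 1" using True fin by (simp add: nu_def Psi_def)
    \<comment> \<open>An infinite numerator over a finite Phi would give an infinite ratio. The
      tangent inequality at rho needs the derivative series to converge.\<close>
    then have "(\<Sum>k. of_nat k * ennreal (w k) * rho w ^ k) \<noteq> \<infinity>"
      using fin by (auto simp: Psi_ratio_def ennreal_top_divide top_unique split: if_splits)
    moreover have "(\<Sum>k. of_nat k * ennreal (w k) * rho w ^ k) = (\<Sum>k. ennreal (real k * w k * r ^ k))"
      using r w by (simp add: ennreal_power ennreal_mult ennreal_of_nat_eq_real_of_nat)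
    ultimately have smA: "summable (\<lambda>k. real k * w k * r ^ k)"
      using w r by (intro summable_suminf_not_top) auto
    have "(\<Sum>k. real k * w k * r ^ k) \<le> (\<Sum>k. w k * r ^ k)"
      using \<open>Psi_ratio w (rho w) \<le> 1\<close> Psi_ratio_cmp_1(1)[OF r(2) sm smA] r by simp
    then have "y * (\<Sum>k. w k * r ^ k) \<le> r * (\<Sum>k. w k * y ^ k)"
      using y yr by (intro Phi_tangent sm smA) auto
    then show ?thesis using tau r sm y yr by (intro exI[of _ r]) auto
  next
    case False
    then obtain s where s: "s > 0" "ennreal s < rho w" "(\<Sum>k. real k * w k * s ^ k) = (\<Sum>k. w k * s ^ k)"
      using critical_point_exists by (auto simp: not_le)
    have "tau w = ennreal s" using False s by (intro tau_eq) auto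
    moreover have sm: "summable (\<lambda>k. w k * s ^ k)" "summable (\<lambda>k. real k * w k * s ^ k)"
      using summable_below_rho[of s] s by auto
    moreover have "y * (\<Sum>k. w k * s ^ k) \<le> s * (\<Sum>k. w k * y ^ k)"
      using s y by (intro Phi_tangent sm) auto
    ultimately show ?thesis using s by (intro exI[of _ s]) auto
  qed
  then obtain s where s: "s > 0" "tau w = ennreal s" "summable (\<lambda>k. w k * s ^ k)"
    and tangent: "y * (\<Sum>k. w k * s ^ k) \<le> s * (\<Sum>k. w k * y ^ k)" by blast
  let ?S = "\<Sum>k. w k * s ^ k" and ?Y = "\<Sum>k. w k * y ^ k"
  have pos: "?S > 0" "?Y > 0" using Phi_pos s y by auto
  have "ennreal (w 1 * s / ?S) < ennreal (1 - \<epsilon>)"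
    using hyp s pos w[of 1] by (simp add: Phi_ennreal divide_ennreal flip: ennreal_mult)
  then have "w 1 * s / ?S < 1 - \<epsilon>" using w[of 1] s pos by (subst (asm) ennreal_less_iff) auto
  then have "w 1 * s \<le> (1 - \<epsilon>) * ?S" using pos by (simp add: pos_divide_less_eq less_imp_le)
  then have "w 1 * s * ?Y \<le> (1 - \<epsilon>) * ?S * ?Y" using pos by (intro mult_right_mono) auto
  moreover have "w 1 * (y * ?S) \<le> w 1 * (s * ?Y)" using tangent w[of 1] by (intro mult_left_mono) auto
  ultimately have "(w 1 * y) * ?S \<le> ((1 - \<epsilon>) * ?Y) * ?S" by (simp add: mult_ac)
  then show ?thesis using pos by (subst (asm) mult_le_cancel_right_pos)
qed

end

section \<open>The height of a simply generated tree\<close>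

lemma is_vertex_prefix: "is_vertex t (u @ v) \<Longrightarrow> is_vertex t u"
proof (induction u arbitrary: t)
  case (Cons i u)
  from Cons.prems show ?case
    by (cases rule: is_vertex.cases) (auto intro: is_vertex.intros Cons.IH)
qed (rule is_vertex.intros)

lemma vertex_reachable: "v \<in> vertices t \<Longrightarrow> ([], v) \<in> edges t ^^ length v"
proof (induction v rule: rev_induct)
  case (snoc i v)
  then have v: "v \<in> vertices t" using is_vertex_prefix by (auto simp: vertices_def)
  then have "(v, v @ [i]) \<in> edges t" using snoc.prems by (auto simp: edges_def)
  then show ?case using relpow_Suc_I[OF snoc.IH[OF v]] by simp
qed simp

lemma length_vertex_less_levels: "v \<in> vertices t \<Longrightarrow> length v < levels t"
proof (induction t arbitrary: v)
  case (Node ts)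
  show ?case
  proof (cases v)
    case (Cons i u)
    then have i: "i < length ts" "u \<in> vertices (ts ! i)" using Node.prems by (auto simp: vertices_Node)
    then have "length u < levels (ts ! i)" by (intro Node.IH) auto
    also have "\<dots> \<le> Max (insert 0 (set (map levels ts)))" using i by (intro Max_ge) auto
    finally show ?thesis using Cons by simp
  qed simp
qed

text \<open>The distance to a vertex is at most its depth. Strictness reflects that
  \<open>levels\<close> counts vertices, and turns a height of at least h into more than h
  levels.\<close>

lemma height_less_levels: "height t < levels t"
proof -
  have "[] \<in> vertices t" by (auto simp: vertices_def intro: is_vertex.intros)
  moreover have "graph_dist t [] v < levels t" if v: "v \<in> vertices t" for v
  proof -
    have "graph_dist t [] v \<le> length v"
      unfolding graph_dist_def by (rule Least_le) (rule vertex_reachable[OF v])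
    then show ?thesis using length_vertex_less_levels[OF v] by simp
  qed
  ultimately show ?thesis unfolding height_def by (subst Max_less_iff) (auto simp: finite_vertices)
qed

text \<open>With this, \<open>heavy_levels_le_size\<close> also bounds \<open>levels\<close> by the
  number of vertices.\<close>

lemma heavy_levels_0: "heavy_levels 0 t = levels t"
proof (induction t)
  case (Node ts)
  then have "map (heavy_levels 0) ts = map levels ts" by simp
  then show ?case by simp
qed

text \<open>Entries other than 0 and 1 are at least 2. For the degrees of a tree, whose sum is one
  less than their number, a shortage of ones thus forces zeros.\<close>

lemma count_0_ge: "2 * size c \<le> sum_mset c + 2 * count c 0 + count c 1" for c :: "nat multiset"
  by (induction c) auto

theorem theorem20:
  fixes \<epsilon> :: real
  assumes "0 < \<epsilon>" and "\<epsilon> < 1"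
  shows "\<exists>c1>0. \<exists>c2>0. \<forall>w :: nat \<Rightarrow> real.
    (\<forall>k. w k \<ge> 0) \<and> w 0 > 0 \<and> (\<exists>k\<ge>2. w k > 0) \<and>
    ennreal (w 1) * tau w / Phi w (tau w) < ennreal (1 - \<epsilon>) \<longrightarrow>
    (\<exists>N. \<forall>t>1. \<forall>n\<ge>N. partition_function w n > 0 \<longrightarrow>
      measure_pmf.prob (simply_generated_tree w n) {T. real (height T) \<ge> t * sqrt (real n)}
        < c1 * exp (- c2 * t ^ 2))"
proof -
  \<comment> \<open>If fewer than (1 - \<epsilon> / 4) n vertices have exactly one child, then more
    than \<epsilon> n / 8 vertices are leaves, because twice the leaves plus these vertices number
    at least n + 1.\<close>
  have "0 < \<epsilon> / 8" using assms by simp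
  from card_tree_class_levels_le[OF this] obtain C \<gamma> N0 where C: "C > 0" and \<gamma>: "\<gamma> > 0"
    and class_le: "\<And>c t. size c \<ge> N0 \<Longrightarrow> \<epsilon> / 8 * size c \<le> count c 0 \<Longrightarrow> t > 1 \<Longrightarrow>
      real (card {T \<in> tree_class c. levels T > t * sqrt (size c)}) \<le> C * exp (- \<gamma> * t\<^sup>2) * card (tree_class c)"
    by blast
  \<comment> \<open>Half of the rate \<epsilon>^2 / 64 of the leaf estimate, the other half being
    reserved for its prefactor.\<close>
  define c2 where "c2 = min \<gamma> (\<epsilon>\<^sup>2 / 128)"
  have c2: "c2 > 0" "c2 \<le> \<gamma>" "c2 \<le> \<epsilon>\<^sup>2 / 128" using \<gamma> assms by (auto simp: c2_def)
  \<comment> \<open>\<open>C\<close> bounds the trees with enough leaves, 1 the remaining trees, and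
    the last 1 makes the inequality strict.\<close>
  show ?thesis
  proof (rule exI[of _ "C + 2"], intro exI[of _ c2] conjI allI impI)
    show "C + 2 > 0" "c2 > 0" using C c2 by auto
    fix w :: "nat \<Rightarrow> real"
    assume asm: "(\<forall>k. w k \<ge> 0) \<and> w 0 > 0 \<and> (\<exists>k\<ge>2. w k > 0) \<and>
      ennreal (w 1) * tau w / Phi w (tau w) < ennreal (1 - \<epsilon>)"
    then have w: "\<And>k. w k \<ge> 0" and w0: "w 0 > 0" and w2: "\<exists>k\<ge>2. w k > 0"
      and hyp: "ennreal (w 1) * tau w / Phi w (tau w) < ennreal (1 - \<epsilon>)" by auto
    obtain k where k: "k \<ge> 2" "w k > 0" using w2 by auto
    obtain Cw where Cw: "Cw > 0" "\<And>j. w 1 ^ j \<le> Cw * (1 - \<epsilon> / 2) ^ j * fps_nth (Abs_fps w ^ j) j"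
      using power_weight_1_le[OF w w0 k assms weight_1_tilt_le[OF w w0 w2 assms(2) hyp]] by auto
    \<comment> \<open>The threshold \<open>N1\<close> is the only one that depends on the
      weights.\<close>
    have "(\<lambda>n. Cw * exp (- (\<epsilon>\<^sup>2 / 128) * real n)) \<longlonglongrightarrow> 0" using assms(1) by real_asymp
    then have "eventually (\<lambda>n. Cw * exp (- (\<epsilon>\<^sup>2 / 128) * real n) < 1) sequentially"
      by (rule order_tendstoD) simp
    then obtain N1 where N1: "\<And>n. n \<ge> N1 \<Longrightarrow> Cw * exp (- (\<epsilon>\<^sup>2 / 128) * real n) < 1"
      by (auto simp: eventually_sequentially)
    show "\<exists>N. \<forall>t>1. \<forall>n\<ge>N. partition_function w n > 0 \<longrightarrow>
      measure_pmf.prob (simply_generated_tree w n) {T. real (height T) \<ge> t * sqrt (real n)}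
        < (C + 2) * exp (- c2 * t ^ 2)"
    proof (intro exI[of _ "max 1 (max N0 N1)"] allI impI)
      fix t :: real and n :: nat
      assume t: "1 < t" and n: "max 1 (max N0 N1) \<le> n" and Z: "partition_function w n > 0"
      define h where "h = t * sqrt (real n)"
      define p where "p = simply_generated_tree w n"
      let ?Z = "partition_function w n" and ?E = "{T. real (height T) \<ge> h}"
      have weight0: "weight w T \<ge> 0" for T
        unfolding weight_eq by (intro prod_list_nonneg) (use w in auto)
      have pmf: "pmf p T = (if T \<in> trees n then weight w T / ?Z else 0)" for T
        unfolding p_def using w Z by (rule pmf_simply_generated_tree)
      have set_p: "set_pmf p \<subseteq> trees n" by (auto simp: set_pmf_iff pmf split: if_splits)
      define f where "f = (\<lambda>T. if levels T > h then weight w T else 0)"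
      have "measure_pmf.prob p ?E = measure_pmf.prob p (?E \<inter> set_pmf p)"
        by (simp add: measure_Int_set_pmf)
      also have "\<dots> = (\<Sum>T\<in>?E \<inter> set_pmf p. pmf p T)"
        using finite_subset[OF set_p finite_trees] by (intro measure_measure_pmf_finite) auto
      also have "\<dots> \<le> (\<Sum>T\<in>?E \<inter> set_pmf p. f T / ?Z)"
      proof (intro sum_mono)
        fix T assume T: "T \<in> ?E \<inter> set_pmf p"
        then have "levels T > h" using height_less_levels[of T] by simp
        then show "pmf p T \<le> f T / ?Z" using Z weight0 by (simp add: pmf f_def)
      qed
      also have "\<dots> \<le> (\<Sum>T\<in>trees n. f T / ?Z)"
        using set_p Z weight0 by (intro sum_mono2) (auto simp: finite_trees f_def)
      finally have prob_le: "measure_pmf.prob p ?E \<le> (\<Sum>T\<in>trees n. f T) / ?Z"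
        by (simp add: sum_divide_distrib)
      have "(\<Sum>T\<in>trees n. f T) \<le> (C + 1) * exp (- c2 * t\<^sup>2) * ?Z"
      \<comment> \<open>For t^2 > n no tree is high enough, as n < t n^(1/2). Otherwise a bound
        exponential in n is also one in t^2.\<close>
      proof (cases "t\<^sup>2 \<le> n")
        case False
        have "f T = 0" if T: "T \<in> trees n" for T
        proof -
          have "sqrt n < t" using False t by (intro real_less_lsqrt) auto
          then have "sqrt n * sqrt n \<le> h" unfolding h_def by (intro mult_right_mono) auto
          moreover have "levels T \<le> n"
            using heavy_levels_le_size[of 0 T] T by (simp add: heavy_levels_0 trees_eq)
          ultimately show ?thesis by (simp add: f_def)
        qed
        then show ?thesis using C Z by simp
      next
        case True
        define f1 where "f1 = (\<lambda>T. if (1 - \<epsilon> / 4) * n \<le> count (mset (degree_word T)) 1 then weight w T else 0)"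
        define f2 where "f2 = (\<lambda>T. if \<epsilon> / 8 * n \<le> count (mset (degree_word T)) 0 then f T else 0)"
        have "(\<Sum>T\<in>trees n. f T) \<le> (\<Sum>T\<in>trees n. f1 T + f2 T)"
        proof (intro sum_mono)
          fix T assume T: "T \<in> trees n"
          have "2 * size (mset (degree_word T)) \<le> sum_mset (mset (degree_word T))
              + 2 * count (mset (degree_word T)) 0 + count (mset (degree_word T)) 1" by (rule count_0_ge)
          then have "n + 1 \<le> 2 * count (mset (degree_word T)) 0 + count (mset (degree_word T)) 1"
            using sum_degree_word[of T] T by (simp add: trees_eq sum_mset_sum_list)
          then have "real n + 1 \<le> 2 * real (count (mset (degree_word T)) 0) + real (count (mset (degree_word T)) 1)"
            by linarith
          then have "(1 - \<epsilon> / 4) * n \<le> count (mset (degree_word T)) 1 \<or> \<epsilon> / 8 * n \<le> count (mset (degree_word T)) 0"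
            by (simp add: algebra_simps) linarith
          then show "f T \<le> f1 T + f2 T" using weight0[of T] by (auto simp: f1_def f2_def f_def)
        qed
        also have "\<dots> = (\<Sum>T\<in>trees n. f1 T) + (\<Sum>T\<in>trees n. f2 T)" by (rule sum.distrib)
        also have "(\<Sum>T\<in>trees n. f1 T) \<le> exp (- c2 * t\<^sup>2) * ?Z"
        proof -
          have "(\<Sum>T\<in>trees n. f1 T)
              = (\<Sum>T\<in>{T \<in> trees n. (1 - \<epsilon> / 4) * n \<le> count (mset (degree_word T)) 1}. weight w T)"
            unfolding f1_def by (rule sum.inter_filter[symmetric]) (rule finite_trees)
          also have "\<dots> \<le> Cw * exp (- (\<epsilon>\<^sup>2 / 64) * n) * ?Z"
            using n by (intro sum_weight_many_ones_le w assms Cw(2)) auto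
          also have "Cw * exp (- (\<epsilon>\<^sup>2 / 64) * n)
              = Cw * exp (- (\<epsilon>\<^sup>2 / 128) * n) * exp (- (\<epsilon>\<^sup>2 / 128) * n)"
            by (simp flip: exp_add)
          also have "\<dots> \<le> 1 * exp (- c2 * t\<^sup>2)"
          proof (intro mult_mono)
            show "Cw * exp (- (\<epsilon>\<^sup>2 / 128) * n) \<le> 1" using N1[of n] n by simp
            have "c2 * t\<^sup>2 \<le> \<epsilon>\<^sup>2 / 128 * n" using c2 True by (intro mult_mono) auto
            then show "exp (- (\<epsilon>\<^sup>2 / 128) * n) \<le> exp (- c2 * t\<^sup>2)" by simp
          qed auto
          finally show ?thesis using Z by simp
        qed
        also have "(\<Sum>T\<in>trees n. f2 T) \<le> C * exp (- c2 * t\<^sup>2) * ?Z"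
        proof -
          have class_f2_le: "(\<Sum>T\<in>tree_class c. f2 T) \<le> C * exp (- c2 * t\<^sup>2) * (\<Sum>T\<in>tree_class c. weight w T)"
            if c: "c \<in> mset ` degree_word ` trees n" for c
          proof -
            have size: "size c = n" using c by (auto simp: trees_eq)
            \<comment> \<open>The weight depends on the degrees only, so within a class the bound on
              the number of high trees is a bound on their weight.\<close>
            define \<omega> where "\<omega> = prod_mset (image_mset w c)"
            have weight: "weight w T = \<omega>" if "T \<in> tree_class c" for T
              using weight_tree_class[OF that] by (simp add: \<omega>_def)
            have \<omega>0: "\<omega> \<ge> 0"
            proof -
              have "prod_mset (image_mset w d) \<ge> 0" for d using w by (induction d) auto
              then show ?thesis by (simp add: \<omega>_def)
            qed
            have total: "(\<Sum>T\<in>tree_class c. weight w T) = \<omega> * card (tree_class c)"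
              by (simp add: weight)
            show ?thesis
            proof (cases "\<epsilon> / 8 * n \<le> count c 0")
              case True
              have "(\<Sum>T\<in>tree_class c. f2 T) = (\<Sum>T\<in>tree_class c. if levels T > h then \<omega> else 0)"
                using True by (intro sum.cong refl) (auto simp: f2_def f_def weight tree_class_def)
              also have "\<dots> = (\<Sum>T\<in>{T \<in> tree_class c. levels T > h}. \<omega>)"
                by (rule sum.inter_filter[symmetric]) simp
              also have "\<dots> = \<omega> * card {T \<in> tree_class c. levels T > t * sqrt (size c)}"
                by (simp add: h_def size)
              also have "\<dots> \<le> \<omega> * (C * exp (- \<gamma> * t\<^sup>2) * card (tree_class c))"
                using n t True size \<omega>0 by (intro mult_left_mono class_le) auto
              also have "\<dots> \<le> \<omega> * (C * exp (- c2 * t\<^sup>2) * card (tree_class c))"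
                using c2 C \<omega>0 by (intro mult_left_mono mult_right_mono) (auto simp: mult_right_mono)
              finally show ?thesis by (simp add: total mult_ac)
            next
              case False
              then have "(\<Sum>T\<in>tree_class c. f2 T) = 0"
                by (intro sum.neutral) (auto simp: f2_def tree_class_def)
              then show ?thesis using C \<omega>0 by (simp add: total)
            qed
          qed
          have "(\<Sum>T\<in>trees n. f2 T) = (\<Sum>c\<in>mset ` degree_word ` trees n. \<Sum>T\<in>tree_class c. f2 T)"
            by (rule sum_trees_group)
          also have "\<dots> \<le> (\<Sum>c\<in>mset ` degree_word ` trees n.
              C * exp (- c2 * t\<^sup>2) * (\<Sum>T\<in>tree_class c. weight w T))"
            by (rule sum_mono) (rule class_f2_le)
          also have "\<dots> = C * exp (- c2 * t\<^sup>2) * ?Z"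
            by (simp only: partition_function_def sum_trees_group sum_distrib_left)
          finally show ?thesis .
        qed
        finally show ?thesis by (simp add: algebra_simps)
      qed
      then have "(\<Sum>T\<in>trees n. f T) / ?Z \<le> (C + 1) * exp (- c2 * t\<^sup>2)"
        using Z by (simp add: divide_le_eq)
      also have "\<dots> < (C + 2) * exp (- c2 * t\<^sup>2)" by simp
      finally show "measure_pmf.prob (simply_generated_tree w n) {T. real (height T) \<ge> t * sqrt (real n)}
        < (C + 2) * exp (- c2 * t ^ 2)"
        using prob_le by (simp add: p_def h_def)
    qed
  qed
qed

end
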